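(* Let $(u_h,\widetilde{\mathtt d}_h)\in\mathcal S^1(\mathcal T_h)\times\mathcal H_m^h$ be a minimizer of $E_h$. Consider the block coordinate descent algorithm: given an initial iterate $u_h^{(0)}\in\mathcal S^1(\mathcal T_h)$, for every $i\in\mathbb N_0$ perform Step 1: compute $\mathtt C_{u_h^{(i)}}>0$ implicitly defined by $\mathtt C_{u_h^{(i)}}=\frac1{m\beta}\|I_h\{(|u_h^{(i)}-u_\infty^h|-\mathtt C_{u_h^{(i)}})_+\}\|_{1,\Gamma_I}$; Step 2: compute $\widetilde{\mathtt d}_h^{(i)}\in\mathcal H_m^h$ given via $\widetilde{\mathtt d}_h^{(i)}:=\frac1{\mathtt C_{u_h^{(i)}}\beta}I_h\{(|u_h^{(i)}-u_\infty^h|-\mathtt C_{u_h^{(i)}})_+\}$ on $\Gamma_I$; Step 3: compute $u_h^{(i+1)}\in\mathcal S^1(\mathcal T_h)$ such that for every $v_h\in\mathcal S^1(\mathcal T_h)$ $$\kappa(\nabla u_h^{(i+1)},\nabla v_h)_\Omega+\beta\bigl((1+\beta\widetilde{\mathtt d}_h^{(i)})^{-1}(u_h^{(i+1)}-u_\infty^h),v_h\bigr)_{\Gamma_I,h}=(f_h,v_h)_\Omega+(g_h,v_h)_{\Gamma_N}.$$ Then the following statements apply. (i) The algorithm is well-posed, i.e., for every $i\in\mathbb N_0$ the iterate $(u_h^{(i+1)},\mathtt C_{u_h^{(i)}},\widetilde{\mathtt d}_h^{(i)})\in\mathcal S^1(\mathcal T_h)\times\mathbb R_{>0}\times\mathcal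 H_m^h$ is computable according to Steps 1--3. (ii) If, in addition, the discrete non-degeneracy condition $$\delta_{\star,h}:=\operatorname{dist}_{\mathcal S^1(\mathcal S_h^I)}\Bigl(1,\tfrac{\beta(u_h-u_\infty^h)}{1+\beta\widetilde{\mathtt d}_h}\,\widetilde{\mathcal S}^1(\mathcal S_h^I)\Bigr)>0,\qquad\widetilde{\mathcal S}^1(\mathcal S_h^I):=\{\eta_h\in\mathcal S^1(\mathcal S_h^I)\mid(\eta_h,1)_{\Gamma_I,h}=0\},$$ is satisfied, then the algorithm is linearly convergent, i.e., for every $i\in\mathbb N_0$ there holds $$\sigma_h\|u_h^{(i)}-u_h\|_{H^1(\Omega)}^2\le E_h(u_h^{(i)},\widetilde{\mathtt d}_h^{(i)})-E_h(u_h,\widetilde{\mathtt d}_h)\le\bigl(1-\tfrac{\sigma_h}{8L}\bigr)^i\bigl(E_h(u_h^{(0)},\widetilde{\mathtt d}_h^{(0)})-E_h(u_h,\widetilde{\mathtt d}_h)\bigr),$$ where $\sigma_h>0$ is a constant (independent of $i$) that may deteriorate as $h\to0^+$ and $L:=\kappa+c_{\rm Tr}^2\beta(d+1)>0$.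
   Context: Let $d\in\{2,3\}$ and let $\Omega\subseteq\mathbb R^d$ be a bounded polyhedral Lipschitz domain whose boundary is disjointly split into relatively open parts $\Gamma_I\neq\emptyset$ and $\Gamma_N$ with $\partial\Omega=\overline\Gamma_I\cup\overline\Gamma_N$. $(\cdot,\cdot)_\omega$ is the $L^2(\omega)$ inner product (surface measure on boundary parts), $\|\cdot\|_{p,\omega}$ the $L^p(\omega)$ norm, $\|\cdot\|_\omega:=\|\cdot\|_{2,\omega}$, $(\cdot)_+:=\max\{\cdot,0\}$, and $\kappa,\beta,m>0$ are given. $c_{\rm Tr}>0$ denotes the constant of the trace embedding $H^1(\Omega)\hookrightarrow H^{1/2}(\partial\Omega)$. $\mathcal T_h$ is a member of a shape-regular family of (conforming, simplicial) triangulations of $\Omega$ with maximal mesh-size $h$. The boundary facets split disjointly into the facets $\mathcal S_h^I$ contained in $\overline\Gamma_I$ and $\mathcal S_h^N$ contained in $\overline\Gamma_N$. $\mathcal S^1(\mathcal T_h)$ is the space of continuous, element-wise affine functions on $\overline\Omega$; $\mathcal S^1(\mathcal S_h^X)$, $X\in\{I,N\}$, the space of continuous, facet-wise affine functions on $\overline\Gamma_X$. $I_h:C^0(\overline\Gamma_I)\to\mathcal S^1(\mathcal S_h^I)$ is nodal interpolation (at the mesh nodes in $\overline\Gamma_I$); for $v,w\in C^0(\overline\Gamma_I)$, $(v,w)_{\Gamma_I,h}:=(I_h\{vw\},1)_{\Gamma_I}$ and $\|v\|_{\Gamma_I,h}:=(v,v)_{\Gamma_I,h}^{1/2}$. In the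 definition of $\delta_{\star,h}$, functions are identified with their nodal values and the distance is understood as $\inf_{\xi_h\in\widetilde{\mathcal S}^1(\mathcal S_h^I)}\bigl\|1-\frac{\beta(u_h-u_\infty^h)}{1+\beta\widetilde{\mathtt d}_h}\xi_h\bigr\|_{\Gamma_I,h}$. Discrete data: $f_h\in\mathcal S^1(\mathcal T_h)$, $g_h\in\mathcal S^1(\mathcal S_h^N)$ with $(f_h,1)_\Omega+(g_h,1)_{\Gamma_N}\neq0$, and $u_\infty^h\in\mathcal S^1(\mathcal S_h^I)$. Set $$\mathcal H_m^h:=\{\eta_h\in\mathcal S^1(\mathcal S_h^I)\mid\eta_h\ge0\text{ on }\Gamma_I,\ (\eta_h,1)_{\Gamma_I,h}=m\},$$ $$E_h(v_h,\eta_h):=\tfrac\kappa2\|\nabla v_h\|_\Omega^2+\tfrac\beta2\|(1+\beta\eta_h)^{-1/2}(v_h-u_\infty^h)\|_{\Gamma_I,h}^2-(f_h,v_h)_\Omega-(g_h,v_h)_{\Gamma_N}\ \text{ if }\eta_h\in\mathcal H_m^h,\quad E_h(v_h,\eta_h):=+\infty\text{ otherwise},$$ for $(v_h,\eta_h)\in\mathcal S^1(\mathcal T_h)\times\mathcal S^1(\mathcal S_h^I)$.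
   Formalization: Part (i) additionally assumes that the initial iterate u_h^(0) differs from u_∞^h somewhere on the closure of Γ_I; if they agree there, Step 1 has no solution C > 0, since its right-hand side is 0 for every C > 0. *)

theory Defs
  imports "HOL-Analysis.Analysis"
begin

subsection \<open>Lebesgue inner products and norms on a set\<close>

text \<open>The same definition serves scalar functions (on \<^typ>\<open>real\<close> the inner product is
  multiplication) and gradients.\<close>

definition inner_L2 :: "'a measure \<Rightarrow> 'a set \<Rightarrow> ('a \<Rightarrow> 'b::real_inner) \<Rightarrow> ('a \<Rightarrow> 'b) \<Rightarrow> real" where
  "inner_L2 M S f g = (LINT x:S|M. f x \<bullet> g x)"

definition norm_L2 :: "'a measure \<Rightarrow> 'a set \<Rightarrow> ('a \<Rightarrow> 'b::real_inner) \<Rightarrow> real" where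
  "norm_L2 M S f = sqrt (inner_L2 M S f f)"

definition norm_L1 :: "'a measure \<Rightarrow> 'a set \<Rightarrow> ('a \<Rightarrow> real) \<Rightarrow> real" where
  "norm_L1 M S f = (LINT x:S|M. \<bar>f x\<bar>)"

definition space_L2 :: "'a measure \<Rightarrow> 'a set \<Rightarrow> ('a \<Rightarrow> 'b::euclidean_space) set" where
  "space_L2 M S = {f. set_borel_measurable M S f \<and> set_integrable M S (\<lambda>x. (norm (f x))\<^sup>2)}"

subsection \<open>Bounded polyhedral Lipschitz domains\<close>

text \<open>Near each boundary point, the domain is the strict epigraph of a Lipschitz function over
  the hyperplane orthogonal to some unit vector \<open>e\<close>; \<open>x - (x \<bullet> e) *\<^sub>R e\<close> is
  the projection of \<open>x\<close> to that hyperplane.\<close>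

definition lipschitz_boundary :: "'a::euclidean_space set \<Rightarrow> bool" where
  "lipschitz_boundary \<Omega> \<longleftrightarrow>
     (\<forall>p\<in>frontier \<Omega>. \<exists>e \<gamma> K r. norm e = 1 \<and> K-lipschitz_on UNIV \<gamma> \<and> r > 0 \<and>
        \<Omega> \<inter> ball p r = {x \<in> ball p r. (\<gamma> (x - (x \<bullet> e) *\<^sub>R e) :: real) < x \<bullet> e})"

definition bounded_polyhedral_lipschitz_domain :: "'a::euclidean_space set \<Rightarrow> bool" where
  "bounded_polyhedral_lipschitz_domain \<Omega> \<longleftrightarrow>
     open \<Omega> \<and> connected \<Omega> \<and> \<Omega> \<noteq> {} \<and> bounded \<Omega> \<and>
     (\<exists>\<P>. finite \<P> \<and> (\<forall>P\<in>\<P>. polytope P) \<and> closure \<Omega> = \<Union>\<P>) \<and>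
     lipschitz_boundary \<Omega>"

subsection \<open>Surface measure of a polyhedral boundary\<close>

definition hyperplanes :: "'a::euclidean_space set set" where
  "hyperplanes = {{x. n \<bullet> x = b} | n b. norm n = 1}"

text \<open>The \<open>(d-1)\<close>-dimensional Lebesgue measure on a hyperplane with unit normal \<open>n\<close>:
  the area of a set is the volume of the right cylinder of height one over it.
  The result does not depend on which of the two unit normals is chosen.\<close>

definition slab_measure :: "'a::euclidean_space \<Rightarrow> real \<Rightarrow> 'a measure" where
  "slab_measure n b =
     distr (density lborel (indicator {x. b \<le> n \<bullet> x \<and> n \<bullet> x \<le> b + 1})) borel
       (\<lambda>x. x - (n \<bullet> x - b) *\<^sub>R n)"

definition hyperplane_measure :: "'a::euclidean_space set \<Rightarrow> 'a measure" where
  "hyperplane_measure H =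
     (let p = (SOME p. norm (fst p) = 1 \<and> H = {x. fst p \<bullet> x = snd p})
      in slab_measure (fst p) (snd p))"

text \<open>A polyhedral boundary \<open>B\<close> meets only finitely many hyperplanes in a set of positive area,
  it is covered by them up to a set of area zero, and distinct hyperplanes meet in sets of
  area zero.  So summing the areas over these hyperplanes is the surface measure on \<open>B\<close>.\<close>

definition surface_measure :: "'a::euclidean_space set \<Rightarrow> 'a measure" where
  "surface_measure B =
     measure_of UNIV (sets borel)
       (\<lambda>A. \<Sum>H\<in>{H \<in> hyperplanes. emeasure (hyperplane_measure H) B > 0}.
              emeasure (hyperplane_measure H) (A \<inter> B))"

abbreviation boundary_measure :: "'a::euclidean_space set \<Rightarrow> 'a measure" where
  "boundary_measure \<Omega> \<equiv> surface_measure (frontier \<Omega>)"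

subsection \<open>The Sobolev space of order one and its trace embedding\<close>

text \<open>Weak gradients are tested against continuously differentiable functions with compact
  support in \<open>\<Omega>\<close>; by mollification this is the same as testing against smooth ones.
  The vector-valued identity comprises all partial derivatives.\<close>

definition weak_gradient :: "'a::euclidean_space set \<Rightarrow> ('a \<Rightarrow> real) \<Rightarrow> ('a \<Rightarrow> 'a) \<Rightarrow> bool" where
  "weak_gradient \<Omega> v G \<longleftrightarrow> v \<in> space_L2 lborel \<Omega> \<and> G \<in> space_L2 lborel \<Omega> \<and>
     (\<forall>\<phi> D K. compact K \<and> K \<subseteq> \<Omega> \<and> (\<forall>x. x \<notin> K \<longrightarrow> \<phi> x = 0) \<and>
        (\<forall>x. GDERIV \<phi> x :> D x) \<and> continuous_on UNIV D \<longrightarrow>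
        (LINT x:\<Omega>|lborel. v x *\<^sub>R D x) = - (LINT x:\<Omega>|lborel. \<phi> x *\<^sub>R G x))"

definition space_H1 :: "'a::euclidean_space set \<Rightarrow> ('a \<Rightarrow> real) set" where
  "space_H1 \<Omega> = {v. \<exists>G. weak_gradient \<Omega> v G}"

text \<open>Functions that agree almost everywhere are not identified, so the gradient is a chosen
  representative; it is unique up to null sets.\<close>

definition grad :: "'a::euclidean_space set \<Rightarrow> ('a \<Rightarrow> real) \<Rightarrow> 'a \<Rightarrow> 'a" where
  "grad \<Omega> v = (SOME G. weak_gradient \<Omega> v G)"

definition norm_H1 :: "'a::euclidean_space set \<Rightarrow> ('a \<Rightarrow> real) \<Rightarrow> real" where
  "norm_H1 \<Omega> v = sqrt ((norm_L2 lborel \<Omega> v)\<^sup>2 + (norm_L2 lborel \<Omega> (grad \<Omega> v))\<^sup>2)"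

text \<open>The trace is the continuous extension of the restriction to the boundary from
  those functions in \<^const>\<open>space_H1\<close> that are continuous up to the boundary.\<close>

definition is_trace :: "'a::euclidean_space set \<Rightarrow> ('a \<Rightarrow> real) \<Rightarrow> ('a \<Rightarrow> real) \<Rightarrow> bool" where
  "is_trace \<Omega> v g \<longleftrightarrow> v \<in> space_H1 \<Omega> \<and> g \<in> space_L2 (boundary_measure \<Omega>) (frontier \<Omega>) \<and>
     (\<exists>w. (\<forall>k::nat. w k \<in> space_H1 \<Omega> \<and> continuous_on (closure \<Omega>) (w k)) \<and>
          (\<lambda>k. norm_H1 \<Omega> (\<lambda>x. w k x - v x)) \<longlonglongrightarrow> 0 \<and>
          (\<lambda>k. norm_L2 (boundary_measure \<Omega>) (frontier \<Omega>) (\<lambda>x. w k x - g x)) \<longlonglongrightarrow> 0)"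

text \<open>The square of the Sobolev-Slobodeckij norm of order \<open>1/2\<close>; it is infinite for functions
  outside the space.\<close>

definition norm_H12_sq :: "'a::euclidean_space set \<Rightarrow> ('a \<Rightarrow> real) \<Rightarrow> ennreal" where
  "norm_H12_sq \<Omega> g =
     (\<integral>\<^sup>+x\<in>frontier \<Omega>. ennreal ((g x)\<^sup>2) \<partial>boundary_measure \<Omega>) +
     (\<integral>\<^sup>+x\<in>frontier \<Omega>. (\<integral>\<^sup>+y\<in>frontier \<Omega>.
        ennreal ((g x - g y)\<^sup>2 / norm (x - y) ^ DIM('a)) \<partial>boundary_measure \<Omega>) \<partial>boundary_measure \<Omega>)"

definition trace_constant :: "'a::euclidean_space set \<Rightarrow> real \<Rightarrow> bool" where
  "trace_constant \<Omega> c \<longleftrightarrow> c > 0 \<and>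
     (\<forall>v g. is_trace \<Omega> v g \<longrightarrow> norm_H12_sq \<Omega> g \<le> ennreal ((c * norm_H1 \<Omega> v)\<^sup>2))"

subsection \<open>Triangulations and piecewise affine functions\<close>

definition triangulates :: "'a::euclidean_space set set \<Rightarrow> 'a set \<Rightarrow> bool" where
  "triangulates \<T> \<Omega> \<longleftrightarrow>
     triangulation \<T> \<and> (\<forall>T\<in>\<T>. int DIM('a) simplex T) \<and> \<Union>\<T> = closure \<Omega>"

definition inradius :: "'a::euclidean_space set \<Rightarrow> real" where
  "inradius T = Sup {r. \<exists>x. cball x r \<subseteq> T}"

definition shape_regular_family :: "'a::euclidean_space set set set \<Rightarrow> 'a set \<Rightarrow> bool" where
  "shape_regular_family \<F> \<Omega> \<longleftrightarrow>
     (\<forall>\<T>\<in>\<F>. triangulates \<T> \<Omega>) \<and>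
     (\<exists>c>0. \<forall>\<T>\<in>\<F>. \<forall>T\<in>\<T>. diameter T \<le> c * inradius T)"

definition nodes :: "'a::euclidean_space set set \<Rightarrow> 'a set" where
  "nodes \<T> = {z. \<exists>T\<in>\<T>. z extreme_point_of T}"

definition boundary_facets :: "'a::euclidean_space set \<Rightarrow> 'a set set \<Rightarrow> 'a set set" where
  "boundary_facets \<Omega> \<T> = {S. (\<exists>T\<in>\<T>. S facet_of T) \<and> S \<subseteq> frontier \<Omega>}"

definition facets_in :: "'a::euclidean_space set \<Rightarrow> 'a set set \<Rightarrow> 'a set \<Rightarrow> 'a set set" where
  "facets_in \<Omega> \<T> \<Gamma> = {S \<in> boundary_facets \<Omega> \<T>. S \<subseteq> closure \<Gamma>}"

text \<open>Members are functions on the whole space of which only the values on \<open>\<Union>\<K>\<close> matter; thus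
  a function in \<open>S1 \<T>\<close> is also, by restriction, one in \<open>S1 (facets_in \<Omega> \<T> \<Gamma>)\<close>.\<close>

definition S1 :: "'a::euclidean_space set set \<Rightarrow> ('a \<Rightarrow> real) set" where
  "S1 \<K> = {v. continuous_on (\<Union>\<K>) v \<and> (\<forall>K\<in>\<K>. \<exists>a b. \<forall>x\<in>K. v x = a \<bullet> x + b)}"

text \<open>Nodal interpolation on \<open>closure \<Gamma>\<close>, and the inner product and norm obtained from it
  by mass lumping.\<close>

definition interp :: "'a::euclidean_space set \<Rightarrow> 'a set set \<Rightarrow> 'a set \<Rightarrow> ('a \<Rightarrow> real) \<Rightarrow> 'a \<Rightarrow> real" where
  "interp \<Omega> \<T> \<Gamma> v =
     (SOME w. w \<in> S1 (facets_in \<Omega> \<T> \<Gamma>) \<and> (\<forall>z \<in> nodes \<T> \<inter> closure \<Gamma>. w z = v z))"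

definition inner_h ::
  "'a::euclidean_space set \<Rightarrow> 'a set set \<Rightarrow> 'a set \<Rightarrow> ('a \<Rightarrow> real) \<Rightarrow> ('a \<Rightarrow> real) \<Rightarrow> real" where
  "inner_h \<Omega> \<T> \<Gamma> v w =
     inner_L2 (boundary_measure \<Omega>) \<Gamma> (interp \<Omega> \<T> \<Gamma> (\<lambda>x. v x * w x)) (\<lambda>x. 1)"

definition norm_h :: "'a::euclidean_space set \<Rightarrow> 'a set set \<Rightarrow> 'a set \<Rightarrow> ('a \<Rightarrow> real) \<Rightarrow> real" where
  "norm_h \<Omega> \<T> \<Gamma> v = sqrt (inner_h \<Omega> \<T> \<Gamma> v v)"

subsection \<open>The discrete energy and its non-degeneracy condition\<close>

definition admissible :: "'a::euclidean_space set \<Rightarrow> 'a set set \<Rightarrow> 'a set \<Rightarrow> real \<Rightarrow> ('a \<Rightarrow> real) set" where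
  "admissible \<Omega> \<T> \<Gamma>I m =
     {\<eta> \<in> S1 (facets_in \<Omega> \<T> \<Gamma>I). (\<forall>x\<in>\<Gamma>I. \<eta> x \<ge> 0) \<and> inner_h \<Omega> \<T> \<Gamma>I \<eta> (\<lambda>x. 1) = m}"

definition energy ::
  "'a::euclidean_space set \<Rightarrow> 'a set \<Rightarrow> 'a set \<Rightarrow> 'a set set \<Rightarrow> real \<Rightarrow> real \<Rightarrow> real \<Rightarrow>
   ('a \<Rightarrow> real) \<Rightarrow> ('a \<Rightarrow> real) \<Rightarrow> ('a \<Rightarrow> real) \<Rightarrow> ('a \<Rightarrow> real) \<Rightarrow> ('a \<Rightarrow> real) \<Rightarrow> ereal" where
  "energy \<Omega> \<Gamma>I \<Gamma>N \<T> \<kappa> \<beta> m f g uinf v \<eta> =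
     (if \<eta> \<in> admissible \<Omega> \<T> \<Gamma>I m
      then ereal (\<kappa> / 2 * (norm_L2 lborel \<Omega> (grad \<Omega> v))\<^sup>2
             + \<beta> / 2 * (norm_h \<Omega> \<T> \<Gamma>I (\<lambda>x. (1 + \<beta> * \<eta> x) powr (-1/2) * (v x - uinf x)))\<^sup>2
             - inner_L2 lborel \<Omega> f v - inner_L2 (boundary_measure \<Omega>) \<Gamma>N g v)
      else \<infinity>)"

definition is_minimizer ::
  "'a::euclidean_space set \<Rightarrow> 'a set \<Rightarrow> 'a set \<Rightarrow> 'a set set \<Rightarrow> real \<Rightarrow> real \<Rightarrow> real \<Rightarrow>
   ('a \<Rightarrow> real) \<Rightarrow> ('a \<Rightarrow> real) \<Rightarrow> ('a \<Rightarrow> real) \<Rightarrow> ('a \<Rightarrow> real) \<Rightarrow> ('a \<Rightarrow> real) \<Rightarrow> bool" where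
  "is_minimizer \<Omega> \<Gamma>I \<Gamma>N \<T> \<kappa> \<beta> m f g uinf u d \<longleftrightarrow>
     u \<in> S1 \<T> \<and> d \<in> admissible \<Omega> \<T> \<Gamma>I m \<and>
     (\<forall>v \<in> S1 \<T>. \<forall>\<eta> \<in> S1 (facets_in \<Omega> \<T> \<Gamma>I).
        energy \<Omega> \<Gamma>I \<Gamma>N \<T> \<kappa> \<beta> m f g uinf u d \<le> energy \<Omega> \<Gamma>I \<Gamma>N \<T> \<kappa> \<beta> m f g uinf v \<eta>)"

definition nondegeneracy_dist ::
  "'a::euclidean_space set \<Rightarrow> 'a set \<Rightarrow> 'a set set \<Rightarrow> real \<Rightarrow>
   ('a \<Rightarrow> real) \<Rightarrow> ('a \<Rightarrow> real) \<Rightarrow> ('a \<Rightarrow> real) \<Rightarrow> real" where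
  "nondegeneracy_dist \<Omega> \<Gamma>I \<T> \<beta> uinf u d =
     (INF \<xi> \<in> {\<xi> \<in> S1 (facets_in \<Omega> \<T> \<Gamma>I). inner_h \<Omega> \<T> \<Gamma>I \<xi> (\<lambda>x. 1) = 0}.
        norm_h \<Omega> \<T> \<Gamma>I (\<lambda>x. 1 - \<beta> * (u x - uinf x) / (1 + \<beta> * d x) * \<xi> x))"

subsection \<open>Block coordinate descent\<close>

definition bcd_step1 ::
  "'a::euclidean_space set \<Rightarrow> 'a set \<Rightarrow> 'a set set \<Rightarrow> real \<Rightarrow> real \<Rightarrow> ('a \<Rightarrow> real) \<Rightarrow>
   ('a \<Rightarrow> real) \<Rightarrow> real \<Rightarrow> bool" where
  "bcd_step1 \<Omega> \<Gamma>I \<T> \<beta> m uinf u c \<longleftrightarrow> c > 0 \<and>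
     c = 1 / (m * \<beta>) *
       norm_L1 (boundary_measure \<Omega>) \<Gamma>I (interp \<Omega> \<T> \<Gamma>I (\<lambda>x. max (\<bar>u x - uinf x\<bar> - c) 0))"

definition bcd_step2 ::
  "'a::euclidean_space set \<Rightarrow> 'a set \<Rightarrow> 'a set set \<Rightarrow> real \<Rightarrow> real \<Rightarrow> ('a \<Rightarrow> real) \<Rightarrow>
   ('a \<Rightarrow> real) \<Rightarrow> real \<Rightarrow> ('a \<Rightarrow> real) \<Rightarrow> bool" where
  "bcd_step2 \<Omega> \<Gamma>I \<T> \<beta> m uinf u c d \<longleftrightarrow> d \<in> admissible \<Omega> \<T> \<Gamma>I m \<and>
     (\<forall>x\<in>\<Gamma>I. d x = 1 / (c * \<beta>) * interp \<Omega> \<T> \<Gamma>I (\<lambda>y. max (\<bar>u y - uinf y\<bar> - c) 0) x)"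

definition bcd_step3 ::
  "'a::euclidean_space set \<Rightarrow> 'a set \<Rightarrow> 'a set \<Rightarrow> 'a set set \<Rightarrow> real \<Rightarrow> real \<Rightarrow>
   ('a \<Rightarrow> real) \<Rightarrow> ('a \<Rightarrow> real) \<Rightarrow> ('a \<Rightarrow> real) \<Rightarrow> ('a \<Rightarrow> real) \<Rightarrow> ('a \<Rightarrow> real) \<Rightarrow> bool" where
  "bcd_step3 \<Omega> \<Gamma>I \<Gamma>N \<T> \<kappa> \<beta> f g uinf d u' \<longleftrightarrow> u' \<in> S1 \<T> \<and>
     (\<forall>v \<in> S1 \<T>.
        \<kappa> * inner_L2 lborel \<Omega> (grad \<Omega> u') (grad \<Omega> v)
        + \<beta> * inner_h \<Omega> \<T> \<Gamma>I (\<lambda>x. inverse (1 + \<beta> * d x) * (u' x - uinf x)) v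
        = inner_L2 lborel \<Omega> f v + inner_L2 (boundary_measure \<Omega>) \<Gamma>N g v)"

text \<open>\<open>bcd_run \<dots> n u C d\<close>: the first \<open>n\<close> passes of the algorithm started at \<open>u 0\<close> have been
  carried out and produced the listed iterates.\<close>

definition bcd_run ::
  "'a::euclidean_space set \<Rightarrow> 'a set \<Rightarrow> 'a set \<Rightarrow> 'a set set \<Rightarrow> real \<Rightarrow> real \<Rightarrow> real \<Rightarrow>
   ('a \<Rightarrow> real) \<Rightarrow> ('a \<Rightarrow> real) \<Rightarrow> ('a \<Rightarrow> real) \<Rightarrow>
   nat \<Rightarrow> (nat \<Rightarrow> 'a \<Rightarrow> real) \<Rightarrow> (nat \<Rightarrow> real) \<Rightarrow> (nat \<Rightarrow> 'a \<Rightarrow> real) \<Rightarrow> bool" where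
  "bcd_run \<Omega> \<Gamma>I \<Gamma>N \<T> \<kappa> \<beta> m f g uinf n u C d \<longleftrightarrow> u 0 \<in> S1 \<T> \<and>
     (\<forall>i<n. bcd_step1 \<Omega> \<Gamma>I \<T> \<beta> m uinf (u i) (C i) \<and>
            bcd_step2 \<Omega> \<Gamma>I \<T> \<beta> m uinf (u i) (C i) (d i) \<and>
            bcd_step3 \<Omega> \<Gamma>I \<Gamma>N \<T> \<kappa> \<beta> f g uinf (d i) (u (Suc i)))"

end

theory Submission
  imports Defs
begin

text \<open>The lumped energy depends on nodal values only, and it is jointly convex in \<open>(v, \<eta>)\<close> because
  \<open>w\<^sup>2 / s\<close> is; the Taylor remainder of this function is an exact square.  At a minimizer
  \<open>(u\<^sub>h, d\<^sub>h)\<close> this square together with the Dirichlet energy is a quadratic form in the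
  increments, whose kernel is trivial in \<open>v\<close> by the non-degeneracy condition; as all spaces are
  finite-dimensional, the energy gap dominates the \<open>H\<^sup>1\<close> distance globally.  Step 2 minimizes
  the energy in \<open>\<eta>\<close> and Step 3 in \<open>v\<close>, so by joint convexity a short step towards \<open>u\<^sub>h\<close>
  reduces the gap by a fixed factor.\<close>

section \<open>Semidefinite forms on spaces separated by finitely many functionals\<close>

text \<open>The Taylor remainder has the denominators \<open>1 + \<beta> * \<eta>' z\<close> of the
  new density, so it is not one fixed form. Positive weights and the mass constraint bound all of
  them by one \<open>S\<close>; with \<open>S\<close> in their place a fixed form on pairs
  (increment of \<open>v\<close>, mean-zero increment of \<open>\<eta>\<close>) lies below the
  energy gap for every competitor, which is why the estimate is global. This form may still vanish
  on nonzero density increments. Forms are therefore compared only by inclusion of their null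
  vectors, through an induction that takes the place of compactness. The same comparison, used a
  second time, bounds the quadratic term of the descent step by the gap.

  Reaching the nodal setting is the larger burden, because \<open>grad\<close> and
  \<open>interp\<close> are choice operators. Elementwise slopes have to form a weak gradient, weak
  gradients have to be unique almost everywhere, and the quadrature weights have to be positive. The
  last point rests on the geometry: the frontier of the domain is a union of mesh facets, and a
  relatively open boundary part contains a flat disc of each facet in its closure.\<close>

text \<open>A space of functions is described by the operation \<open>comb t x y = x + t y\<close> only.  No vector
  space axioms are needed, because elements are inspected only through linear functionals; so
  functions which differ outside the mesh need not be identified.\<close>

locale psd_form =
  fixes comb :: "real \<Rightarrow> 'v \<Rightarrow> 'v \<Rightarrow> 'v" and V :: "'v set" and q :: "'v \<Rightarrow> 'v \<Rightarrow> real"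
  assumes nonempty: "V \<noteq> {}"
    and closed: "\<And>t x y. x \<in> V \<Longrightarrow> y \<in> V \<Longrightarrow> comb t x y \<in> V"
    and linear: "\<And>t x y z. x \<in> V \<Longrightarrow> y \<in> V \<Longrightarrow> z \<in> V \<Longrightarrow> q (comb t x y) z = q x z + t * q y z"
    and sym: "\<And>x y. x \<in> V \<Longrightarrow> y \<in> V \<Longrightarrow> q x y = q y x"
    and nonneg: "\<And>x. x \<in> V \<Longrightarrow> 0 \<le> q x x"
begin

lemma linear_right: "x \<in> V \<Longrightarrow> y \<in> V \<Longrightarrow> z \<in> V \<Longrightarrow> q z (comb t x y) = q z x + t * q z y"
  by (metis closed linear sym)

lemma comb_square:
  assumes "x \<in> V" "y \<in> V"
  shows "q (comb t x y) (comb t x y) = q x x + 2 * t * q x y + t\<^sup>2 * q y y"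
  using assms by (simp add: linear linear_right closed sym[of y x] power2_eq_square algebra_simps)

text \<open>The degenerate case of Cauchy-Schwarz: along \<open>comb t x y\<close> the square is
  affine in \<open>t\<close>, and an affine function bounded below is constant.\<close>

lemma null_orthogonal:
  assumes "x \<in> V" "y \<in> V" "q y y = 0"
  shows "q x y = 0"
proof (rule ccontr)
  assume ne: "q x y \<noteq> 0"
  \<comment> \<open>At this \<open>t\<close> the affine function takes the value -1.\<close>
  define t where "t = - (q x x + 1) / (2 * q x y)"
  have "q (comb t x y) (comb t x y) = q x x + 2 * t * q x y"
    using assms by (simp add: comb_square)
  also have "2 * t * q x y = - (q x x + 1)"
    using ne by (simp add: t_def)
  finally show False
    using nonneg[OF closed[OF assms(1,2), of t]] by simp
qed

lemma restrict_kernel: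
  assumes \<phi>: "\<And>t x y. x \<in> V \<Longrightarrow> y \<in> V \<Longrightarrow> \<phi> (comb t x y) = \<phi> x + t * \<phi> y"
  shows "psd_form comb {x \<in> V. \<phi> x = 0} q"
proof
  obtain x where x: "x \<in> V" using nonempty by auto
  \<comment> \<open>\<open>comb (- 1) x x\<close> stands in for the zero vector: every functional
    linear with respect to \<open>comb\<close> vanishes on it.\<close>
  have "comb (- 1) x x \<in> {x \<in> V. \<phi> x = 0}"
    using x closed \<phi> by simp
  then show "{x \<in> V. \<phi> x = 0} \<noteq> {}" by blast
qed (use closed \<phi> linear sym nonneg in auto)

end

text \<open>Riesz representation for a possibly degenerate form. The functionals
  \<open>\<phi> i\<close> separate elements up to null vectors, so modulo these the space has finite
  dimension. The induction passes to the kernel of one functional, and a Gram-Schmidt step with a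
  vector off the kernel leads back. Vanishing on null vectors lets \<open>l\<close> descend to the
  quotient.\<close>

theorem psd_form_riesz:
  fixes \<phi> :: "'i \<Rightarrow> 'v \<Rightarrow> real"
  assumes "finite I" and "psd_form comb V q"
    and "\<And>i t x y. i \<in> I \<Longrightarrow> x \<in> V \<Longrightarrow> y \<in> V \<Longrightarrow> \<phi> i (comb t x y) = \<phi> i x + t * \<phi> i y"
    and "\<And>x. x \<in> V \<Longrightarrow> (\<And>i. i \<in> I \<Longrightarrow> \<phi> i x = 0) \<Longrightarrow> q x x = 0"
    and "\<And>t x y. x \<in> V \<Longrightarrow> y \<in> V \<Longrightarrow> l (comb t x y) = l x + t * l y"
    and "\<And>x. x \<in> V \<Longrightarrow> q x x = 0 \<Longrightarrow> l x = (0::real)"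
  obtains u where "u \<in> V" "\<And>v. v \<in> V \<Longrightarrow> q u v = l v"
proof -
  have "\<exists>u\<in>V. \<forall>v\<in>V. q u v = l v"
    using assms
  proof (induction I arbitrary: V l rule: finite_induct)
    case empty
    interpret psd_form comb V q by fact
    obtain u where u: "u \<in> V" using nonempty by auto
    have "q u v = l v" if "v \<in> V" for v
      using null_orthogonal[OF u that] empty.prems(3,5) that by auto
    with u show ?case by blast
  next
    case (insert i I)
    interpret psd_form comb V q by fact
    define V' where "V' = {x \<in> V. \<phi> i x = 0}"
    have form': "psd_form comb V' q"
      unfolding V'_def by (rule restrict_kernel) (use insert.prems(2) in auto)
    have IH: "\<exists>u\<in>V'. \<forall>v\<in>V'. q u v = k v"
      if "\<And>t x y. x \<in> V \<Longrightarrow> y \<in> V \<Longrightarrow> k (comb t x y) = k x + t * k y"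
        and "\<And>x. x \<in> V \<Longrightarrow> q x x = 0 \<Longrightarrow> k x = 0" for k
    proof (rule insert.IH[OF form'])
      fix x assume "x \<in> V'" and z: "\<And>j. j \<in> I \<Longrightarrow> \<phi> j x = 0"
      then have "x \<in> V" "\<phi> i x = 0" by (auto simp: V'_def)
      then show "q x x = 0" using insert.prems(3)[of x] z by (metis insertE)
    qed (use that insert.prems(2) in \<open>auto simp: V'_def\<close>)
    obtain u where u: "u \<in> V'" and uv: "\<And>v. v \<in> V' \<Longrightarrow> q u v = l v"
      using IH[of l] insert.prems(4,5) by blast
    have uV: "u \<in> V" using u by (simp add: V'_def)
    show ?case
    proof (cases "\<exists>b\<in>V. \<phi> i b \<noteq> 0")
      case False
      then have "V' = V" by (auto simp: V'_def)
      then show ?thesis using u uv by auto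
    next
      case True
      then obtain b where b: "b \<in> V" "\<phi> i b \<noteq> 0" by auto
      \<comment> \<open>\<open>y\<close> is the projection of \<open>b\<close> onto the kernel, from
        the induction hypothesis for the functional \<open>q b\<close>; so \<open>b' = b - y\<close>
        is orthogonal to the kernel.\<close>
      obtain y where y: "y \<in> V'" and yv: "\<And>v. v \<in> V' \<Longrightarrow> q y v = q b v"
      proof -
        have "\<exists>u\<in>V'. \<forall>v\<in>V'. q u v = q b v"
          by (rule IH) (use b null_orthogonal linear_right in auto)
        then show ?thesis using that by blast
      qed
      have yV: "y \<in> V" "\<phi> i y = 0" using y by (auto simp: V'_def)
      define b' where "b' = comb (- 1) b y"
      have b': "b' \<in> V" "\<phi> i b' \<noteq> 0"
        using b yV closed insert.prems(2) by (auto simp: b'_def)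
      have orth: "q b' v = 0" if "v \<in> V'" for v
        using yv[OF that] that b yV by (simp add: b'_def linear V'_def)
      \<comment> \<open>If \<open>b'\<close> is null, division by zero gives \<open>c = 0\<close>;
        this is right, since then \<open>l b' = 0\<close>.\<close>
      define c where "c = l b' / q b' b'"
      define u' where "u' = comb c u b'"
      have u'V: "u' \<in> V" using uV b' closed by (simp add: u'_def)
      have ub': "q u b' = 0" using orth[OF u] sym[OF uV b'(1)] by simp
      have cb: "c * q b' b' = l b'"
        using insert.prems(5)[OF b'(1)] by (auto simp: c_def)
      have "q u' v = l v" if v: "v \<in> V" for v
      proof -
        define s where "s = \<phi> i v / \<phi> i b'"
        define v' where "v' = comb (- s) v b'"
        have v': "v' \<in> V'"
          using v b' closed insert.prems(2) by (auto simp: v'_def V'_def s_def)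
        have "q u' v' = q u' v - s * q u' b'"
          using v b' u'V by (simp add: v'_def linear_right)
        moreover have "l v' = l v - s * l b'"
          using v b' insert.prems(4) by (simp add: v'_def)
        moreover have "q u' v' = l v'"
          using uv[OF v'] orth[OF v'] uV b' v' by (simp add: u'_def linear V'_def)
        moreover have "q u' b' = l b'"
          using uV b' cb ub' by (simp add: u'_def linear)
        ultimately show ?thesis by simp
      qed
      then show ?thesis using u'V by blast
    qed
  qed
  then show ?thesis using that by blast
qed

text \<open>A substitute for compactness of the unit sphere that copes with degenerate forms.
  Peeling off one functional splits \<open>v = v' + s b'\<close> orthogonally for \<open>q\<close>,
  while for \<open>p\<close> the mixed term is absorbed at the price of a factor 2.\<close>

theorem psd_form_dominated:
  fixes \<phi> :: "'i \<Rightarrow> 'v \<Rightarrow> real"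
  assumes "finite I" and "psd_form comb V q" and "psd_form comb V p"
    and "\<And>i t x y. i \<in> I \<Longrightarrow> x \<in> V \<Longrightarrow> y \<in> V \<Longrightarrow> \<phi> i (comb t x y) = \<phi> i x + t * \<phi> i y"
    and "\<And>x. x \<in> V \<Longrightarrow> (\<And>i. i \<in> I \<Longrightarrow> \<phi> i x = 0) \<Longrightarrow> q x x = 0"
    and "\<And>x. x \<in> V \<Longrightarrow> q x x = 0 \<Longrightarrow> p x x = 0"
  obtains c where "c > 0" "\<And>x. x \<in> V \<Longrightarrow> p x x \<le> c * q x x"
proof -
  have "\<exists>c>0. \<forall>x\<in>V. p x x \<le> c * q x x"
    using assms
  proof (induction I arbitrary: V rule: finite_induct)
    case empty
    then have "p x x \<le> 1 * q x x" if "x \<in> V" for x using that by auto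
    then show ?case using zero_less_one by blast
  next
    case (insert i I)
    interpret q: psd_form comb V q by fact
    interpret p: psd_form comb V p by fact
    define V' where "V' = {x \<in> V. \<phi> i x = 0}"
    have q': "psd_form comb V' q"
      unfolding V'_def by (rule q.restrict_kernel) (use insert.prems(3) in auto)
    have p': "psd_form comb V' p"
      unfolding V'_def by (rule p.restrict_kernel) (use insert.prems(3) in auto)
    have sep: "q x x = 0" if "x \<in> V'" "\<And>j. j \<in> I \<Longrightarrow> \<phi> j x = 0" for x
      using insert.prems(4)[of x] that by (auto simp: V'_def)
    have lin: "\<phi> j (comb t x y) = \<phi> j x + t * \<phi> j y" if "j \<in> I" "x \<in> V'" "y \<in> V'" for j t x y
      using insert.prems(3) that by (auto simp: V'_def)
    have "\<exists>c>0. \<forall>x\<in>V'. p x x \<le> c * q x x"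
      by (rule insert.IH[OF q' p']) (use lin sep insert.prems(5) in \<open>auto simp: V'_def\<close>)
    then obtain c where c: "c > 0" "\<And>x. x \<in> V' \<Longrightarrow> p x x \<le> c * q x x" by blast
    show ?case
    proof (cases "\<exists>b\<in>V. \<phi> i b \<noteq> 0")
      case False
      then have "V' = V" by (auto simp: V'_def)
      then show ?thesis using c by auto
    next
      case True
      then obtain b where b: "b \<in> V" "\<phi> i b \<noteq> 0" by auto
      obtain y where y: "y \<in> V'" and yv: "\<And>v. v \<in> V' \<Longrightarrow> q y v = q b v"
      proof (rule psd_form_riesz[OF insert.hyps(1) q', of \<phi> "q b"])
        show "q b (comb t x z) = q b x + t * q b z" if "x \<in> V'" "z \<in> V'" for t x z
          using that b by (simp add: V'_def q.linear_right)
        show "q b x = 0" if "x \<in> V'" "q x x = 0" for x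
          using that b by (simp add: V'_def q.null_orthogonal)
      qed (use lin sep in auto)
      have yV: "y \<in> V" "\<phi> i y = 0" using y by (auto simp: V'_def)
      define b' where "b' = comb (- 1) b y"
      have b': "b' \<in> V" "\<phi> i b' \<noteq> 0"
        using b yV q.closed insert.prems(3) by (auto simp: b'_def)
      have orth: "q v b' = 0" if "v \<in> V'" for v
        using yv[OF that] that b yV q.sym[of v b] q.sym[of v y]
        by (simp add: b'_def q.linear_right V'_def)
      \<comment> \<open>A vector null for \<open>q\<close> is null for \<open>p\<close>, so any
        factor would do in the first case.\<close>
      define k where "k = (if q b' b' = 0 then 1 else p b' b' / q b' b')"
      have kb: "p b' b' \<le> k * q b' b'"
        using insert.prems(5)[OF b'(1)] by (auto simp: k_def)
      define K where "K = 2 * (c + \<bar>k\<bar>)"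
      have "p v v \<le> K * q v v" if v: "v \<in> V" for v
      proof -
        define s where "s = \<phi> i v / \<phi> i b'"
        define v' where "v' = comb (- s) v b'"
        have v': "v' \<in> V'"
          using v b' q.closed insert.prems(3) by (auto simp: v'_def V'_def s_def)
        then have v'V: "v' \<in> V" by (simp add: V'_def)
        have qv': "q v' b' = 0" by (rule orth[OF v'])
        then have qvb: "q v b' = s * q b' b'"
          using v b' by (simp add: v'_def q.linear)
        have "q v' v' = q v v - s\<^sup>2 * q b' b'"
          using v b' qvb by (simp add: v'_def q.comb_square power2_eq_square)
        then have split: "q v v = q v' v' + s\<^sup>2 * q b' b'" by simp
        have pvv: "p v v = p v' v' + 2 * s * p v' b' + s\<^sup>2 * p b' b'"
          using v b' p.sym[of b' v]
          by (simp add: v'_def p.comb_square p.linear power2_eq_square algebra_simps)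
        \<comment> \<open>Nonnegativity of \<open>p\<close> at \<open>v' - s b'\<close> bounds the
          mixed term by the two squares.\<close>
        have "0 \<le> p v' v' - 2 * s * p v' b' + s\<^sup>2 * p b' b'"
          using p.nonneg[OF p.closed[OF v'V b'(1)], of "- s"] v'V b' by (simp add: p.comb_square)
        then have "p v v \<le> 2 * p v' v' + 2 * s\<^sup>2 * p b' b'" using pvv by (simp add: algebra_simps)
        also have "\<dots> \<le> 2 * (c * q v' v') + 2 * s\<^sup>2 * (\<bar>k\<bar> * q b' b')"
        proof -
          have "p b' b' \<le> \<bar>k\<bar> * q b' b'"
            using kb mult_right_mono[OF abs_ge_self q.nonneg[OF b'(1)], of k] by linarith
          then have "s\<^sup>2 * p b' b' \<le> s\<^sup>2 * (\<bar>k\<bar> * q b' b')" by (simp add: mult_left_mono)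
          then show ?thesis using c(2)[OF v'] by simp
        qed
        also have "\<dots> \<le> K * q v v"
        proof -
          have "0 \<le> c * (s\<^sup>2 * q b' b')" "0 \<le> \<bar>k\<bar> * q v' v'"
            using c q.nonneg[OF b'(1)] q.nonneg[OF v'V] by auto
          then show ?thesis unfolding K_def split by (simp add: algebra_simps)
        qed
        finally show ?thesis .
      qed
      moreover have "K > 0" using c by (simp add: K_def)
      ultimately show ?thesis by blast
    qed
  qed
  then show ?thesis using that by blast
qed

section \<open>Piecewise affine functions on simplicial complexes\<close>

lemma S1_comb: "v \<in> S1 \<K> \<Longrightarrow> w \<in> S1 \<K> \<Longrightarrow> (\<lambda>x. v x + t * w x) \<in> S1 \<K>"
  unfolding S1_def
proof (safe, goal_cases)
  case 1
  then show ?case by (intro continuous_intros)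
next
  case (2 K)
  then obtain a b a' b' where "\<forall>x\<in>K. v x = a \<bullet> x + b" "\<forall>x\<in>K. w x = a' \<bullet> x + b'" by meson
  then have "\<forall>x\<in>K. v x + t * w x = (a + t *\<^sub>R a') \<bullet> x + (b + t * b')"
    by (simp add: inner_add_left algebra_simps)
  then show ?case by blast
qed

lemma S1_const: "(\<lambda>x. c) \<in> S1 \<K>"
  unfolding S1_def by (auto intro!: exI[of _ 0] exI[of _ c])

lemma S1_cmult:
  assumes "v \<in> S1 \<K>" shows "(\<lambda>x. t * v x) \<in> S1 \<K>"
  using S1_comb[OF S1_const[of 0] assms, of t] by simp

lemma S1_diff:
  assumes "v \<in> S1 \<K>" "w \<in> S1 \<K>" shows "(\<lambda>x. v x - w x) \<in> S1 \<K>"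
  using S1_comb[OF assms, of "- 1"] by simp

lemma S1_restrict: "v \<in> S1 \<T> \<Longrightarrow> (\<And>K. K \<in> \<K> \<Longrightarrow> \<exists>T\<in>\<T>. K \<subseteq> T) \<Longrightarrow> v \<in> S1 \<K>"
  unfolding S1_def by (auto elim!: continuous_on_subset) (metis subsetD)+

lemma triangulationD:
  assumes "triangulation \<K>"
  shows "finite \<K>" "S \<in> \<K> \<Longrightarrow> \<exists>n. n simplex S"
    "S \<in> \<K> \<Longrightarrow> S' \<in> \<K> \<Longrightarrow> S \<inter> S' face_of S" "S \<in> \<K> \<Longrightarrow> S' \<in> \<K> \<Longrightarrow> S \<inter> S' face_of S'"
  using assms unfolding triangulation_def by (auto, metis Int_commute)

lemma simplex_compact: "triangulation \<K> \<Longrightarrow> S \<in> \<K> \<Longrightarrow> compact S"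
  using triangulationD(2) compact_simplex by blast

lemma simplex_convex: "triangulation \<K> \<Longrightarrow> S \<in> \<K> \<Longrightarrow> convex S"
  using triangulationD(2) convex_simplex by blast

lemma finite_nodes: "triangulation \<K> \<Longrightarrow> finite (nodes \<K>)"
proof -
  assume K: "triangulation \<K>"
  have "nodes \<K> = (\<Union>T\<in>\<K>. {z. z extreme_point_of T})" by (auto simp: nodes_def)
  moreover have "finite {z. z extreme_point_of T}" if "T \<in> \<K>" for T
    using triangulationD(2)[OF K that] finite_polyhedron_extreme_points simplex_imp_polyhedron by blast
  ultimately show ?thesis using triangulationD(1)[OF K] by simp
qed

lemma affine_nonneg_convex_hull:
  fixes a :: "'a::euclidean_space"
  assumes "\<And>x. x \<in> C \<Longrightarrow> 0 \<le> a \<bullet> x + b" and "x \<in> convex hull C"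
  shows "0 \<le> a \<bullet> x + b"
proof -
  have "convex hull C \<subseteq> {x. a \<bullet> x \<ge> - b}"
    by (rule hull_minimal) (use assms(1) in \<open>force simp: convex_halfspace_ge\<close>)+
  then show ?thesis using assms(2) by force
qed

text \<open>Krein-Milman makes each simplex the hull of its vertices, and a half-space containing
  these contains the hull. Applied to both differences of two functions, this shows that nodal
  values determine a function of \<open>S1\<close>.\<close>

lemma S1_nonneg:
  assumes K: "triangulation \<K>" and v: "v \<in> S1 \<K>" and nn: "\<And>z. z \<in> nodes \<K> \<Longrightarrow> 0 \<le> v z"
    and x: "x \<in> \<Union>\<K>"
  shows "0 \<le> v x"
proof -
  obtain S where S: "S \<in> \<K>" "x \<in> S" using x by auto
  obtain a b where ab: "\<forall>x\<in>S. v x = a \<bullet> x + b" using v S unfolding S1_def by blast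
  have "S = convex hull {x. x extreme_point_of S}"
    using Krein_Milman_Minkowski simplex_compact[OF K S(1)] simplex_convex[OF K S(1)] by blast
  moreover have "0 \<le> a \<bullet> z + b" if "z extreme_point_of S" for z
    using nn[of z] ab that S unfolding nodes_def extreme_point_of_def by auto
  ultimately have "0 \<le> a \<bullet> x + b"
    using affine_nonneg_convex_hull[of "{x. x extreme_point_of S}" a b x] S(2) by auto
  then show ?thesis using ab S by auto
qed

lemma S1_eq:
  assumes K: "triangulation \<K>" and "v \<in> S1 \<K>" "w \<in> S1 \<K>"
    and eq: "\<And>z. z \<in> nodes \<K> \<Longrightarrow> v z = w z" and x: "x \<in> \<Union>\<K>"
  shows "v x = w x"
  using S1_nonneg[OF K S1_diff[OF assms(2,3)] _ x] S1_nonneg[OF K S1_diff[OF assms(3,2)] _ x] eq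
  by fastforce

text \<open>Subtracting one vertex \<open>c\<close> turns affine into linear independence, so the
  increments from \<open>c\<close> can be prescribed by a linear functional;
  \<open>adjoint g 1\<close> is the vector representing it.\<close>

lemma affine_interpolation:
  fixes C :: "'a::euclidean_space set" and v :: "'a \<Rightarrow> real"
  assumes "\<not> affine_dependent C"
  obtains a b where "\<And>x. x \<in> C \<Longrightarrow> a \<bullet> x + b = v x"
proof (cases "C = {}")
  case False
  then obtain c where c: "c \<in> C" by auto
  have "independent ((\<lambda>x. - c + x) ` (C - {c}))"
    using assms affine_dependent_iff_dependent2[OF c] by simp
  then obtain g :: "'a \<Rightarrow> real" where g: "linear g" "\<forall>y\<in>(\<lambda>x. - c + x) ` (C - {c}). g y = v (c + y) - v c"
    using linear_independent_extend[of _ "\<lambda>y. v (c + y) - v c"] by blast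
  have gi: "g y = adjoint g 1 \<bullet> y" for y
    using adjoint_works[OF g(1), of y 1] by (simp add: inner_commute)
  have "g (x - c) = v x - v c" if "x \<in> C" for x
    using g(2) that linear_0[OF g(1)] by (cases "x = c") auto
  then have "adjoint g 1 \<bullet> x + (v c - adjoint g 1 \<bullet> c) = v x" if "x \<in> C" for x
    using that gi[of "x - c"] by (simp add: inner_diff_right)
  then show ?thesis using that by blast
qed (use that in auto)

text \<open>Two simplices meet in a common face, the hull of vertices that belong to both, so the
  affine interpolants of the two simplices agree there. A finite closed cover then yields
  continuity.\<close>

lemma S1_interpolation:
  assumes K: "triangulation \<K>"
  obtains w where "w \<in> S1 \<K>" "\<And>z. z \<in> nodes \<K> \<Longrightarrow> w z = v z"
proof -
  have "\<exists>a b. \<forall>z. z extreme_point_of S \<longrightarrow> a \<bullet> z + b = v z" if S: "S \<in> \<K>" for S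
  proof -
    obtain C where C: "\<not> affine_dependent C" "S = convex hull C"
      using triangulationD(2)[OF K S] by (auto simp: simplex_def)
    then show ?thesis
      using affine_interpolation[OF C(1), of v] extreme_point_of_convex_hull[of _ C] by metis
  qed
  then obtain a b where ab: "\<And>S z. S \<in> \<K> \<Longrightarrow> z extreme_point_of S \<Longrightarrow> a S \<bullet> z + b S = v z"
    by metis
  define w where "w x = (let S = SOME S. S \<in> \<K> \<and> x \<in> S in a S \<bullet> x + b S)" for x
  have w: "w x = a S \<bullet> x + b S" if S: "S \<in> \<K>" "x \<in> S" for S x
  proof -
    define S' where "S' = (SOME S. S \<in> \<K> \<and> x \<in> S)"
    have "S' \<in> \<K> \<and> x \<in> S'" unfolding S'_def by (rule someI[of _ S]) (use S in auto)
    then have S': "S' \<in> \<K>" "x \<in> S'" by auto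
    have F: "S \<inter> S' face_of S" "S \<inter> S' face_of S'" using triangulationD(3,4)[OF K S(1) S'(1)] by auto
    let ?E = "{z. z extreme_point_of (S \<inter> S')}"
    have hull: "S \<inter> S' = convex hull ?E"
      by (intro Krein_Milman_Minkowski compact_Int convex_Int simplex_compact[OF K] simplex_convex[OF K] S S')
    have eq: "(a S - a S') \<bullet> z + (b S - b S') = 0" if "z \<in> ?E" for z
      using that ab[OF S(1), of z] ab[OF S'(1), of z] extreme_point_of_face[OF F(1), of z] extreme_point_of_face[OF F(2), of z]
      by (auto simp: inner_diff_left)
    have xE: "x \<in> convex hull ?E" using S S' hull by auto
    have "0 \<le> (a S - a S') \<bullet> x + (b S - b S')"
      by (rule affine_nonneg_convex_hull[OF _ xE]) (use eq in force)
    moreover have "0 \<le> (a S' - a S) \<bullet> x + (b S' - b S)"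
      by (rule affine_nonneg_convex_hull[OF _ xE]) (use eq in \<open>force simp: inner_diff_left\<close>)
    ultimately show ?thesis
      by (simp add: w_def S'_def[symmetric] inner_diff_left)
  qed
  have "continuous_on (\<Union>S\<in>\<K>. S) w"
  proof (rule continuous_on_closed_Union)
    show "continuous_on S w" if "S \<in> \<K>" for S
    proof -
      have "continuous_on S (\<lambda>x. a S \<bullet> x + b S)" by (intro continuous_intros)
      then show ?thesis using w[OF that] by (subst continuous_on_cong[OF refl]) auto
    qed
  qed (use triangulationD(1)[OF K] compact_imp_closed[OF simplex_compact[OF K]] in auto)
  then have "w \<in> S1 \<K>"
    unfolding S1_def using w by auto
  moreover have "w z = v z" if z: "z \<in> nodes \<K>" for z
  proof -
    obtain S where "S \<in> \<K>" "z extreme_point_of S" using z by (auto simp: nodes_def)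
    then show ?thesis using w[of S z] ab[of S z] by (simp add: extreme_point_of_def)
  qed
  ultimately show ?thesis using that by blast
qed

section \<open>The boundary of a triangulated domain\<close>

lemma facet_of_simplex:
  assumes "n simplex T" "S facet_of T"
  shows "(n - 1) simplex S"
proof -
  obtain C where C: "\<not> affine_dependent C" "int (card C) = n + 1" "T = convex hull C"
    using assms(1) by (auto simp: simplex_def)
  then obtain u where u: "u \<in> C" "S = convex hull (C - {u})"
    using assms(2) facet_of_convex_hull_affine_independent by blast
  moreover have "\<not> affine_dependent (C - {u})"
    using C(1) affine_independent_subset by blast
  moreover have "int (card (C - {u})) = n"
    using u(1) C(2) card_Suc_Diff1[OF aff_independent_finite[OF C(1)] u(1)] by simp
  ultimately show ?thesis by (auto simp: simplex_def)
qed

text \<open>Makes interpolation and nodal comparison available on the boundary. Two facets may come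
  from different simplices \<open>U\<close> and \<open>U'\<close>; face relations are transported
  through the common face \<open>U \<inter> U'\<close>.\<close>

lemma triangulation_facets:
  assumes T: "triangulation \<T>" and F: "\<And>S. S \<in> \<F> \<Longrightarrow> \<exists>T\<in>\<T>. S facet_of T"
  shows "triangulation \<F>"
  unfolding triangulation_def
proof (intro conjI ballI allI impI)
  have "\<F> \<subseteq> (\<Union>T\<in>\<T>. {S. S facet_of T})" using F by auto
  moreover have "finite (\<Union>T\<in>\<T>. {S. S facet_of T})"
    using triangulationD(1,2)[OF T] finite_polytope_facets simplex_imp_polytope by blast
  ultimately show "finite \<F>" by (rule finite_subset)
next
  fix S assume "S \<in> \<F>"
  then show "\<exists>n. n simplex S" using F triangulationD(2)[OF T] facet_of_simplex by blast
next
  fix S S' assume "S \<in> \<F> \<and> S' \<in> \<F>"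
  then obtain U U' where U: "U \<in> \<T>" "S facet_of U" and U': "U' \<in> \<T>" "S' facet_of U'" using F by blast
  have face: "X \<inter> U2 face_of U1" if "X facet_of U1" "U1 \<in> \<T>" "U2 \<in> \<T>" for X U1 U2
  proof -
    have "X \<inter> (U1 \<inter> U2) face_of U1"
      using that facet_of_imp_face_of triangulationD(3)[OF T] face_of_Int by blast
    moreover have "X \<inter> (U1 \<inter> U2) = X \<inter> U2" using facet_of_imp_subset[OF that(1)] by auto
    ultimately show ?thesis by simp
  qed
  have "S' \<inter> U face_of U"
  proof -
    have "S' \<inter> U face_of U \<inter> U'"
      using face_of_subset[OF face[OF U'(2,1) U(1)], of "U \<inter> U'"] facet_of_imp_subset[OF U'(2)] by auto
    then show ?thesis using triangulationD(3)[OF T U(1) U'(1)] face_of_trans by blast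
  qed
  then have "S \<inter> (S' \<inter> U) face_of U" using U(2) facet_of_imp_face_of face_of_Int by blast
  moreover have "S \<inter> (S' \<inter> U) = S \<inter> S'" using facet_of_imp_subset[OF U(2)] by auto
  ultimately show "S \<inter> S' face_of S"
    using face_of_subset facet_of_imp_subset[OF U(2)] by (metis inf_le1)
qed

text \<open>A mesh node on a facet \<open>S\<close> might a priori be a vertex only of a simplex
  elsewhere. It is then a vertex of the common face with the simplex that carries \<open>S\<close>,
  hence of that simplex, hence of \<open>S\<close>.\<close>

lemma nodes_facets:
  assumes T: "triangulation \<T>" and F: "\<And>S. S \<in> \<F> \<Longrightarrow> \<exists>T\<in>\<T>. S facet_of T"
  shows "nodes \<F> = nodes \<T> \<inter> \<Union>\<F>"
proof (intro set_eqI iffI IntI)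
  fix z assume "z \<in> nodes \<F>"
  then obtain S where S: "S \<in> \<F>" "z extreme_point_of S" by (auto simp: nodes_def)
  then show "z \<in> \<Union>\<F>" by (auto simp: extreme_point_of_def)
  show "z \<in> nodes \<T>"
    using S F facet_of_imp_face_of extreme_point_of_face unfolding nodes_def by blast
next
  fix z assume "z \<in> nodes \<T> \<inter> \<Union>\<F>"
  then obtain T S where *: "T \<in> \<T>" "z extreme_point_of T" "S \<in> \<F>" "z \<in> S" by (auto simp: nodes_def)
  obtain U where U: "U \<in> \<T>" "S facet_of U" using F * by blast
  have "z \<in> T \<inter> U" using * U facet_of_imp_subset by (auto simp: extreme_point_of_def)
  then have "z extreme_point_of (T \<inter> U)" using * extreme_point_of_face[OF triangulationD(3)[OF T *(1) U(1)]] by simp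
  then have "z extreme_point_of U" using extreme_point_of_face[OF triangulationD(4)[OF T *(1) U(1)]] by simp
  then have "z extreme_point_of S" using extreme_point_of_face[OF facet_of_imp_face_of[OF U(2)]] * by simp
  then show "z \<in> nodes \<F>" using * by (auto simp: nodes_def)
qed

section \<open>Facets, half-spaces and the frontier of a triangulated set\<close>

lemma facet_halfspace:
  fixes T :: "'a::euclidean_space set"
  assumes T: "polyhedron T" "aff_dim T = int DIM('a)" and S: "S facet_of T"
  obtains a b where "a \<noteq> 0" "T \<subseteq> {x. a \<bullet> x \<le> b}" "S = T \<inter> {x. a \<bullet> x = b}"
    "affine hull S = {x. a \<bullet> x = b}"
proof -
  have face: "S face_of T" and ne: "S \<noteq> {}" and dim: "aff_dim S = int DIM('a) - 1"
    using S T(2) by (auto simp: facet_of_def)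
  obtain a b where ab: "T \<subseteq> {x. a \<bullet> x \<le> b}" "S = T \<inter> {x. a \<bullet> x = b}"
    using exposed_face_of_polyhedron[OF T(1), of S] face by (auto simp: exposed_face_of_def)
  have a: "a \<noteq> 0"
  proof
    assume "a = 0"
    then have "S = T" using ab(2) ne by auto
    then show False using dim T(2) by simp
  qed
  have "affine hull S = {x. a \<bullet> x = b}"
  proof (rule affine_dim_equal)
    show "affine hull S \<subseteq> {x. a \<bullet> x = b}"
      by (rule hull_minimal) (use ab(2) affine_hyperplane in auto)
    show "aff_dim (affine hull S) = aff_dim {x. a \<bullet> x = b}"
      using dim a by (simp add: aff_dim_hyperplane)
  qed (use ne affine_hyperplane in auto)
  then show ?thesis using that a ab by blast
qed

text \<open>A point of the half-space close to \<open>p\<close> is a convex combination of a point of \<open>S\<close> and a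
  fixed point \<open>c\<close> of \<open>T\<close> off the hyperplane.\<close>

lemma facet_halfspace_nbhd:
  fixes T :: "'a::euclidean_space set"
  assumes T: "convex T" "T \<subseteq> {x. a \<bullet> x \<le> b}" "c \<in> T" "a \<bullet> c < b"
    and S: "S \<subseteq> T" "affine hull S = {x. a \<bullet> x = b}" and p: "p \<in> rel_interior S"
  obtains e where "e > 0" "ball p e \<inter> {x. a \<bullet> x \<le> b} \<subseteq> T"
proof -
  \<comment> \<open>\<open>t q\<close> is the weight of \<open>c\<close> for which
    \<open>s q\<close> falls onto the hyperplane; at \<open>p\<close> it is 0 with
    \<open>s p = p\<close>, and both depend continuously on the point there.\<close>
  define t where "t q = (b - a \<bullet> q) / (b - a \<bullet> c)" for q
  define s where "s q = (q - t q *\<^sub>R c) /\<^sub>R (1 - t q)" for q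
  obtain r where r: "r > 0" "ball p r \<inter> affine hull S \<subseteq> S"
    using p by (auto simp: mem_rel_interior_ball)
  have pS: "a \<bullet> p = b"
    using p rel_interior_subset hull_subset[of S affine] S(2) by blast
  have t_lim: "(t \<longlongrightarrow> 0) (nhds p)"
  proof -
    have "((\<lambda>q. (b - a \<bullet> q) / (b - a \<bullet> c)) \<longlongrightarrow> (b - a \<bullet> p) / (b - a \<bullet> c)) (nhds p)"
      by (intro tendsto_divide tendsto_diff tendsto_const tendsto_inner filterlim_ident) (use T(4) in auto)
    then show ?thesis by (simp add: pS t_def[abs_def])
  qed
  have s_lim: "(s \<longlongrightarrow> p) (nhds p)"
  proof -
    have "((\<lambda>q. (q - t q *\<^sub>R c) /\<^sub>R (1 - t q)) \<longlongrightarrow> (p - 0 *\<^sub>R c) /\<^sub>R (1 - 0)) (nhds p)"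
      by (intro tendsto_scaleR tendsto_inverse tendsto_diff tendsto_const filterlim_ident t_lim) auto
    then show ?thesis by (simp add: s_def[abs_def])
  qed
  have "\<forall>\<^sub>F q in nhds p. t q < 1" using order_tendstoD(2)[OF t_lim, of 1] by simp
  moreover have "\<forall>\<^sub>F q in nhds p. dist (s q) p < r" using tendstoD[OF s_lim r(1)] .
  ultimately have "\<forall>\<^sub>F q in nhds p. t q < 1 \<and> dist (s q) p < r" by eventually_elim auto
  then obtain e where e: "e > 0" "\<And>q. dist q p < e \<Longrightarrow> t q < 1 \<and> dist (s q) p < r"
    by (auto simp: eventually_nhds_metric)
  have "q \<in> T" if q: "q \<in> ball p e" "a \<bullet> q \<le> b" for q
  proof -
    have t: "t q < 1" "dist (s q) p < r" "0 \<le> t q"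
      using e(2)[of q] q T(4) by (auto simp: dist_commute t_def)
    have "a \<bullet> (q - t q *\<^sub>R c) = b * (1 - t q)"
    proof -
      have "t q * (b - a \<bullet> c) = b - a \<bullet> q" using T(4) by (simp add: t_def)
      then show ?thesis by (simp add: inner_diff_right algebra_simps)
    qed
    then have "a \<bullet> s q = b" using t by (simp add: s_def)
    then have "s q \<in> T" using r(2) S t(2) by (auto simp: dist_commute)
    moreover have "q = (1 - t q) *\<^sub>R s q + t q *\<^sub>R c" using t by (simp add: s_def)
    ultimately show ?thesis
      using convexD[OF T(1), of "s q" c "1 - t q" "t q"] T(3) t by simp
  qed
  then show ?thesis using that e(1) by blast
qed

context
  fixes \<T> :: "'a::euclidean_space set set"
  assumes tri: "triangulation \<T>" and full: "\<And>T. T \<in> \<T> \<Longrightarrow> int DIM('a) simplex T"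
begin

lemma tri_dim: "T \<in> \<T> \<Longrightarrow> aff_dim T = int DIM('a)"
  using full aff_dim_simplex by blast

lemma tri_interior:
  assumes "T \<in> \<T>" shows "interior T \<noteq> {}"
proof -
  have "T \<noteq> {}" using tri_dim[OF assms] by auto
  then have "rel_interior T \<noteq> {}"
    using rel_interior_eq_empty[OF convex_simplex[OF full[OF assms]]] by simp
  then show ?thesis using interior_rel_interior[OF tri_dim[OF assms]] by simp
qed

lemma closed_Union_tri: "closed (\<Union>\<T>)"
  using triangulationD(1)[OF tri] full closed_simplex by blast

lemma facet_halfspace_tri:
  assumes "T \<in> \<T>" "S facet_of T"
  obtains a b where "a \<noteq> 0" "T \<subseteq> {x. a \<bullet> x \<le> b}" "S = T \<inter> {x. a \<bullet> x = b}"
    "affine hull S = {x. a \<bullet> x = b}"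
  using facet_halfspace[OF simplex_imp_polyhedron tri_dim] full assms by blast

text \<open>A second simplex through \<open>p\<close> would have \<open>S\<close> as a common facet.
  On opposite sides the two would fill a neighbourhood of \<open>p\<close>, which is then no
  frontier point; on the same side they would overlap beyond \<open>S\<close>, although they meet in
  \<open>S\<close> only.\<close>

lemma facet_point_in_one_simplex:
  assumes T: "T \<in> \<T>" "S facet_of T" and p: "p \<in> rel_interior S" "p \<in> frontier (\<Union>\<T>)"
    and T': "T' \<in> \<T>" "p \<in> T'"
  shows "T' = T"
proof (rule ccontr)
  assume ne: "T' \<noteq> T"
  have dimS: "aff_dim S = int DIM('a) - 1" using T tri_dim by (auto simp: facet_of_def)
  have convT: "convex T" "convex T'" using full convex_simplex T T' by blast+
  have pS: "p \<in> S" using p rel_interior_subset by blast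
  let ?F = "T \<inter> T'"
  have F: "?F face_of T" "?F face_of T'" using triangulationD(3,4)[OF tri T(1) T'(1)] by auto
  have SF: "S \<subseteq> ?F"
    by (rule subset_of_face_of[OF F(1)]) (use T facet_of_imp_subset p T' pS in auto)
  have "?F \<noteq> T"
    using face_of_aff_dim_lt[OF convT(2) F(2)] tri_dim[OF T(1)] tri_dim[OF T'(1)] ne by fastforce
  then have dimF: "aff_dim ?F < int DIM('a)"
    using face_of_aff_dim_lt[OF convT(1) F(1)] tri_dim[OF T(1)] by simp
  have S_face_F: "S face_of ?F"
    using face_of_subset[OF facet_of_imp_face_of[OF T(2)] SF] by simp
  have "S = ?F"
    using face_of_aff_dim_lt[OF _ S_face_F] dimS dimF convT convex_Int by fastforce
  then have S': "S facet_of T'"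
    using F(2) T(2) tri_dim[OF T(1)] tri_dim[OF T'(1)] by (auto simp: facet_of_def)
  obtain a b where ab: "a \<noteq> 0" "T \<subseteq> {x. a \<bullet> x \<le> b}" "S = T \<inter> {x. a \<bullet> x = b}" "affine hull S = {x. a \<bullet> x = b}"
    using facet_halfspace_tri[OF T] .
  obtain a' b' where ab': "a' \<noteq> 0" "T' \<subseteq> {x. a' \<bullet> x \<le> b'}" "S = T' \<inter> {x. a' \<bullet> x = b'}" "affine hull S = {x. a' \<bullet> x = b'}"
    using facet_halfspace_tri[OF T'(1) S'] .
  have nb: "\<exists>e>0. ball p e \<inter> {x. n \<bullet> x \<le> k} \<subseteq> U"
    if U: "U \<in> \<T>" "S \<subseteq> U" "U \<subseteq> {x. n \<bullet> x \<le> k}" "affine hull S = {x. n \<bullet> x = k}" for U n k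
  proof -
    obtain c where c: "c \<in> U" "n \<bullet> c < k"
    proof (rule ccontr)
      assume "\<not> thesis"
      then have "U \<subseteq> {x. n \<bullet> x = k}" using U(3) that by force
      then have "aff_dim U \<le> aff_dim (affine hull S)" using aff_dim_subset U(4) by blast
      then have "aff_dim U \<le> aff_dim S" by (simp only: aff_dim_affine_hull)
      then show False using dimS tri_dim[OF U(1)] by simp
    qed
    show ?thesis
      using facet_halfspace_nbhd[OF _ U(3) c U(2) U(4) p(1)] convex_simplex[OF full[OF U(1)]] by blast
  qed
  obtain e where e: "e > 0" "ball p e \<inter> {x. a \<bullet> x \<le> b} \<subseteq> T"
    using nb[OF T(1) _ ab(2,4)] facet_of_imp_subset[OF T(2)] by blast
  obtain e' where e': "e' > 0" "ball p e' \<inter> {x. a' \<bullet> x \<le> b'} \<subseteq> T'"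
    using nb[OF T'(1) _ ab'(2,4)] facet_of_imp_subset[OF S'] by blast
  have hyp: "a \<bullet> x = b \<longleftrightarrow> a' \<bullet> x = b'" for x using ab(4) ab'(4) by auto
  have ap: "a \<bullet> p = b" "a' \<bullet> p = b'" using pS ab(3) ab'(3) by auto
  \<comment> \<open>Both normals belong to the same hyperplane; the sign of their ratio
    \<open>c\<close> tells on which sides the simplices lie.\<close>
  define c where "c = (a' \<bullet> a) / (a \<bullet> a)"
  have a'c: "a' \<bullet> x - b' = c * (a \<bullet> x - b)" for x
  proof -
    have "a \<bullet> (x - ((a \<bullet> x - b) / (a \<bullet> a)) *\<^sub>R a) = b" using ab(1) by (simp add: inner_diff_right)
    then have "a' \<bullet> (x - ((a \<bullet> x - b) / (a \<bullet> a)) *\<^sub>R a) = b'" using hyp by blast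
    then show ?thesis by (simp add: inner_diff_right c_def mult.commute)
  qed
  show False
  proof (cases "c < 0")
    case True
    have "ball p (min e e') \<subseteq> \<Union>\<T>"
    proof
      fix x assume x: "x \<in> ball p (min e e')"
      show "x \<in> \<Union>\<T>"
      proof (cases "a \<bullet> x \<le> b")
        case True then show ?thesis using x e(2) T(1) by auto
      next
        case False
        then have "a' \<bullet> x \<le> b'" using a'c[of x] \<open>c < 0\<close> mult_neg_pos[of c "a \<bullet> x - b"] by linarith
        then show ?thesis using x e'(2) T'(1) by auto
      qed
    qed
    then have "p \<in> interior (\<Union>\<T>)" using e(1) e'(1) by (auto simp: mem_interior intro!: exI[of _ "min e e'"])
    then show False using p(2) by (simp add: frontier_def)
  next
    case False
    \<comment> \<open>A small step from \<open>p\<close> into the common half-space reaches a point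
      of both simplices off the hyperplane.\<close>
    define x where "x = p - (min e e' / (2 * norm a)) *\<^sub>R a"
    have xb: "x \<in> ball p (min e e')"
      using e(1) e'(1) ab(1) by (simp add: x_def dist_norm min_def)
    have ax: "a \<bullet> x < b"
      using e(1) e'(1) ab(1) ap by (simp add: x_def inner_diff_right)
    then have "a' \<bullet> x \<le> b'" using a'c[of x] False mult_nonneg_nonpos[of c "a \<bullet> x - b"] by linarith
    then have "x \<in> ?F" using xb ax e(2) e'(2) by auto
    then show False using \<open>S = ?F\<close> ab(3) ax by auto
  qed
qed

text \<open>Any other simplex that meets the relative interior of \<open>S\<close> contains all of
  \<open>S\<close>, hence \<open>p\<close>, which is excluded. So near each relative interior point
  only \<open>T\<close> is present, on one side of a hyperplane.\<close>

lemma facet_subset_frontier: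
  assumes T: "T \<in> \<T>" "S facet_of T" and p: "p \<in> rel_interior S" "p \<in> frontier (\<Union>\<T>)"
  shows "S \<subseteq> frontier (\<Union>\<T>)"
proof -
  obtain a b where ab: "a \<noteq> 0" "T \<subseteq> {x. a \<bullet> x \<le> b}" "S = T \<inter> {x. a \<bullet> x = b}"
    using facet_halfspace_tri[OF T] .
  have "q \<in> frontier (\<Union>\<T>)" if q: "q \<in> rel_interior S" for q
  proof -
    have qS: "q \<in> S" using q rel_interior_subset by blast
    have "q \<notin> interior (\<Union>\<T>)"
    proof
      assume int: "q \<in> interior (\<Union>\<T>)"
      have "q \<notin> T'" if T': "T' \<in> \<T> - {T}" for T'
      proof
        assume "q \<in> T'"
        have "S \<subseteq> T \<inter> T'"
          by (rule subset_of_face_of[OF triangulationD(3)[OF tri T(1)]])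
            (use T' T facet_of_imp_subset q qS \<open>q \<in> T'\<close> in auto)
        then have "p \<in> T'" using p rel_interior_subset by blast
        then show False using facet_point_in_one_simplex[OF T p] T' by blast
      qed
      then have "q \<in> interior (\<Union>\<T>) - \<Union>(\<T> - {T})" using int by blast
      moreover have "open (interior (\<Union>\<T>) - \<Union>(\<T> - {T}))"
        using triangulationD(1)[OF tri] full closed_simplex by (intro open_Diff) auto
      moreover have "interior (\<Union>\<T>) - \<Union>(\<T> - {T}) \<subseteq> {x. a \<bullet> x \<le> b}"
        using interior_subset ab(2) by blast
      ultimately have "q \<in> interior {x. a \<bullet> x \<le> b}" by (meson interiorI)
      then show False using qS ab(1,3) by simp
    qed
    moreover have "q \<in> \<Union>\<T>" using qS T facet_of_imp_subset by blast
    ultimately show ?thesis using closure_subset[of "\<Union>\<T>"] by (auto simp: frontier_def)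
  qed
  then have "closure (rel_interior S) \<subseteq> frontier (\<Union>\<T>)"
    by (intro closure_minimal) auto
  moreover have "closure (rel_interior S) = closure S"
    using convex_closure_rel_interior T full facet_of_imp_face_of face_of_imp_convex by blast
  ultimately show ?thesis using closure_subset by blast
qed

text \<open>A segment from a point inside a simplex to a point outside the triangulation,
  in general position, crosses the frontier in the relative interior of a facet.\<close>

lemma frontier_in_facet:
  assumes x: "x \<in> frontier (\<Union>\<T>)"
  obtains T S where "T \<in> \<T>" "S facet_of T" "x \<in> S" "S \<subseteq> frontier (\<Union>\<T>)"
proof -
  have poly: "polytope T" if "T \<in> \<T>" for T using full simplex_imp_polytope that by blast
  have conv: "convex T" if "T \<in> \<T>" for T using full convex_simplex that by blast
  define Fs where "Fs = (\<Union>T\<in>\<T>. {F. F facet_of T})"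
  \<comment> \<open>Faces of codimension at least two. Joined with \<open>y\<close>, each spans at
    most a hyperplane. A point \<open>z\<close> avoiding these finitely many null sets gives a
    segment to \<open>y\<close> that misses the faces.\<close>
  define Gs where "Gs = {F \<in> (\<Union>T\<in>\<T>. {F. F face_of T}). aff_dim F \<le> int DIM('a) - 2}"
  have finF: "finite Fs" unfolding Fs_def
    using triangulationD(1)[OF tri] poly finite_polytope_facets by blast
  have "finite (\<Union>T\<in>\<T>. {F. F face_of T})"
    using triangulationD(1)[OF tri] poly finite_polytope_faces by blast
  then have finG: "finite Gs" unfolding Gs_def by (rule rev_finite_subset) auto
  have closF: "closed S" if "S \<in> Fs" for S
  proof -
    obtain T where "T \<in> \<T>" "S facet_of T" using \<open>S \<in> Fs\<close> by (auto simp: Fs_def)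
    then show ?thesis
      using face_of_imp_closed conv poly polytope_imp_closed facet_of_imp_face_of by metis
  qed
  have "open (- \<Union>{S \<in> Fs. x \<notin> S})"
    using finF closF by (intro open_Compl closed_Union) auto
  moreover have "x \<in> - \<Union>{S \<in> Fs. x \<notin> S}" by auto
  \<comment> \<open>Within this radius every facet that is met contains \<open>x\<close>, so a
    crossing anywhere in the ball yields a facet through \<open>x\<close>.\<close>
  ultimately obtain r where r: "r > 0" "ball x r \<subseteq> - \<Union>{S \<in> Fs. x \<notin> S}"
    using open_contains_ball by metis
  have "x \<in> \<Union>\<T>" using x closed_Union_tri frontier_subset_closed by blast
  then obtain T0 where T0: "T0 \<in> \<T>" "x \<in> T0" by auto
  obtain y where y: "y \<in> ball x r" "y \<notin> \<Union>\<T>"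
    using x r(1) by (auto simp: frontier_straddle dist_commute)
  have "x \<in> closure (interior T0)"
    using convex_closure_interior[OF conv[OF T0(1)] tri_interior[OF T0(1)]] T0(2) closure_subset by blast
  then have "interior T0 \<inter> ball x r \<noteq> {}"
    using r(1) by (metis centre_in_ball closure_iff_nhds_not_empty open_ball order_refl Int_commute)
  then have "\<not> negligible (interior T0 \<inter> ball x r)" by (intro open_not_negligible) auto
  moreover have "negligible (\<Union>F\<in>Gs. affine hull insert y F)"
  proof (rule negligible_Union)
    fix A assume "A \<in> (\<lambda>F. affine hull insert y F) ` Gs"
    then obtain F where F: "F \<in> Gs" "A = affine hull insert y F" by auto
    have "aff_dim A < int DIM('a)"
      using F by (auto simp: Gs_def aff_dim_insert)
    then show "negligible A"
      using negligible_convex_interior[of A] F(2) affine_imp_convex[OF affine_affine_hull]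
      by (metis aff_dim_eq_full_gen low_dim_interior less_irrefl)
  qed (use finG in auto)
  ultimately obtain z where z: "z \<in> interior T0" "z \<in> ball x r" "\<And>F. F \<in> Gs \<Longrightarrow> z \<notin> affine hull insert y F"
    using negligible_subset[of "\<Union>F\<in>Gs. affine hull insert y F" "interior T0 \<inter> ball x r"] by blast
  have "closed_segment z y \<inter> frontier (\<Union>\<T>) \<noteq> {}"
  proof (rule connected_Int_frontier)
    have "z \<in> \<Union>\<T>" using z(1) interior_subset T0(1) by blast
    then show "closed_segment z y \<inter> \<Union>\<T> \<noteq> {}" using ends_in_segment(1) by blast
    show "closed_segment z y - \<Union>\<T> \<noteq> {}" using y(2) ends_in_segment(2) by blast
  qed simp
  then obtain p where p: "p \<in> closed_segment z y" "p \<in> frontier (\<Union>\<T>)" by auto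
  have pT: "p \<in> \<Union>\<T>" using p closed_Union_tri frontier_subset_closed by blast
  then obtain T where T: "T \<in> \<T>" "p \<in> T" by auto
  have pb: "p \<in> ball x r"
    using p(1) closed_segment_subset[OF z(2) y(1) convex_ball] by blast
  have "p \<notin> interior T"
    using p(2) interior_mono[of T "\<Union>\<T>"] T by (auto simp: frontier_def)
  then have "p \<in> rel_frontier T"
    using T closure_subset interior_rel_interior[OF tri_dim[OF T(1)]] by (auto simp: rel_frontier_def)
  then obtain S where S: "S facet_of T" "p \<in> S"
    using rel_frontier_of_polyhedron[OF polytope_imp_polyhedron[OF poly[OF T(1)]]] by auto
  have "S \<in> Fs" using S T by (auto simp: Fs_def)
  then have xS: "x \<in> S" using r(2) pb S(2) by blast
  have "p \<in> rel_interior S"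
  proof (rule ccontr)
    assume "p \<notin> rel_interior S"
    moreover have polyS: "polytope S"
      using face_of_polytope_polytope poly[OF T(1)] facet_of_imp_face_of[OF S(1)] by blast
    ultimately have "p \<in> rel_frontier S" using S(2) closure_subset by (auto simp: rel_frontier_def)
    then obtain G where G: "G facet_of S" "p \<in> G"
      using rel_frontier_of_polyhedron[OF polytope_imp_polyhedron[OF polyS]] by auto
    have "G face_of T"
      using G(1) S(1) facet_of_imp_face_of face_of_trans by blast
    moreover have "aff_dim G = int DIM('a) - 2"
      using G(1) S(1) tri_dim[OF T(1)] by (simp add: facet_of_def)
    ultimately have "G \<in> Gs" using T(1) by (auto simp: Gs_def)
    have "p \<noteq> y" using pT y(2) by auto
    obtain u where u: "0 \<le> u" "u \<le> 1" "p = (1 - u) *\<^sub>R z + u *\<^sub>R y"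
      using p(1) by (auto simp: closed_segment_def)
    have "u \<noteq> 1" using u(3) \<open>p \<noteq> y\<close> by auto
    have "(1 - u) *\<^sub>R z = p - u *\<^sub>R y" using u(3) by simp
    then have "(1 / (1 - u)) *\<^sub>R ((1 - u) *\<^sub>R z) = (1 / (1 - u)) *\<^sub>R (p - u *\<^sub>R y)" by simp
    then have "z = (1 / (1 - u)) *\<^sub>R (p - u *\<^sub>R y)" using \<open>u \<noteq> 1\<close> by simp
    then have "z = (1 / (1 - u)) *\<^sub>R p + (- u / (1 - u)) *\<^sub>R y"
      by (simp add: scaleR_diff_right)
    moreover have "(1 / (1 - u)) + (- u / (1 - u)) = 1"
      using \<open>u \<noteq> 1\<close> by (simp add: field_simps)
    ultimately have "z \<in> affine hull insert y G"
      using mem_affine[OF affine_affine_hull, of p "insert y G" y "1 / (1 - u)" "- u / (1 - u)"] G(2)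
        hull_subset[of "insert y G" affine] by auto
    then show False using z(3) \<open>G \<in> Gs\<close> by blast
  qed
  then have "S \<subseteq> frontier (\<Union>\<T>)" using facet_subset_frontier T S p by blast
  then show ?thesis using that T S xS by blast
qed

end

text \<open>Taking the closure could swallow parts of the frontier, as for a slit domain. Here a
  small step against the graph direction \<open>e\<close> leads from a frontier point into an open
  set below the graph, which misses \<Omega>; so every neighbourhood of the point leaves the
  closure.\<close>

lemma lipschitz_frontier_closure:
  fixes \<Omega> :: "'a::euclidean_space set"
  assumes "open \<Omega>" "lipschitz_boundary \<Omega>"
  shows "frontier (closure \<Omega>) = frontier \<Omega>"
proof
  show "frontier (closure \<Omega>) \<subseteq> frontier \<Omega>"
    using interior_mono[OF closure_subset[of \<Omega>]] by (auto simp: frontier_def)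
next
  show "frontier \<Omega> \<subseteq> frontier (closure \<Omega>)"
  proof
    fix p assume p: "p \<in> frontier \<Omega>"
    obtain e K r and \<gamma> :: "'a \<Rightarrow> real" where e: "norm e = 1" and lip: "K-lipschitz_on UNIV \<gamma>" and r: "r > 0"
      and graph: "\<Omega> \<inter> ball p r = {x \<in> ball p r. \<gamma> (x - (x \<bullet> e) *\<^sub>R e) < x \<bullet> e}"
      using bspec[OF assms(2)[unfolded lipschitz_boundary_def] p] by (elim exE conjE) (rule that)
    have ee: "e \<bullet> e = 1" using e by (simp add: norm_eq_1)
    have cont: "continuous_on UNIV (\<lambda>x. \<gamma> (x - (x \<bullet> e) *\<^sub>R e))"
      by (rule continuous_on_compose2[OF lipschitz_on_continuous_on[OF lip]]) (auto intro!: continuous_intros)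
    have "p \<notin> \<Omega>" using p assms(1) by (simp add: frontier_def interior_open)
    then have gp: "p \<bullet> e \<le> \<gamma> (p - (p \<bullet> e) *\<^sub>R e)" using graph r by force
    have "p \<notin> interior (closure \<Omega>)"
    proof
      assume "p \<in> interior (closure \<Omega>)"
      then obtain s where s: "s > 0" "ball p s \<subseteq> closure \<Omega>"
        using interior_subset by (metis mem_interior)
      define t where "t = min r s / 2"
      have t: "t > 0" "t < r" "t < s" using r s(1) by (auto simp: t_def)
      define x where "x = p - t *\<^sub>R e"
      have "dist p x = t" using t e by (simp add: x_def dist_norm)
      then have x: "x \<in> ball p r" "x \<in> closure \<Omega>" using t s(2) by auto
      define U where "U = ball p r \<inter> {y. y \<bullet> e < \<gamma> (y - (y \<bullet> e) *\<^sub>R e)}"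
      have "open U" unfolding U_def
        by (intro open_Int open_ball open_Collect_less cont continuous_intros)
      moreover have "x \<in> U"
        using x(1) gp t by (simp add: U_def x_def inner_diff_left ee algebra_simps)
      ultimately have "U \<inter> \<Omega> \<noteq> {}" using x(2) open_Int_closure_eq_empty by blast
      then obtain w where w: "w \<in> \<Omega> \<inter> ball p r" "w \<bullet> e < \<gamma> (w - (w \<bullet> e) *\<^sub>R e)"
        unfolding U_def by blast
      from w(1) show False unfolding graph using w(2) by simp
    qed
    then show "p \<in> frontier (closure \<Omega>)" using p by (simp add: frontier_def)
  qed
qed

section \<open>Boundary facets and boundary parts of a meshed domain\<close>

locale mesh =
  fixes \<Omega> :: "'a::euclidean_space set" and \<T> :: "'a set set"
  assumes domain: "bounded_polyhedral_lipschitz_domain \<Omega>" and triangulates: "triangulates \<T> \<Omega>"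
begin

lemma open_domain: "open \<Omega>" and connected_domain: "connected \<Omega>" and nonempty_domain: "\<Omega> \<noteq> {}"
  and bounded_domain: "bounded \<Omega>" and lipschitz_domain: "lipschitz_boundary \<Omega>"
  using domain by (auto simp: bounded_polyhedral_lipschitz_domain_def)

lemma tri: "triangulation \<T>" and full: "T \<in> \<T> \<Longrightarrow> int DIM('a) simplex T" and Union_tri: "\<Union>\<T> = closure \<Omega>"
  using triangulates by (auto simp: triangulates_def)

lemma compact_closure_domain: "compact (closure \<Omega>)"
  using bounded_domain by (simp add: compact_closure)

lemma frontier_eq: "frontier (\<Union>\<T>) = frontier \<Omega>"
  unfolding Union_tri by (rule lipschitz_frontier_closure[OF open_domain lipschitz_domain])

lemma boundary_facetsD:
  assumes "S \<in> boundary_facets \<Omega> \<T>"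
  shows "\<exists>T\<in>\<T>. S facet_of T" "S \<subseteq> frontier \<Omega>"
  using assms by (auto simp: boundary_facets_def)

lemma frontier_eq_facets: "frontier \<Omega> = \<Union>(boundary_facets \<Omega> \<T>)"
proof
  show "frontier \<Omega> \<subseteq> \<Union>(boundary_facets \<Omega> \<T>)"
  proof
    fix x assume "x \<in> frontier \<Omega>"
    then obtain T S where "T \<in> \<T>" "S facet_of T" "x \<in> S" "S \<subseteq> frontier \<Omega>"
      using frontier_in_facet[OF tri full, of x] frontier_eq by metis
    then show "x \<in> \<Union>(boundary_facets \<Omega> \<T>)" by (auto simp: boundary_facets_def)
  qed
qed (auto simp: boundary_facets_def)

lemma triangulation_boundary: "triangulation (boundary_facets \<Omega> \<T>)"
  by (rule triangulation_facets[OF tri]) (rule boundary_facetsD)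

lemma facets_in_subset: "facets_in \<Omega> \<T> \<Gamma> \<subseteq> boundary_facets \<Omega> \<T>"
  by (auto simp: facets_in_def)

lemma triangulation_facets_in: "triangulation (facets_in \<Omega> \<T> \<Gamma>)"
  by (rule triangulation_facets[OF tri]) (use facets_in_subset boundary_facetsD in blast)

lemma closed_boundary_facets:
  assumes "\<F> \<subseteq> boundary_facets \<Omega> \<T>" shows "closed (\<Union>\<F>)"
  using assms triangulationD(1)[OF triangulation_boundary] finite_subset
    compact_imp_closed[OF simplex_compact[OF triangulation_boundary]] by (intro closed_Union) blast+

lemma S1_facets_in: "v \<in> S1 \<T> \<Longrightarrow> v \<in> S1 (facets_in \<Omega> \<T> \<Gamma>)"
  by (erule S1_restrict) (meson boundary_facetsD(1) facet_of_imp_subset facets_in_subset subsetD)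

lemma aff_dim_boundary_facet:
  assumes "S \<in> boundary_facets \<Omega> \<T>" shows "aff_dim S = int DIM('a) - 1"
  using boundary_facetsD(1)[OF assms] facet_of_simplex[OF full] aff_dim_simplex by blast

lemma boundary_facet_hyperplane:
  assumes "S \<in> boundary_facets \<Omega> \<T>"
  obtains n b where "norm n = 1" "affine hull S = {x. n \<bullet> x = b}"
proof -
  obtain T where T: "T \<in> \<T>" "S facet_of T" using boundary_facetsD[OF assms] by blast
  obtain a b where ab: "a \<noteq> 0" "affine hull S = {x. a \<bullet> x = b}"
    using facet_halfspace_tri[OF tri full T] by blast
  have "{x. a \<bullet> x = b} = {x. (a /\<^sub>R norm a) \<bullet> x = b / norm a}"
    using ab(1) by (auto simp: divide_simps)
  then show ?thesis using that[of "a /\<^sub>R norm a" "b / norm a"] ab by simp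
qed

text \<open>In a neighbourhood of a relative interior point of a boundary facet, the boundary consists of
  that facet only; so a relatively open boundary part contains a flat piece of every facet
  in its closure.\<close>

lemma boundary_part_contains_flat_piece:
  assumes \<Gamma>: "openin (top_of_set (frontier \<Omega>)) \<Gamma>" and S: "S \<in> facets_in \<Omega> \<T> \<Gamma>"
  obtains y e where "e > 0" "y \<in> S" "affine hull S \<inter> ball y e \<subseteq> \<Gamma> \<inter> rel_interior S"
proof -
  have Sb: "S \<in> boundary_facets \<Omega> \<T>" "S \<subseteq> closure \<Gamma>" using S by (auto simp: facets_in_def)
  have convS: "convex S" using simplex_convex[OF triangulation_boundary Sb(1)] .
  have "S \<noteq> {}" using boundary_facetsD(1)[OF Sb(1)] by (auto simp: facet_of_def)
  then obtain p where p: "p \<in> rel_interior S" using rel_interior_eq_empty[OF convS] by auto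
  then obtain r where r: "r > 0" "ball p r \<inter> affine hull S \<subseteq> S" and pS: "p \<in> S"
    by (auto simp: mem_rel_interior_ball)
  have ri: "ball p r \<inter> affine hull S \<subseteq> rel_interior S"
    by (rule rel_interior_maximal[OF r(2)]) (metis Int_commute open_ball openin_open_Int)
  \<comment> \<open>Another boundary facet through \<open>p\<close> would have \<open>S\<close> as a
    proper face, but both have the same dimension.\<close>
  have others: "p \<notin> S'" if S': "S' \<in> boundary_facets \<Omega> \<T>" "S' \<noteq> S" for S'
  proof
    assume "p \<in> S'"
    then have "S \<subseteq> S \<inter> S'"
      using subset_of_face_of[OF triangulationD(3)[OF triangulation_boundary Sb(1) S'(1)], of S] p pS by auto
    then have "S face_of S'"
      using triangulationD(4)[OF triangulation_boundary Sb(1) S'(1)] by (metis inf.absorb1 inf.bounded_iff)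
    then show False
      using face_of_aff_dim_lt[OF simplex_convex[OF triangulation_boundary S'(1)] _ S'(2)[symmetric]]
        aff_dim_boundary_facet[OF Sb(1)] aff_dim_boundary_facet[OF S'(1)] by simp
  qed
  define U where "U = ball p r - \<Union>(boundary_facets \<Omega> \<T> - {S})"
  have "open U" unfolding U_def by (intro open_Diff closed_boundary_facets) auto
  moreover have "p \<in> U" using others r by (auto simp: U_def)
  moreover have "p \<in> closure \<Gamma>" using pS Sb by auto
  ultimately obtain y where y: "y \<in> \<Gamma>" "y \<in> U" using open_Int_closure_eq_empty[of U \<Gamma>] by auto
  have \<Gamma>f: "\<Gamma> \<subseteq> frontier \<Omega>" using openin_imp_subset[OF \<Gamma>] by simp
  then have "y \<in> S" using y frontier_eq_facets by (auto simp: U_def)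
  obtain O' where O': "open O'" "\<Gamma> = frontier \<Omega> \<inter> O'" using \<Gamma> by (auto simp: openin_open)
  have "open (O' \<inter> ball p r)" using O' by auto
  moreover have "y \<in> O' \<inter> ball p r" using y O' by (auto simp: U_def)
  ultimately obtain e where e: "e > 0" "ball y e \<subseteq> O' \<inter> ball p r" using open_contains_ball by meson
  have "affine hull S \<inter> ball y e \<subseteq> \<Gamma> \<inter> rel_interior S"
    using e(2) ri rel_interior_subset[of S] boundary_facetsD(2)[OF Sb(1)] O'(2) by blast
  then show ?thesis using that e(1) \<open>y \<in> S\<close> by blast
qed

text \<open>A relatively open part does not meet the closure of a part disjoint from it. So a facet
  through a point of \<Gamma> is not contained in the closure of \<open>\<Gamma>'\<close> and must
  be a facet of \<Gamma>.\<close>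

lemma closure_boundary_part:
  assumes \<Gamma>: "openin (top_of_set (frontier \<Omega>)) \<Gamma>" and \<Gamma>': "\<Gamma>' \<subseteq> frontier \<Omega>" "\<Gamma> \<inter> \<Gamma>' = {}"
    and split: "boundary_facets \<Omega> \<T> = facets_in \<Omega> \<T> \<Gamma> \<union> facets_in \<Omega> \<T> \<Gamma>'"
  shows "closure \<Gamma> = \<Union>(facets_in \<Omega> \<T> \<Gamma>)"
proof
  obtain O' where O': "open O'" "\<Gamma> = frontier \<Omega> \<inter> O'" using \<Gamma> by (auto simp: openin_open)
  have "closure \<Gamma>' \<subseteq> - O'" by (rule closure_minimal) (use \<Gamma>' O' in auto)
  then have disj: "closure \<Gamma>' \<inter> \<Gamma> = {}" using O' by auto
  have "\<Gamma> \<subseteq> \<Union>(facets_in \<Omega> \<T> \<Gamma>)"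
  proof
    fix x assume x: "x \<in> \<Gamma>"
    then obtain S where S: "S \<in> boundary_facets \<Omega> \<T>" "x \<in> S" using O' frontier_eq_facets by auto
    then have "S \<notin> facets_in \<Omega> \<T> \<Gamma>'" using disj x by (auto simp: facets_in_def)
    then show "x \<in> \<Union>(facets_in \<Omega> \<T> \<Gamma>)" using S split by auto
  qed
  then show "closure \<Gamma> \<subseteq> \<Union>(facets_in \<Omega> \<T> \<Gamma>)"
    by (intro closure_minimal closed_boundary_facets facets_in_subset)
qed (auto simp: facets_in_def)

end

section \<open>Surface measure\<close>

lemma emeasure_lborel_hyperplane:
  fixes a :: "'a::euclidean_space"
  assumes "a \<noteq> 0"
  shows "emeasure lborel {x. a \<bullet> x = b} = 0"
proof -
  have "emeasure lebesgue {x. a \<bullet> x = b} = 0"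
    using negligible_hyperplane[of a b] assms by (simp add: negligible_iff_emeasure0)
  moreover have "{x. a \<bullet> x = b} \<in> sets lborel" by simp
  ultimately show ?thesis by simp
qed

lemma emeasure_lborel_open_pos:
  fixes U :: "'a::euclidean_space set"
  assumes "open U" "U \<noteq> {}"
  shows "0 < emeasure lborel U"
proof -
  have "emeasure lebesgue U \<noteq> 0"
    using open_not_negligible[OF assms] assms(1) by (simp add: negligible_iff_emeasure0)
  then show ?thesis using assms(1) by (simp add: zero_less_iff_neq_zero)
qed

lemma sets_slab_measure [simp]: "sets (slab_measure n b) = sets borel"
  by (simp add: slab_measure_def)

lemma emeasure_slab_measure:
  fixes n :: "'a::euclidean_space"
  assumes "A \<in> sets borel"
  shows "emeasure (slab_measure n b) A =
    emeasure lborel ({x. b \<le> n \<bullet> x \<and> n \<bullet> x \<le> b + 1} \<inter> {x. x - (n \<bullet> x - b) *\<^sub>R n \<in> A})"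
proof -
  let ?\<pi> = "\<lambda>x. x - (n \<bullet> x - b) *\<^sub>R n"
  let ?S = "{x. b \<le> n \<bullet> x \<and> n \<bullet> x \<le> b + 1}"
  have S: "?S \<in> sets borel"
    by (intro borel_closed closed_Collect_conj closed_Collect_le continuous_intros)
  have m: "?\<pi> \<in> borel_measurable borel"
    by (intro borel_measurable_continuous_onI continuous_intros)
  have pre: "?\<pi> -` A \<in> sets borel"
    using measurable_sets[OF m assms] by simp
  have "emeasure (slab_measure n b) A = emeasure (density lborel (indicator ?S)) (?\<pi> -` A)"
    using m assms by (simp add: slab_measure_def emeasure_distr)
  also have "\<dots> = (\<integral>\<^sup>+x. indicator ?S x * indicator (?\<pi> -` A) x \<partial>lborel)"
    by (rule emeasure_density) (use S pre in auto)
  also have "\<dots> = (\<integral>\<^sup>+x. indicator (?S \<inter> ?\<pi> -` A) x \<partial>lborel)"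
    by (intro nn_integral_cong) (simp add: indicator_inter_arith)
  also have "\<dots> = emeasure lborel (?S \<inter> ?\<pi> -` A)"
    using S pre by (intro nn_integral_indicator) auto
  finally show ?thesis by (simp add: vimage_def)
qed

text \<open>The preimage under the projection along \<open>n\<close> is a hyperplane whose normal
  \<open>a\<close> is the part of \<open>n'\<close> orthogonal to \<open>n\<close>. If
  \<open>a = 0\<close>, the hyperplanes are parallel and distinct, and the preimage is
  empty.\<close>

lemma emeasure_slab_measure_other_hyperplane:
  fixes n :: "'a::euclidean_space"
  assumes n: "norm n = 1" "norm n' = 1" and ne: "{x. n' \<bullet> x = b'} \<noteq> {x. n \<bullet> x = b}"
  shows "emeasure (slab_measure n b) {x. n' \<bullet> x = b'} = 0"
proof -
  define c where "c = n' \<bullet> n"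
  define a where "a = n' - c *\<^sub>R n"
  have pre: "n' \<bullet> (x - (n \<bullet> x - b) *\<^sub>R n) = b' \<longleftrightarrow> a \<bullet> x = b' - b * c" for x
    by (simp add: a_def c_def inner_diff_right inner_diff_left algebra_simps)
  have "emeasure lborel {x. a \<bullet> x = b' - b * c} = 0"
  proof (cases "a = 0")
    case False
    then show ?thesis by (rule emeasure_lborel_hyperplane)
  next
    case True
    then have n': "n' = c *\<^sub>R n" by (simp add: a_def)
    then have "c \<noteq> 0" using n by auto
    have "b' - b * c \<noteq> 0"
    proof
      assume "b' - b * c = 0"
      then have "n' \<bullet> x = b' \<longleftrightarrow> n \<bullet> x = b" for x using n' \<open>c \<noteq> 0\<close> by (auto simp: mult.commute)
      then show False using ne by simp
    qed
    then show ?thesis using True by simp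
  qed
  moreover have "emeasure (slab_measure n b) {x. n' \<bullet> x = b'} \<le> emeasure lborel {x. a \<bullet> x = b' - b * c}"
    by (subst emeasure_slab_measure) (auto simp: pre intro!: emeasure_mono)
  ultimately show ?thesis by simp
qed

lemma emeasure_slab_measure_bounded:
  fixes n :: "'a::euclidean_space"
  assumes n: "norm n = 1" and A: "A \<in> sets borel" "bounded A"
  shows "emeasure (slab_measure n b) A < \<infinity>"
proof -
  obtain R where R: "\<And>x. x \<in> A \<Longrightarrow> norm x \<le> R" using A(2) by (auto simp: bounded_iff)
  have "norm x \<le> R + 1" if x: "b \<le> n \<bullet> x" "n \<bullet> x \<le> b + 1" "x - (n \<bullet> x - b) *\<^sub>R n \<in> A" for x
  proof -
    have "norm x \<le> norm (x - (n \<bullet> x - b) *\<^sub>R n) + norm ((n \<bullet> x - b) *\<^sub>R n)"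
      using norm_triangle_ineq[of "x - (n \<bullet> x - b) *\<^sub>R n" "(n \<bullet> x - b) *\<^sub>R n"] by simp
    then show ?thesis using R[OF x(3)] x(1,2) n by simp
  qed
  then have "bounded ({x. b \<le> n \<bullet> x \<and> n \<bullet> x \<le> b + 1} \<inter> {x. x - (n \<bullet> x - b) *\<^sub>R n \<in> A})"
    by (auto simp: bounded_iff)
  then show ?thesis
    unfolding emeasure_slab_measure[OF A(1)] by (rule emeasure_bounded_finite)
qed

text \<open>The cylinder over a relatively open disc contains a nonempty open set, here around the
  point half a unit above \<open>y\<close>.\<close>

lemma emeasure_slab_measure_pos:
  fixes n :: "'a::euclidean_space"
  assumes n: "norm n = 1" and y: "n \<bullet> y = b" "e > 0"
  shows "0 < emeasure (slab_measure n b) ({x. n \<bullet> x = b} \<inter> ball y e)"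
proof -
  define U where "U = {x. b < n \<bullet> x} \<inter> {x. n \<bullet> x < b + 1} \<inter> {x. dist y (x - (n \<bullet> x - b) *\<^sub>R n) < e}"
  have nn: "n \<bullet> n = 1" using n by (simp add: norm_eq_1)
  have "open U" unfolding U_def
    by (intro open_Int open_Collect_less continuous_intros)
  moreover have "y + (1/2) *\<^sub>R n \<in> U"
    using y by (simp add: U_def inner_add_right nn)
  ultimately have "0 < emeasure lborel U" by (intro emeasure_lborel_open_pos) auto
  also have "\<dots> \<le> emeasure (slab_measure n b) ({x. n \<bullet> x = b} \<inter> ball y e)"
  proof (subst emeasure_slab_measure)
    show "emeasure lborel U \<le> emeasure lborel ({x. b \<le> n \<bullet> x \<and> n \<bullet> x \<le> b + 1} \<inter>
      {x. x - (n \<bullet> x - b) *\<^sub>R n \<in> {x. n \<bullet> x = b} \<inter> ball y e})"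
    proof (rule emeasure_mono)
      have m: "(\<lambda>x. x - (n \<bullet> x - b) *\<^sub>R n) \<in> borel_measurable borel"
        by (intro borel_measurable_continuous_onI continuous_intros)
      have "{x. x - (n \<bullet> x - b) *\<^sub>R n \<in> {x. n \<bullet> x = b} \<inter> ball y e} \<in> sets borel"
        using measurable_sets[OF m, of "{x. n \<bullet> x = b} \<inter> ball y e"] by (simp add: vimage_def)
      moreover have "{x. b \<le> n \<bullet> x \<and> n \<bullet> x \<le> b + 1} \<in> sets borel"
        by (intro borel_closed closed_Collect_conj closed_Collect_le continuous_intros)
      ultimately show "{x. b \<le> n \<bullet> x \<and> n \<bullet> x \<le> b + 1} \<inter>
          {x. x - (n \<bullet> x - b) *\<^sub>R n \<in> {x. n \<bullet> x = b} \<inter> ball y e} \<in> sets lborel" by simp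
    qed (auto simp: U_def inner_diff_right nn)
  qed simp
  finally show ?thesis .
qed

lemma hyperplane_measure_eq_slab:
  assumes "H \<in> hyperplanes"
  obtains n b where "norm n = 1" "H = {x. n \<bullet> x = b}" "hyperplane_measure H = slab_measure n b"
proof -
  obtain n b where nb: "norm n = 1" "H = {x. n \<bullet> x = b}" using assms by (auto simp: hyperplanes_def)
  define p where "p = (SOME p. norm (fst p) = 1 \<and> H = {x. fst p \<bullet> x = snd p})"
  have "norm (fst p) = 1 \<and> H = {x. fst p \<bullet> x = snd p}"
    unfolding p_def by (rule someI[of _ "(n, b)"]) (use nb in simp)
  moreover have "hyperplane_measure H = slab_measure (fst p) (snd p)"
    unfolding hyperplane_measure_def p_def Let_def ..
  ultimately show ?thesis using that by blast
qed

lemma sets_surface_measure [simp]: "sets (surface_measure B) = sets borel"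
  unfolding surface_measure_def using sets.sets_measure_of_eq[of borel] by simp

lemma space_surface_measure [simp]: "space (surface_measure B) = UNIV"
  using sets_eq_imp_space_eq[OF sets_surface_measure] by simp

text \<open>\<open>measure_of\<close> yields the zero measure unless its argument is countably
  additive, so additivity has to come before the defining formula can be used. It passes from the
  hyperplane measures to their sum.\<close>

lemma emeasure_surface_measure:
  assumes B: "B \<in> sets borel" and A: "A \<in> sets borel"
  shows "emeasure (surface_measure B) A =
    (\<Sum>H\<in>{H \<in> hyperplanes. emeasure (hyperplane_measure H) B > 0}. emeasure (hyperplane_measure H) (A \<inter> B))"
  unfolding surface_measure_def
proof (rule emeasure_measure_of_sigma)
  let ?HH = "{H \<in> hyperplanes. emeasure (hyperplane_measure H) B > 0}"
  show "sigma_algebra UNIV (sets borel)"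
    using sets.sigma_algebra_axioms[of borel] by simp
  show "countably_additive (sets borel) (\<lambda>A. \<Sum>H\<in>?HH. emeasure (hyperplane_measure H) (A \<inter> B))"
  proof (rule countably_additiveI)
    fix F :: "nat \<Rightarrow> 'a set" assume F: "range F \<subseteq> sets borel" "disjoint_family F" "\<Union>(range F) \<in> sets borel"
    have "(\<Sum>i. emeasure (hyperplane_measure H) (F i \<inter> B)) = emeasure (hyperplane_measure H) (\<Union>(range F) \<inter> B)"
      if H: "H \<in> ?HH" for H
    proof -
      obtain n b where "hyperplane_measure H = slab_measure n b"
        using H hyperplane_measure_eq_slab[of H] by blast
      moreover have "disjoint_family (\<lambda>i. F i \<inter> B)"
        using F(2) by (auto simp: disjoint_family_on_def)
      moreover have "range (\<lambda>i. F i \<inter> B) \<subseteq> sets borel" using F(1) B by auto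
      ultimately show ?thesis
        using suminf_emeasure[of "\<lambda>i. F i \<inter> B" "hyperplane_measure H"] by simp
    qed
    then show "(\<Sum>i. \<Sum>H\<in>?HH. emeasure (hyperplane_measure H) (F i \<inter> B)) =
      (\<Sum>H\<in>?HH. emeasure (hyperplane_measure H) (\<Union>(range F) \<inter> B))"
      by (subst suminf_sum) (auto intro!: summableI)
  qed
qed (use A in \<open>auto simp: positive_def\<close>)

section \<open>Finiteness and positivity of the boundary measure\<close>

context mesh
begin

lemma frontier_borel: "frontier \<Omega> \<in> sets borel" and bounded_frontier: "bounded (frontier \<Omega>)"
  using bounded_domain by (auto simp: frontier_def bounded_diff)

lemma affine_hull_facet_hyperplane:
  assumes "S \<in> boundary_facets \<Omega> \<T>" shows "affine hull S \<in> hyperplanes"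
  using boundary_facet_hyperplane[OF assms] unfolding hyperplanes_def by blast

text \<open>Over an infinite index set the sum in \<open>surface_measure\<close> would be 0 by
  convention. The frontier is covered by the affine hulls of finitely many facets, and these are
  null for the area on any other hyperplane.\<close>

lemma finite_boundary_hyperplanes:
  "finite {H \<in> hyperplanes. emeasure (hyperplane_measure H) (frontier \<Omega>) > 0}" (is "finite ?HH")
proof (rule finite_subset)
  show "?HH \<subseteq> (\<lambda>S. affine hull S) ` boundary_facets \<Omega> \<T>"
  proof (rule ccontr)
    assume "\<not> ?thesis"
    then obtain H where H: "H \<in> ?HH" "\<And>S. S \<in> boundary_facets \<Omega> \<T> \<Longrightarrow> affine hull S \<noteq> H" by blast
    obtain n b where nb: "norm n = 1" "H = {x. n \<bullet> x = b}" "hyperplane_measure H = slab_measure n b"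
      using H(1) hyperplane_measure_eq_slab[of H] by blast
    have "emeasure (slab_measure n b) (\<Union>S\<in>boundary_facets \<Omega> \<T>. affine hull S) \<le>
        (\<Sum>S\<in>boundary_facets \<Omega> \<T>. emeasure (slab_measure n b) (affine hull S))"
      by (rule emeasure_subadditive_finite)
        (use triangulationD(1)[OF triangulation_boundary] in \<open>auto simp: closed_affine_hull\<close>)
    also have "\<dots> = 0"
    proof (rule sum.neutral, rule ballI)
      fix S assume S: "S \<in> boundary_facets \<Omega> \<T>"
      obtain n' b' where n': "norm n' = 1" "affine hull S = {x. n' \<bullet> x = b'}"
        using boundary_facet_hyperplane[OF S] .
      then show "emeasure (slab_measure n b) (affine hull S) = 0"
        using emeasure_slab_measure_other_hyperplane[OF nb(1) n'(1), of b' b] H(2)[OF S] nb(2) by simp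
    qed
    finally have "emeasure (slab_measure n b) (\<Union>S\<in>boundary_facets \<Omega> \<T>. affine hull S) = 0" by simp
    moreover have "frontier \<Omega> \<subseteq> (\<Union>S\<in>boundary_facets \<Omega> \<T>. affine hull S)"
      unfolding frontier_eq_facets using hull_subset by fast
    moreover have "(\<Union>S\<in>boundary_facets \<Omega> \<T>. affine hull S) \<in> sets borel"
      using triangulationD(1)[OF triangulation_boundary] by (intro sets.finite_UN) (auto simp: closed_affine_hull)
    ultimately have "emeasure (slab_measure n b) (frontier \<Omega>) = 0"
      using emeasure_mono[of "frontier \<Omega>" "\<Union>S\<in>boundary_facets \<Omega> \<T>. affine hull S" "slab_measure n b"] by simp
    then show False using H(1) nb(3) by simp
  qed
qed (use triangulationD(1)[OF triangulation_boundary] in auto)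

lemma finite_boundary_measure: "finite_measure (boundary_measure \<Omega>)"
proof (rule finite_measureI)
  have "emeasure (hyperplane_measure H) (UNIV \<inter> frontier \<Omega>) < \<infinity>" if H: "H \<in> hyperplanes" for H
    using hyperplane_measure_eq_slab[OF H] emeasure_slab_measure_bounded[OF _ frontier_borel bounded_frontier]
    by (metis Int_UNIV_left)
  then show "emeasure (boundary_measure \<Omega>) (space (boundary_measure \<Omega>)) \<noteq> \<infinity>"
    using finite_boundary_hyperplanes
    by (simp add: emeasure_surface_measure[OF frontier_borel] less_top ennreal_sum_less_top)
qed

lemma boundary_part_borel:
  assumes "openin (top_of_set (frontier \<Omega>)) \<Gamma>" shows "\<Gamma> \<in> sets borel"
proof -
  obtain U where "open U" "\<Gamma> = frontier \<Omega> \<inter> U" using assms by (auto simp: openin_open)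
  then show ?thesis using frontier_borel by auto
qed

text \<open>The flat disc supplied by relative openness has positive area; through it the quadrature
  weights become positive.\<close>

lemma facet_part_not_null:
  assumes \<Gamma>: "openin (top_of_set (frontier \<Omega>)) \<Gamma>" and S: "S \<in> facets_in \<Omega> \<T> \<Gamma>"
  obtains A where "A \<in> sets borel" "A \<subseteq> \<Gamma> \<inter> rel_interior S" "emeasure (boundary_measure \<Omega>) A > 0"
proof -
  obtain y e where ye: "e > 0" "y \<in> S" "affine hull S \<inter> ball y e \<subseteq> \<Gamma> \<inter> rel_interior S"
    using boundary_part_contains_flat_piece[OF \<Gamma> S] .
  define A where "A = affine hull S \<inter> ball y e"
  have A: "A \<in> sets borel" by (simp add: A_def closed_affine_hull)
  have S': "S \<in> boundary_facets \<Omega> \<T>" using S facets_in_subset by blast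
  have H: "affine hull S \<in> hyperplanes" by (rule affine_hull_facet_hyperplane[OF S'])
  obtain n b where nb: "norm n = 1" "affine hull S = {x. n \<bullet> x = b}" "hyperplane_measure (affine hull S) = slab_measure n b"
    using hyperplane_measure_eq_slab[OF H] .
  have "n \<bullet> y = b" using nb(2) ye(2) hull_subset[of S affine] by blast
  then have pos: "0 < emeasure (hyperplane_measure (affine hull S)) A"
    unfolding nb(3) unfolding A_def nb(2) by (rule emeasure_slab_measure_pos[OF nb(1) _ ye(1)])
  have Af: "A \<inter> frontier \<Omega> = A" using ye(3) openin_imp_subset[OF \<Gamma>] by (auto simp: A_def)
  have "0 < emeasure (hyperplane_measure (affine hull S)) (frontier \<Omega>)"
    using emeasure_mono[of A "frontier \<Omega>" "slab_measure n b"] frontier_borel Af pos nb(3)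
    by (auto intro: less_le_trans)
  then have "emeasure (hyperplane_measure (affine hull S)) (A \<inter> frontier \<Omega>) \<le> emeasure (boundary_measure \<Omega>) A"
    unfolding emeasure_surface_measure[OF frontier_borel A]
    using finite_boundary_hyperplanes H by (intro member_le_sum) auto
  then have "0 < emeasure (boundary_measure \<Omega>) A" using pos Af by (simp add: less_le_trans)
  then show ?thesis using that[OF A] ye(3) by (simp add: A_def)
qed

lemma set_integrable_boundary_part:
  fixes f :: "'a \<Rightarrow> real"
  assumes \<Gamma>: "openin (top_of_set (frontier \<Omega>)) \<Gamma>" and f: "continuous_on (closure \<Gamma>) f"
  shows "set_integrable (boundary_measure \<Omega>) \<Gamma> f"
proof -
  interpret finite_measure "boundary_measure \<Omega>" by (rule finite_boundary_measure)
  have "bounded \<Gamma>" using openin_imp_subset[OF \<Gamma>] bounded_frontier bounded_subset by auto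
  then have "compact (f ` closure \<Gamma>)"
    by (intro compact_continuous_image[OF f]) (simp add: compact_closure)
  then obtain B where B: "\<And>x. x \<in> closure \<Gamma> \<Longrightarrow> norm (f x) \<le> B"
    by (meson compact_imp_bounded bounded_iff imageI)
  have "(\<lambda>x. indicator (closure \<Gamma>) x *\<^sub>R f x) \<in> borel_measurable borel"
    by (rule borel_measurable_continuous_on_indicator[OF _ f]) simp
  then have "(\<lambda>x. indicator \<Gamma> x *\<^sub>R (indicator (closure \<Gamma>) x *\<^sub>R f x)) \<in> borel_measurable borel"
    using boundary_part_borel[OF \<Gamma>] by measurable
  also have "(\<lambda>x. indicator \<Gamma> x *\<^sub>R (indicator (closure \<Gamma>) x *\<^sub>R f x)) = (\<lambda>x. indicator \<Gamma> x *\<^sub>R f x)"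
    using closure_subset[of \<Gamma>] by (auto simp: indicator_def fun_eq_iff)
  finally have m: "(\<lambda>x. indicator \<Gamma> x *\<^sub>R f x) \<in> borel_measurable borel" .
  have "norm (indicator \<Gamma> x *\<^sub>R f x) \<le> \<bar>B\<bar>" for x
    using B[of x] closure_subset[of \<Gamma>] by (auto simp: indicator_def)
  then show ?thesis
    unfolding set_integrable_def
    by (intro integrable_const_bound[of _ "\<bar>B\<bar>"])
      (use m in \<open>auto cong: measurable_cong_sets\<close>)
qed

end

section \<open>Mass lumping\<close>

lemma S1_sum: "(\<And>i. i \<in> I \<Longrightarrow> f i \<in> S1 \<K>) \<Longrightarrow> (\<lambda>x. \<Sum>i\<in>I. c i * f i x) \<in> S1 \<K>"
proof (induction I rule: infinite_finite_induct)
  case (insert i I)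
  then have "(\<lambda>x. (\<Sum>i\<in>I. c i * f i x) + c i * f i x) \<in> S1 \<K>" by (intro S1_comb) auto
  then show ?case using insert.hyps by (simp add: add.commute)
qed (auto intro: S1_const)

locale boundary_part = mesh \<Omega> \<T> for \<Omega> :: "'a::euclidean_space set" and \<T> +
  fixes \<Gamma> :: "'a set"
  assumes part_open: "openin (top_of_set (frontier \<Omega>)) \<Gamma>"
    and closure_part: "closure \<Gamma> = \<Union>(facets_in \<Omega> \<T> \<Gamma>)"
begin

abbreviation facets :: "'a set set" where "facets \<equiv> facets_in \<Omega> \<T> \<Gamma>"
abbreviation Z :: "'a set" where "Z \<equiv> nodes \<T> \<inter> closure \<Gamma>"

text \<open>\<open>interp\<close> prescribes values at mesh nodes in the closure, whereas existence
  and uniqueness are known for the vertices of the facet complex.\<close>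

lemma Z_eq_nodes: "Z = nodes facets"
  using nodes_facets[OF tri, of facets] boundary_facetsD(1) facets_in_subset closure_part by blast

lemma finite_Z: "finite Z"
  using finite_nodes[OF tri] by simp

lemma S1_part_nonneg: "v \<in> S1 facets \<Longrightarrow> (\<And>z. z \<in> Z \<Longrightarrow> 0 \<le> v z) \<Longrightarrow> x \<in> closure \<Gamma> \<Longrightarrow> 0 \<le> v x"
  using S1_nonneg[OF triangulation_facets_in, of v \<Gamma> x] unfolding Z_eq_nodes unfolding closure_part by blast

lemma S1_part_eq:
  "v \<in> S1 facets \<Longrightarrow> w \<in> S1 facets \<Longrightarrow> (\<And>z. z \<in> Z \<Longrightarrow> v z = w z) \<Longrightarrow> x \<in> closure \<Gamma> \<Longrightarrow> v x = w x"
  using S1_eq[OF triangulation_facets_in, of v \<Gamma> w x] unfolding Z_eq_nodes unfolding closure_part by blast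

lemma S1_part_continuous: "v \<in> S1 facets \<Longrightarrow> continuous_on (closure \<Gamma>) v"
  by (simp add: S1_def closure_part)

lemma interp: "interp \<Omega> \<T> \<Gamma> v \<in> S1 facets" "z \<in> Z \<Longrightarrow> interp \<Omega> \<T> \<Gamma> v z = v z"
proof -
  have "\<exists>w. w \<in> S1 facets \<and> (\<forall>z\<in>Z. w z = v z)"
    using S1_interpolation[OF triangulation_facets_in, of \<Gamma> v] Z_eq_nodes by metis
  then have "interp \<Omega> \<T> \<Gamma> v \<in> S1 facets \<and> (\<forall>z\<in>Z. interp \<Omega> \<T> \<Gamma> v z = v z)"
    unfolding interp_def by (rule someI_ex)
  then show "interp \<Omega> \<T> \<Gamma> v \<in> S1 facets" "z \<in> Z \<Longrightarrow> interp \<Omega> \<T> \<Gamma> v z = v z" by auto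
qed

lemma integrable_part:
  fixes v :: "'a \<Rightarrow> real"
  shows "continuous_on (closure \<Gamma>) v \<Longrightarrow> set_integrable (boundary_measure \<Omega>) \<Gamma> v"
  by (rule set_integrable_boundary_part[OF part_open])

definition hat :: "'a \<Rightarrow> 'a \<Rightarrow> real" where
  "hat z = interp \<Omega> \<T> \<Gamma> (\<lambda>x. if x = z then 1 else 0)"

text \<open>The diagonal entries of the lumped mass matrix.\<close>

definition weight :: "'a \<Rightarrow> real" where
  "weight z = (LINT x:\<Gamma>|boundary_measure \<Omega>. hat z x)"

lemma hat: "hat z \<in> S1 facets" "y \<in> Z \<Longrightarrow> hat z y = (if y = z then 1 else 0)"
  by (simp_all add: hat_def interp)

lemma hat_nonneg: "x \<in> closure \<Gamma> \<Longrightarrow> 0 \<le> hat z x"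
  using hat S1_part_nonneg by auto

lemma part_borel: "\<Gamma> \<in> sets borel"
  by (rule boundary_part_borel[OF part_open])

lemma integral_S1_part:
  assumes w: "w \<in> S1 facets"
  shows "(LINT x:\<Gamma>|boundary_measure \<Omega>. w x) = (\<Sum>z\<in>Z. weight z * w z)"
proof -
  have "w x = (\<Sum>z\<in>Z. w z * hat z x)" if "x \<in> closure \<Gamma>" for x
  proof (rule S1_part_eq[OF w _ _ that])
    show "(\<lambda>x. \<Sum>z\<in>Z. w z * hat z x) \<in> S1 facets" by (rule S1_sum) (rule hat)
    show "w y = (\<Sum>z\<in>Z. w z * hat z y)" if "y \<in> Z" for y
      using that by (simp add: hat if_distrib finite_Z cong: if_cong)
  qed
  then have "(LINT x:\<Gamma>|boundary_measure \<Omega>. w x) = (LINT x:\<Gamma>|boundary_measure \<Omega>. (\<Sum>z\<in>Z. w z * hat z x))"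
    using part_borel closure_subset[of \<Gamma>] by (intro set_lebesgue_integral_cong) auto
  also have "\<dots> = (\<Sum>z\<in>Z. (LINT x:\<Gamma>|boundary_measure \<Omega>. w z * hat z x))"
    unfolding set_lebesgue_integral_def scaleR_sum_right
  proof (rule Bochner_Integration.integral_sum)
    fix z
    have "set_integrable (boundary_measure \<Omega>) \<Gamma> (\<lambda>x. w z * hat z x)"
      by (intro integrable_part continuous_intros S1_part_continuous hat)
    then show "integrable (boundary_measure \<Omega>) (\<lambda>x. indicator \<Gamma> x *\<^sub>R (w z * hat z x))"
      by (simp add: set_integrable_def)
  qed
  also have "\<dots> = (\<Sum>z\<in>Z. weight z * w z)"
    by (intro sum.cong refl) (simp add: weight_def mult.commute)
  finally show ?thesis .
qed

text \<open>The hat function is nonnegative and positive in the relative interior of a facet with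
  vertex \<open>z\<close>, where a set of positive area lies.\<close>

lemma weight_pos:
  assumes z: "z \<in> Z" shows "0 < weight z"
proof -
  obtain S where S: "S \<in> facets" "z extreme_point_of S"
    using z unfolding Z_eq_nodes by (auto simp: nodes_def)
  obtain A where A: "A \<in> sets borel" "A \<subseteq> \<Gamma> \<inter> rel_interior S" "emeasure (boundary_measure \<Omega>) A > 0"
    using facet_part_not_null[OF part_open S(1)] .
  have SG: "S \<subseteq> closure \<Gamma>" using S(1) closure_part by auto
  have zS: "z \<in> S" using S(2) by (simp add: extreme_point_of_def)
  obtain a b where ab: "\<And>x. x \<in> S \<Longrightarrow> hat z x = a \<bullet> x + b"
    using hat(1)[of z] S(1) unfolding S1_def by blast
  have pos: "0 < hat z x" if x: "x \<in> rel_interior S" for x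
  proof (rule ccontr)
    assume "\<not> 0 < hat z x"
    have xS: "x \<in> S" using x rel_interior_subset by blast
    then have hx: "a \<bullet> x + b = 0"
      using \<open>\<not> 0 < hat z x\<close> hat_nonneg[of x z] SG ab by fastforce
    have "convex S" using simplex_convex[OF triangulation_facets_in S(1)] .
    \<comment> \<open>The segment from \<open>z\<close> through \<open>x\<close> can be prolonged
      beyond \<open>x\<close> inside \<open>S\<close>; an affine function with value 1 at
      \<open>z\<close> and 0 at \<open>x\<close> is negative there.\<close>
    from bspec[OF convex_rel_interior_if2[OF this x] hull_inc[OF zS]]
    obtain e where e: "e > 1" "(1 - e) *\<^sub>R z + e *\<^sub>R x \<in> S" by auto
    have "0 \<le> hat z ((1 - e) *\<^sub>R z + e *\<^sub>R x)" using hat_nonneg e(2) SG by blast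
    also have "\<dots> = (1 - e) * (a \<bullet> z + b) + e * (a \<bullet> x + b)"
      unfolding ab[OF e(2)] by (simp add: inner_add_right algebra_simps)
    also have "\<dots> = 1 - e" using hx ab[OF zS] hat(2)[OF z, of z] by simp
    finally show False using e(1) by simp
  qed
  have int: "integrable (boundary_measure \<Omega>) (\<lambda>x. indicator \<Gamma> x *\<^sub>R hat z x)"
    using integrable_part[OF S1_part_continuous[OF hat(1)]] by (simp add: set_integrable_def)
  have nn: "0 \<le> indicator \<Gamma> x *\<^sub>R hat z x" for x
    using hat_nonneg[of x z] closure_subset[of \<Gamma>] by (auto simp: indicator_def)
  have "0 \<le> weight z"
    unfolding weight_def set_lebesgue_integral_def using nn by (intro integral_nonneg_AE) auto
  moreover have "weight z \<noteq> 0"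
  proof
    assume "weight z = 0"
    then have "AE x in boundary_measure \<Omega>. indicator \<Gamma> x *\<^sub>R hat z x = 0"
      using integral_nonneg_eq_0_iff_AE[OF int] nn by (simp add: weight_def set_lebesgue_integral_def)
    moreover have "indicator \<Gamma> x *\<^sub>R hat z x \<noteq> 0" if "x \<in> A" for x
      using that A(2) pos[of x] by (auto simp: indicator_def)
    ultimately have "AE x in boundary_measure \<Omega>. x \<notin> A" by (auto elim: eventually_mono)
    then have "emeasure (boundary_measure \<Omega>) A = 0"
      using A(1) AE_iff_measurable[of A "boundary_measure \<Omega>" "\<lambda>x. x \<notin> A"] by simp
    then show False using A(3) by simp
  qed
  ultimately show ?thesis by simp
qed

lemma inner_h_eq: "inner_h \<Omega> \<T> \<Gamma> v w = (\<Sum>z\<in>Z. weight z * (v z * w z))"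
  unfolding inner_h_def inner_L2_def using integral_S1_part[OF interp(1)] interp(2) by simp

lemma norm_h_square: "(norm_h \<Omega> \<T> \<Gamma> v)\<^sup>2 = (\<Sum>z\<in>Z. weight z * (v z)\<^sup>2)"
proof -
  have "0 \<le> (\<Sum>z\<in>Z. weight z * (v z * v z))"
    by (rule sum_nonneg) (use weight_pos in \<open>simp add: less_imp_le\<close>)
  then show ?thesis by (simp add: norm_h_def inner_h_eq power2_eq_square)
qed

lemma norm_L1_interp:
  assumes "\<And>z. z \<in> Z \<Longrightarrow> 0 \<le> v z"
  shows "norm_L1 (boundary_measure \<Omega>) \<Gamma> (interp \<Omega> \<T> \<Gamma> v) = (\<Sum>z\<in>Z. weight z * v z)"
proof -
  have "0 \<le> interp \<Omega> \<T> \<Gamma> v x" if "x \<in> closure \<Gamma>" for x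
    using S1_part_nonneg[OF interp(1) _ that] interp(2) assms by auto
  then have "norm_L1 (boundary_measure \<Omega>) \<Gamma> (interp \<Omega> \<T> \<Gamma> v) = (LINT x:\<Gamma>|boundary_measure \<Omega>. interp \<Omega> \<T> \<Gamma> v x)"
    unfolding norm_L1_def using part_borel closure_subset[of \<Gamma>] by (intro set_lebesgue_integral_cong) auto
  then show ?thesis using integral_S1_part[OF interp(1)] interp(2) by simp
qed

end

section \<open>Weak gradients\<close>

definition test_function :: "'a::euclidean_space set \<Rightarrow> ('a \<Rightarrow> real) \<Rightarrow> ('a \<Rightarrow> 'a) \<Rightarrow> bool" where
  "test_function \<Omega> \<phi> D \<longleftrightarrow> (\<exists>K. compact K \<and> K \<subseteq> \<Omega> \<and> (\<forall>x. x \<notin> K \<longrightarrow> \<phi> x = 0)) \<and>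
    (\<forall>x. GDERIV \<phi> x :> D x) \<and> continuous_on UNIV D"

lemma weak_gradient_iff:
  "weak_gradient \<Omega> v G \<longleftrightarrow> v \<in> space_L2 lborel \<Omega> \<and> G \<in> space_L2 lborel \<Omega> \<and>
     (\<forall>\<phi> D. test_function \<Omega> \<phi> D \<longrightarrow>
        (LINT x:\<Omega>|lborel. v x *\<^sub>R D x) = - (LINT x:\<Omega>|lborel. \<phi> x *\<^sub>R G x))"
  unfolding weak_gradient_def test_function_def by blast

lemma GDERIV_continuous: "(\<And>x. GDERIV f x :> D x) \<Longrightarrow> continuous_on UNIV f"
  unfolding gderiv_def by (meson continuous_at_imp_continuous_on has_derivative_continuous)

lemma test_function_continuous: "test_function \<Omega> \<phi> D \<Longrightarrow> continuous_on UNIV \<phi>"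
  unfolding test_function_def using GDERIV_continuous by blast

section \<open>Test functions approximating the indicator of an open set\<close>

lemma has_real_derivative_square_pos_part:
  "((\<lambda>s. (max 0 s)\<^sup>2) has_real_derivative 2 * max 0 s) (at s)"
proof (cases s "0 :: real" rule: linorder_cases)
  case less
  have "((\<lambda>s. 0) has_real_derivative 2 * max 0 s) (at s)" using less by simp
  then show ?thesis
    by (rule has_field_derivative_transform_within_open[of _ _ _ "{..<0}"]) (use less in auto)
next
  case greater
  have "((\<lambda>s. s\<^sup>2) has_real_derivative 2 * max 0 s) (at s)"
    using greater by (auto intro!: derivative_eq_intros)
  then show ?thesis
    by (rule has_field_derivative_transform_within_open[of _ _ _ "{0<..}"]) (use greater in auto)
next
  case equal
  have "((\<lambda>y. max 0 y) \<longlongrightarrow> max 0 0) (at (0::real))" by (intro tendsto_intros)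
  then have "((\<lambda>y. max 0 y) \<longlongrightarrow> 0) (at (0::real))" by simp
  moreover have "\<forall>\<^sub>F y in at (0::real). max 0 y = ((max 0 y)\<^sup>2 - (max 0 0)\<^sup>2) / (y - 0)"
    by (auto simp: eventually_at_filter max_def power2_eq_square)
  ultimately have "((\<lambda>y. ((max 0 y)\<^sup>2 - (max 0 0)\<^sup>2) / (y - 0)) \<longlongrightarrow> 0) (at (0::real))"
    by (rule Lim_transform_eventually)
  then show ?thesis using equal by (simp add: has_field_derivative_iff)
qed

text \<open>Test functions need only be continuously differentiable, so the squared positive part of
  \<open>r\<^sup>2 - (x - c) \<bullet> (x - c)\<close> suffices in place of an exponential
  bump.\<close>

lemma ball_bump:
  fixes c :: "'a::euclidean_space"
  assumes "r > 0"
  obtains P D where "\<And>x. 0 \<le> (P x :: real)" "\<And>x. 0 < P x \<longleftrightarrow> x \<in> ball c r"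
    "\<And>x. GDERIV P x :> D x" "continuous_on UNIV D"
proof -
  define N where "N x = r\<^sup>2 - (x - c) \<bullet> (x - c)" for x
  define P where "P x = (max 0 (N x))\<^sup>2" for x
  define D where "D x = (2 * max 0 (N x)) *\<^sub>R (- (2 *\<^sub>R (x - c)))" for x
  have pos: "0 < N x \<longleftrightarrow> x \<in> ball c r" for x
  proof -
    have d: "dist c x = norm (x - c)" by (simp add: dist_norm norm_minus_commute)
    have "N x = r\<^sup>2 - (dist c x)\<^sup>2" unfolding d N_def power2_norm_eq_inner ..
    moreover have "(dist c x)\<^sup>2 < r\<^sup>2 \<longleftrightarrow> dist c x < r"
    proof
      show "dist c x < r" if "(dist c x)\<^sup>2 < r\<^sup>2"
        using power2_less_imp_less[OF that] assms by simp
      show "(dist c x)\<^sup>2 < r\<^sup>2" if "dist c x < r"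
        using power_strict_mono[OF that] by simp
    qed
    ultimately show ?thesis by simp
  qed
  have "GDERIV N x :> - (2 *\<^sub>R (x - c))" for x
    unfolding gderiv_def N_def
    by (auto intro!: derivative_eq_intros simp: inner_commute)
  then have "GDERIV P x :> D x" for x
    unfolding P_def D_def by (rule GDERIV_DERIV_compose[OF _ has_real_derivative_square_pos_part])
  moreover have "continuous_on UNIV D"
    unfolding D_def N_def by (intro continuous_intros)
  moreover have "0 < P x \<longleftrightarrow> x \<in> ball c r" for x
    using pos[of x] by (auto simp: P_def max_def)
  ultimately show ?thesis using that[of P D] by (simp add: P_def)
qed

text \<open>The closed balls have to lie in \<open>U\<close>, since finite unions of them serve as
  compact supports; by Lindelof countably many suffice.\<close>

lemma open_countable_Union_balls:
  fixes U :: "'a::euclidean_space set"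
  assumes "open U" "U \<noteq> {}"
  obtains c :: "nat \<Rightarrow> 'a" and r where "\<And>i. r i > 0" "\<And>i. cball (c i) (r i) \<subseteq> U" "U = (\<Union>i. ball (c i) (r i))"
proof -
  define \<F> where "\<F> = {ball c r |c r. r > 0 \<and> cball c r \<subseteq> U}"
  obtain \<F>' where F': "\<F>' \<subseteq> \<F>" "countable \<F>'" "\<Union>\<F>' = \<Union>\<F>"
    by (rule Lindelof[of \<F>]) (auto simp: \<F>_def)
  have "\<Union>\<F> = U"
  proof
    show "U \<subseteq> \<Union>\<F>"
    proof
      fix x assume "x \<in> U"
      then obtain e where "e > 0" "cball x e \<subseteq> U" using assms(1) open_contains_cball by blast
      then show "x \<in> \<Union>\<F>" unfolding \<F>_def by (auto intro!: exI[of _ "ball x e"])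
    qed
    show "\<Union>\<F> \<subseteq> U" unfolding \<F>_def using ball_subset_cball by fast
  qed
  then have ne: "\<F>' \<noteq> {}" and U: "U = \<Union>\<F>'" using F'(3) assms(2) by auto
  have rng: "range (from_nat_into \<F>') = \<F>'" by (rule range_from_nat_into[OF ne F'(2)])
  have "\<forall>i. \<exists>c r. r > 0 \<and> cball c r \<subseteq> U \<and> from_nat_into \<F>' i = ball c r"
  proof
    fix i
    have "from_nat_into \<F>' i \<in> \<F>" using from_nat_into[OF ne] F'(1) by blast
    then show "\<exists>c r. r > 0 \<and> cball c r \<subseteq> U \<and> from_nat_into \<F>' i = ball c r"
      unfolding \<F>_def by blast
  qed
  from choice[OF this] obtain c
    where "\<forall>i. \<exists>r. r > 0 \<and> cball (c i) r \<subseteq> U \<and> from_nat_into \<F>' i = ball (c i) r" by blast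
  from choice[OF this] obtain r
    where cr: "\<And>i. r i > 0 \<and> cball (c i) (r i) \<subseteq> U \<and> from_nat_into \<F>' i = ball (c i) (r i)" by blast
  have "U = (\<Union>i. from_nat_into \<F>' i)" using U rng by simp
  then have "U = (\<Union>i. ball (c i) (r i))" using cr by simp
  then show ?thesis by (intro that[of r c]) (use cr in blast)+
qed

text \<open>With \<open>S\<close> the sum of the first \<open>n\<close> bumps on balls exhausting \<open>U\<close>, the functions \<open>n S / (1 + n S)\<close>
  converge to the indicator of \<open>U\<close>.\<close>

lemma indicator_test_functions:
  fixes U :: "'a::euclidean_space set"
  assumes U: "open U" "U \<subseteq> \<Omega>"
  obtains \<phi> D where "\<And>n::nat. test_function \<Omega> (\<phi> n) (D n)" "\<And>n x. 0 \<le> \<phi> n x \<and> \<phi> n x \<le> 1"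
    "\<And>x. (\<lambda>n. \<phi> n x) \<longlonglongrightarrow> indicator U x"
proof (cases "U = {}")
  case True
  have "test_function \<Omega> (\<lambda>x. 0) (\<lambda>x. 0)"
    unfolding test_function_def by (auto intro!: exI[of _ "{}"] GDERIV_const)
  then show ?thesis using that[of "\<lambda>_ _. 0" "\<lambda>_ _. 0"] True by simp
next
  case False
  obtain c r where cr: "\<And>i::nat. r i > 0" "\<And>i. cball (c i) (r i) \<subseteq> U" "U = (\<Union>i. ball (c i) (r i))"
    by (rule open_countable_Union_balls[OF U(1) False]) (rule that)
  have "\<exists>P D. (\<forall>x. 0 \<le> (P x :: real)) \<and> (\<forall>x. 0 < P x \<longleftrightarrow> x \<in> ball (c i) (r i)) \<and>
    (\<forall>x. GDERIV P x :> D x) \<and> continuous_on UNIV D" for i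
    using ball_bump[OF cr(1)[of i], of "c i"] by metis
  then obtain P D where P: "\<And>i x. 0 \<le> (P i x :: real)" "\<And>i x. 0 < P i x \<longleftrightarrow> x \<in> ball (c i) (r i)"
    "\<And>i x. GDERIV (P i) x :> D i x" "\<And>i. continuous_on UNIV (D i)" by metis
  define S where "S n x = (\<Sum>i<n. P i x)" for n x
  define DS where "DS n x = (\<Sum>i<n. D i x)" for n x
  have S0: "0 \<le> S n x" for n x unfolding S_def by (intro sum_nonneg P)
  have S: "GDERIV (S n) x :> DS n x" for n x
    using P(3) unfolding S_def DS_def gderiv_def inner_sum_right by (intro has_derivative_sum) auto
  \<comment> \<open>This is n s / (1 + n s) in a form that is easy to differentiate. As n grows it
    tends to 1 for s > 0 and stays 0 at s = 0.\<close>
  define h where "h n s = 1 - inverse (1 + real n * s)" for n s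
  define \<phi> where "\<phi> n x = h n (S n x)" for n x
  define D\<phi> where "D\<phi> n x = (real n * (inverse (1 + real n * S n x))\<^sup>2) *\<^sub>R DS n x" for n x
  have pos: "0 < 1 + real n * S n x" for n x using S0[of n x] by (simp add: add_pos_nonneg)
  have "GDERIV (\<phi> n) x :> D\<phi> n x" for n x
    unfolding \<phi>_def D\<phi>_def
  proof (rule GDERIV_DERIV_compose[OF S])
    show "(h n has_real_derivative real n * (inverse (1 + real n * S n x))\<^sup>2) (at (S n x))"
      unfolding h_def using pos[of n x]
      by (auto intro!: derivative_eq_intros simp: power2_eq_square)
  qed
  moreover have "continuous_on UNIV (D\<phi> n)" for n
  proof -
    have "continuous_on UNIV (S n)" by (rule GDERIV_continuous) (rule S)
    moreover have "continuous_on UNIV (DS n)" unfolding DS_def by (intro continuous_intros P)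
    ultimately show ?thesis unfolding D\<phi>_def
      by (intro continuous_intros ballI less_imp_neq[OF pos, symmetric])
  qed
  moreover have "\<exists>K. compact K \<and> K \<subseteq> \<Omega> \<and> (\<forall>x. x \<notin> K \<longrightarrow> \<phi> n x = 0)" for n
  proof (intro exI conjI allI impI)
    show "compact (\<Union>i<n. cball (c i) (r i))" by (intro compact_UN) auto
    show "(\<Union>i<n. cball (c i) (r i)) \<subseteq> \<Omega>" using cr(2) U(2) by blast
    fix x assume x: "x \<notin> (\<Union>i<n. cball (c i) (r i))"
    have "P i x = 0" if "i < n" for i
    proof -
      have "x \<notin> ball (c i) (r i)" using x that ball_subset_cball by blast
      then show ?thesis using P(1)[of i x] P(2)[of i x] by simp
    qed
    then show "\<phi> n x = 0" by (simp add: \<phi>_def h_def S_def)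
  qed
  ultimately have "test_function \<Omega> (\<phi> n) (D\<phi> n)" for n by (simp add: test_function_def)
  moreover have "0 \<le> \<phi> n x \<and> \<phi> n x \<le> 1" for n x
    using S0[of n x] pos[of n x] by (simp add: \<phi>_def h_def field_simps)
  moreover have "(\<lambda>n. \<phi> n x) \<longlonglongrightarrow> indicator U x" for x
  proof (cases "x \<in> U")
    case True
    then obtain i where i: "0 < P i x" using cr(3) P(2) by blast
    have "filterlim (\<lambda>n. 1 + real n * S n x) at_top sequentially"
    proof (rule filterlim_at_top_mono)
      show "filterlim (\<lambda>n. real n * P i x) at_top sequentially"
        using i by (intro filterlim_at_top_mult_tendsto_pos[OF tendsto_const _ filterlim_real_sequentially]) auto
      show "\<forall>\<^sub>F n in sequentially. real n * P i x \<le> 1 + real n * S n x"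
      proof (rule eventually_mono[OF eventually_gt_at_top[of i]])
        fix n assume "i < n"
        then have "P i x \<le> S n x" unfolding S_def using P(1) by (intro member_le_sum) auto
        then show "real n * P i x \<le> 1 + real n * S n x"
          using mult_left_mono[of "P i x" "S n x" "real n"] by simp
      qed
    qed
    then have "(\<lambda>n. inverse (1 + real n * S n x)) \<longlonglongrightarrow> 0"
      by (rule tendsto_inverse_0_at_top)
    then have "(\<lambda>n. 1 - inverse (1 + real n * S n x)) \<longlonglongrightarrow> 1 - 0" by (intro tendsto_intros)
    then show ?thesis using True by (simp add: \<phi>_def h_def)
  next
    case False
    then have "P i x = 0" for i
      using P(1)[of i x] P(2)[of i x] cr(3) by fastforce
    then show ?thesis using False by (simp add: \<phi>_def h_def S_def)
  qed
  ultimately show ?thesis using that by blast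
qed

section \<open>Uniqueness of weak gradients\<close>

lemma space_L2_integrable:
  fixes G :: "'a::euclidean_space \<Rightarrow> 'b::euclidean_space"
  assumes \<Omega>: "open \<Omega>" "bounded \<Omega>" and G: "G \<in> space_L2 lborel \<Omega>"
  shows "set_integrable lborel \<Omega> G"
proof -
  have m: "(\<lambda>x. indicator \<Omega> x *\<^sub>R G x) \<in> borel_measurable lborel"
    and i: "integrable lborel (\<lambda>x. indicator \<Omega> x *\<^sub>R (norm (G x))\<^sup>2)"
    using G by (auto simp: space_L2_def set_borel_measurable_def set_integrable_def)
  have "integrable lborel (\<lambda>x. indicator \<Omega> x :: real)"
    using emeasure_bounded_finite[OF \<Omega>(2)] \<Omega>(1) by (intro integrable_real_indicator) auto
  then have "integrable lborel (\<lambda>x. indicator \<Omega> x + indicator \<Omega> x *\<^sub>R (norm (G x))\<^sup>2 :: real)"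
    using i by (rule Bochner_Integration.integrable_add)
  then show ?thesis
    unfolding set_integrable_def
  proof (rule Bochner_Integration.integrable_bound[OF _ m], intro AE_I2)
    fix x
    have "norm (G x) \<le> 1 + (norm (G x))\<^sup>2"
      using zero_le_power2[of "norm (G x) - 1/2"] by (simp add: power2_eq_square algebra_simps)
    then show "norm (indicator \<Omega> x *\<^sub>R G x) \<le> norm (indicator \<Omega> x + indicator \<Omega> x *\<^sub>R (norm (G x))\<^sup>2 :: real)"
      by (simp add: indicator_def)
  qed
qed

text \<open>The fundamental lemma of the calculus of variations. The difference, extended by zero,
  integrates to zero against bounded test functions, by dominated convergence over open sets, and by
  Dynkin's argument over Borel sets; so it vanishes almost everywhere.\<close>

lemma weak_gradient_unique:
  fixes \<Omega> :: "'a::euclidean_space set"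
  assumes \<Omega>: "open \<Omega>" "bounded \<Omega>" and G: "weak_gradient \<Omega> v G" "weak_gradient \<Omega> v G'"
  shows "AE x in lborel. x \<in> \<Omega> \<longrightarrow> G x = G' x"
proof -
  define \<Delta> where "\<Delta> x = indicator \<Omega> x *\<^sub>R (G x - G' x)" for x
  have int: "integrable lborel (\<lambda>x. indicator \<Omega> x *\<^sub>R G x)" "integrable lborel (\<lambda>x. indicator \<Omega> x *\<^sub>R G' x)"
    using G space_L2_integrable[OF \<Omega>] by (auto simp: weak_gradient_iff set_integrable_def)
  have \<Delta>int: "integrable lborel \<Delta>"
    unfolding \<Delta>_def scaleR_diff_right by (intro Bochner_Integration.integrable_diff int)
  have \<Delta>m: "\<Delta> \<in> borel_measurable lborel" using \<Delta>int by simp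
  have zero: "(\<integral>x. \<phi> x *\<^sub>R \<Delta> x \<partial>lborel) = 0" if \<phi>: "test_function \<Omega> \<phi> D" and bd: "\<And>x. \<bar>\<phi> x\<bar> \<le> 1" for \<phi> D
  proof -
    have m: "\<phi> \<in> borel_measurable lborel"
      using borel_measurable_continuous_onI[OF test_function_continuous[OF \<phi>]] by simp
    have i: "integrable lborel (\<lambda>x. \<phi> x *\<^sub>R F x)" if F: "integrable lborel F" for F :: "'a \<Rightarrow> 'a"
    proof (rule Bochner_Integration.integrable_bound[OF F])
      show "(\<lambda>x. \<phi> x *\<^sub>R F x) \<in> borel_measurable lborel" using m F by measurable
      show "AE x in lborel. norm (\<phi> x *\<^sub>R F x) \<le> norm (F x)"
        using bd by (intro AE_I2) (simp add: mult_left_le_one_le)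
    qed
    have "(LINT x:\<Omega>|lborel. \<phi> x *\<^sub>R G x) = (LINT x:\<Omega>|lborel. \<phi> x *\<^sub>R G' x)"
    proof -
      have "(LINT x:\<Omega>|lborel. v x *\<^sub>R D x) = - (LINT x:\<Omega>|lborel. \<phi> x *\<^sub>R F x)"
        if "weak_gradient \<Omega> v F" for F
        using that \<phi> unfolding weak_gradient_iff by blast
      from this[OF G(1)] this[OF G(2)] show ?thesis by simp
    qed
    then have "(\<integral>x. \<phi> x *\<^sub>R (indicator \<Omega> x *\<^sub>R G x) \<partial>lborel) = (\<integral>x. \<phi> x *\<^sub>R (indicator \<Omega> x *\<^sub>R G' x) \<partial>lborel)"
      by (simp add: set_lebesgue_integral_def mult.commute)
    then have "(\<integral>x. \<phi> x *\<^sub>R (indicator \<Omega> x *\<^sub>R G x) - \<phi> x *\<^sub>R (indicator \<Omega> x *\<^sub>R G' x) \<partial>lborel) = 0"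
      using i[OF int(1)] i[OF int(2)] by simp
    then show ?thesis by (simp add: \<Delta>_def scaleR_diff_right)
  qed
  have open_zero: "(LINT x:U|lborel. \<Delta> x) = 0" if U: "open U" for U
  proof -
    have "open (U \<inter> \<Omega>)" "U \<inter> \<Omega> \<subseteq> \<Omega>" using U \<Omega>(1) by auto
    then obtain \<phi> D where \<phi>: "\<And>n::nat. test_function \<Omega> (\<phi> n) (D n)" "\<And>n x. 0 \<le> \<phi> n x \<and> \<phi> n x \<le> 1"
        "\<And>x. (\<lambda>n. \<phi> n x) \<longlonglongrightarrow> indicator (U \<inter> \<Omega>) x"
      by (rule indicator_test_functions) (rule that)
    have "(\<lambda>n. \<integral>x. \<phi> n x *\<^sub>R \<Delta> x \<partial>lborel) \<longlonglongrightarrow> (\<integral>x. indicator (U \<inter> \<Omega>) x *\<^sub>R \<Delta> x \<partial>lborel)"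
    proof (rule integral_dominated_convergence)
      show "(\<lambda>x. indicator (U \<inter> \<Omega>) x *\<^sub>R \<Delta> x) \<in> borel_measurable lborel"
        by (intro borel_measurable_scaleR borel_measurable_indicator \<Delta>m) (use U \<Omega>(1) in auto)
      show "(\<lambda>x. \<phi> n x *\<^sub>R \<Delta> x) \<in> borel_measurable lborel" for n
      proof -
        have "\<phi> n \<in> borel_measurable lborel"
          using borel_measurable_continuous_onI[OF test_function_continuous[OF \<phi>(1)]] by simp
        then show ?thesis by (intro borel_measurable_scaleR \<Delta>m)
      qed
      show "integrable lborel (\<lambda>x. norm (\<Delta> x))" using \<Delta>int by simp
      show "AE x in lborel. (\<lambda>n. \<phi> n x *\<^sub>R \<Delta> x) \<longlonglongrightarrow> indicator (U \<inter> \<Omega>) x *\<^sub>R \<Delta> x"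
        by (intro AE_I2 tendsto_intros \<phi>)
      show "AE x in lborel. norm (\<phi> n x *\<^sub>R \<Delta> x) \<le> norm (\<Delta> x)" for n
        using \<phi>(2)[of n] by (intro AE_I2) (simp add: mult_left_le_one_le)
    qed
    moreover have "(\<integral>x. \<phi> n x *\<^sub>R \<Delta> x \<partial>lborel) = 0" for n
      by (rule zero[OF \<phi>(1)]) (use \<phi>(2)[of n] in simp)
    ultimately have "(\<integral>x. indicator (U \<inter> \<Omega>) x *\<^sub>R \<Delta> x \<partial>lborel) = 0"
      by (simp add: LIMSEQ_const_iff)
    moreover have "(\<lambda>x. indicator (U \<inter> \<Omega>) x *\<^sub>R \<Delta> x) = (\<lambda>x. indicator U x *\<^sub>R \<Delta> x)"
      by (auto simp: \<Delta>_def indicator_def fun_eq_iff)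
    ultimately show ?thesis by (simp add: set_lebesgue_integral_def)
  qed
  have sint: "set_integrable lborel A \<Delta>" if "A \<in> sets borel" for A
    using \<Delta>int that unfolding set_integrable_def by (intro integrable_mult_indicator) auto
  have all: "(LINT x:A|lborel. \<Delta> x) = 0" if "A \<in> sets borel" for A
  proof -
    have A: "A \<in> sigma_sets UNIV {S::'a set. open S}" using that by (simp add: borel_def)
    have stable: "Int_stable {S::'a set. open S}" by (auto simp: Int_stable_def)
    have "{S::'a set. open S} \<subseteq> Pow UNIV" by simp
    from stable this A show ?thesis
    proof (induction rule: sigma_sets_induct_disjoint)
      case (basic A)
      then show ?case using open_zero by simp
    next
      case (compl A)
      then have A: "A \<in> sets borel" by (simp add: borel_def)
      have "(LINT x:UNIV|lborel. \<Delta> x) = (LINT x:A \<union> (UNIV - A)|lborel. \<Delta> x)" by simp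
      also have "\<dots> = (LINT x:A|lborel. \<Delta> x) + (LINT x:UNIV - A|lborel. \<Delta> x)"
        by (rule set_integral_Un) (use A sint in auto)
      finally show ?case using compl open_zero[of UNIV] by simp
    next
      case (union A)
      then have A: "\<And>i. A i \<in> sets borel" by (auto simp: borel_def)
      have "(LINT x:(\<Union>i. A i)|lborel. \<Delta> x) = (\<Sum>i. (LINT x:A i|lborel. \<Delta> x))"
        by (rule lebesgue_integral_countable_add) (use A union sint in \<open>auto simp: disjoint_family_on_def\<close>)
      then show ?case using union by simp
    qed (auto simp: set_lebesgue_integral_def)
  qed
  have "AE x in lborel. \<Delta> x = 0"
    by (rule sigma_finite_measure.density_zero[OF sigma_finite_lborel \<Delta>int]) (use all in simp)
  then show ?thesis by eventually_elim (auto simp: \<Delta>_def)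
qed

text \<open>Uniform bounds from which integrable majorants are built. The gradient vanishes off
  \<open>K\<close> because the complement of \<open>K\<close> is open, and the mean value inequality
  turns its bound into a Lipschitz constant.\<close>

lemma test_function_bounds:
  fixes \<phi> :: "'a::euclidean_space \<Rightarrow> real"
  assumes "test_function \<Omega> \<phi> D"
  obtains K B where "compact K" "K \<subseteq> \<Omega>" "\<And>x. x \<notin> K \<Longrightarrow> \<phi> x = 0" "B \<ge> 0" "\<And>x. \<bar>\<phi> x\<bar> \<le> B"
    "\<And>x. x \<notin> K \<Longrightarrow> D x = 0" "\<And>x. norm (D x) \<le> B" "\<And>x y. \<bar>\<phi> x - \<phi> y\<bar> \<le> B * norm (x - y)"
proof -
  obtain K where K: "compact K" "K \<subseteq> \<Omega>" "\<And>x. x \<notin> K \<Longrightarrow> \<phi> x = 0"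
    and D: "\<And>x. GDERIV \<phi> x :> D x" "continuous_on UNIV D"
    using assms by (auto simp: test_function_def)
  have D0: "D x = 0" if x: "x \<notin> K" for x
  proof -
    have "((\<lambda>x. 0) has_derivative (\<lambda>h. 0)) (at x)" by simp
    then have "(\<phi> has_derivative (\<lambda>h. 0)) (at x)"
      by (rule has_derivative_transform_within_open[of _ _ _ _ "- K"])
        (use x K compact_imp_closed in auto)
    then have "(\<lambda>h. h \<bullet> D x) = (\<lambda>h. 0)"
      using D(1) has_derivative_unique unfolding gderiv_def by blast
    then have "D x \<bullet> D x = 0" by metis
    then show ?thesis by simp
  qed
  have "compact (D ` K)" "compact (\<phi> ` K)"
    using K(1) D(2) test_function_continuous[OF assms]
    by (auto intro!: compact_continuous_image elim: continuous_on_subset)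
  then have "bounded (D ` K)" "bounded (\<phi> ` K)" by (auto intro: compact_imp_bounded)
  then obtain B1 B2 where B: "\<And>x. x \<in> K \<Longrightarrow> norm (D x) \<le> B1" "\<And>x. x \<in> K \<Longrightarrow> norm (\<phi> x) \<le> B2"
    unfolding bounded_iff by auto
  define B where "B = \<bar>B1\<bar> + \<bar>B2\<bar>"
  have bD: "norm (D x) \<le> B" for x using B(1)[of x] D0[of x] by (cases "x \<in> K") (auto simp: B_def)
  have b\<phi>: "\<bar>\<phi> x\<bar> \<le> B" for x using B(2)[of x] K(3)[of x] by (cases "x \<in> K") (auto simp: B_def)
  have B0: "B \<ge> 0" by (simp add: B_def)
  have lip: "\<bar>\<phi> x - \<phi> y\<bar> \<le> B * norm (x - y)" for x y
  proof -
    have "norm (\<phi> x - \<phi> y) \<le> B * norm (x - y)"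
    proof (rule differentiable_bound[of UNIV])
      show "(\<phi> has_derivative (\<lambda>h. h \<bullet> D z)) (at z within UNIV)" for z
        using D(1)[of z] by (simp add: gderiv_def)
      show "onorm (\<lambda>h. h \<bullet> D z) \<le> B" for z
        using onorm_le[of "\<lambda>h. h \<bullet> D z" "norm (D z)"] bD[of z] Cauchy_Schwarz_ineq2[of _ "D z"]
        by (simp add: mult.commute)
    qed auto
    then show ?thesis by simp
  qed
  show ?thesis by (rule that[OF K(1) K(2) K(3) B0 b\<phi> D0 bD lip])
qed

lemma set_integrable_bounded:
  fixes f :: "'a::euclidean_space \<Rightarrow> 'b::euclidean_space"
  assumes \<Omega>: "open \<Omega>" "bounded \<Omega>" and m: "set_borel_measurable lborel \<Omega> f"
    and B: "\<And>x. x \<in> \<Omega> \<Longrightarrow> norm (f x) \<le> B"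
  shows "set_integrable lborel \<Omega> f"
  unfolding set_integrable_def
proof (rule integrableI_bounded_set[of \<Omega>])
  show "emeasure lborel \<Omega> < \<infinity>" using emeasure_bounded_finite[OF \<Omega>(2)] .
  show "AE x in lborel. x \<in> \<Omega> \<longrightarrow> norm (indicator \<Omega> x *\<^sub>R f x) \<le> B" using B by simp
qed (use m \<Omega> in \<open>auto simp: set_borel_measurable_def\<close>)

lemma space_L2_bounded:
  fixes f :: "'a::euclidean_space \<Rightarrow> 'b::euclidean_space"
  assumes \<Omega>: "open \<Omega>" "bounded \<Omega>" and m: "set_borel_measurable lborel \<Omega> f"
    and B: "\<And>x. x \<in> \<Omega> \<Longrightarrow> norm (f x) \<le> B"
  shows "f \<in> space_L2 lborel \<Omega>"
proof -
  have "(\<lambda>x. (norm (indicator \<Omega> x *\<^sub>R f x))\<^sup>2) \<in> borel_measurable lborel"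
    using m unfolding set_borel_measurable_def by measurable
  also have "(\<lambda>x. (norm (indicator \<Omega> x *\<^sub>R f x))\<^sup>2) = (\<lambda>x. indicator \<Omega> x *\<^sub>R (norm (f x))\<^sup>2)"
    by (auto simp: fun_eq_iff indicator_def)
  finally have "set_borel_measurable lborel \<Omega> (\<lambda>x. (norm (f x))\<^sup>2)" by (simp add: set_borel_measurable_def)
  then have "set_integrable lborel \<Omega> (\<lambda>x. (norm (f x))\<^sup>2)"
    by (rule set_integrable_bounded[OF \<Omega>, of _ "B\<^sup>2"]) (use B in \<open>auto intro!: power_mono\<close>)
  then show ?thesis using m by (simp add: space_L2_def)
qed

lemma integral_difference_zero:
  fixes F :: "'a::euclidean_space \<Rightarrow> real"
  assumes "integrable lborel F"
  shows "integrable lborel (\<lambda>x. F (x + h))" "(\<integral>x. F (x + h) - F x \<partial>lborel) = 0"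
proof -
  have eq: "distr lborel borel (\<lambda>x. x + h) = (lborel :: 'a measure)"
  proof -
    have "(\<lambda>x. x + h) = (+) h" by (simp add: fun_eq_iff add.commute)
    then show ?thesis using lborel_distr_plus[of h] by simp
  qed
  have "integrable (distr lborel borel (\<lambda>x. x + h)) F" using assms unfolding eq .
  then show i: "integrable lborel (\<lambda>x. F (x + h))"
    using integrable_distr[of "\<lambda>x. x + h" lborel borel F] by simp
  have "(\<integral>x. F (x + h) \<partial>lborel) = integral\<^sup>L (distr lborel borel (\<lambda>x. x + h)) F"
    by (rule integral_distr[symmetric]) (use assms in auto)
  then show "(\<integral>x. F (x + h) - F x \<partial>lborel) = 0"
    using i assms unfolding eq by simp
qed

section \<open>Elementwise gradients of piecewise affine functions\<close>

context mesh
begin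

definition slope :: "'a set \<Rightarrow> ('a \<Rightarrow> real) \<Rightarrow> 'a" where
  "slope T v = (SOME a. \<exists>b. \<forall>x\<in>T. v x = a \<bullet> x + b)"

text \<open>On the faces between simplices, where the slopes compete, the value is 0; these faces
  form a null set.\<close>

definition piecewise_grad :: "('a \<Rightarrow> real) \<Rightarrow> 'a \<Rightarrow> 'a" where
  "piecewise_grad v x = (\<Sum>T\<in>\<T>. indicator (interior T) x *\<^sub>R slope T v)"

lemma finite_tri: "finite \<T>"
  using triangulationD(1)[OF tri] .

lemma slope: "v \<in> S1 \<T> \<Longrightarrow> T \<in> \<T> \<Longrightarrow> \<exists>b. \<forall>x\<in>T. v x = slope T v \<bullet> x + b"
  unfolding slope_def by (rule someI_ex) (auto simp: S1_def)

lemma slope_eqI: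
  assumes v: "v \<in> S1 \<T>" and T: "T \<in> \<T>" and a: "\<And>x. x \<in> T \<Longrightarrow> v x = a \<bullet> x + b"
  shows "slope T v = a"
proof -
  obtain b' where b': "\<forall>x\<in>T. v x = slope T v \<bullet> x + b'" using slope[OF v T] by auto
  obtain p e where e: "e > 0" "ball p e \<subseteq> T"
    using tri_interior[OF tri full T] unfolding interior_def by (auto simp: open_contains_ball) blast
  define d where "d = slope T v - a"
  have d: "d \<bullet> x = b - b'" if "x \<in> ball p e" for x
    using a[of x] b' e(2) that unfolding d_def inner_diff_left by fastforce
  show ?thesis
  proof (rule ccontr)
    assume "slope T v \<noteq> a"
    then have d0: "d \<noteq> 0" by (simp add: d_def)
    \<comment> \<open>Moving in the direction \<open>d\<close> changes \<open>d \<bullet> x\<close>,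
      which is constant on the ball.\<close>
    define y where "y = p + (e / (2 * norm d)) *\<^sub>R d"
    have "y \<in> ball p e" using e(1) d0 by (simp add: y_def dist_norm)
    then have "d \<bullet> y = d \<bullet> p" using d e(1) by simp
    then show False using d0 e(1) by (simp add: y_def inner_add_right)
  qed
qed

lemma slope_comb:
  assumes "v \<in> S1 \<T>" "w \<in> S1 \<T>" "T \<in> \<T>"
  shows "slope T (\<lambda>x. v x + t * w x) = slope T v + t *\<^sub>R slope T w"
proof -
  obtain b b' where "\<forall>x\<in>T. v x = slope T v \<bullet> x + b" "\<forall>x\<in>T. w x = slope T w \<bullet> x + b'"
    using slope assms by blast
  then show ?thesis
    by (intro slope_eqI[of _ _ _ "b + t * b'"] S1_comb assms) (simp add: inner_add_left algebra_simps)
qed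

lemma interiors_disjoint:
  assumes "T \<in> \<T>" "T' \<in> \<T>" "x \<in> interior T" "x \<in> interior T'"
  shows "T = T'"
proof -
  have "x \<in> T \<inter> T'" using assms interior_subset by blast
  then have "T \<inter> T' = T" "T \<inter> T' = T'"
    using face_of_disjoint_interior triangulationD(3,4)[OF tri assms(1,2)] assms(3,4) by blast+
  then show ?thesis by simp
qed

lemma piecewise_grad_interior:
  assumes "T \<in> \<T>" "x \<in> interior T"
  shows "piecewise_grad v x = slope T v"
proof -
  have "piecewise_grad v x = (\<Sum>U\<in>\<T>. if U = T then slope T v else 0)"
    unfolding piecewise_grad_def
    by (rule sum.cong) (use interiors_disjoint assms in \<open>auto simp: indicator_def\<close>)
  then show ?thesis using finite_tri assms(1) by simp
qed

lemma AE_interior: "AE x in lborel. x \<in> \<Omega> \<longrightarrow> (\<exists>T\<in>\<T>. x \<in> interior T)"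
proof -
  have "negligible (frontier T)" if "T \<in> \<T>" for T
    using negligible_convex_frontier full[OF that] convex_simplex by blast
  then have "emeasure lborel (\<Union>T\<in>\<T>. frontier T) = 0"
  proof -
    have "negligible (\<Union>T\<in>\<T>. frontier T)"
      using finite_tri \<open>\<And>T. T \<in> \<T> \<Longrightarrow> negligible (frontier T)\<close> by (intro negligible_Union) auto
    then have "(\<Union>T\<in>\<T>. frontier T) \<in> null_sets lebesgue" using negligible_iff_null_sets by blast
    then have "emeasure lebesgue (\<Union>T\<in>\<T>. frontier T) = 0" by (rule null_setsD1)
    moreover have "(\<Union>T\<in>\<T>. frontier T) \<in> sets lborel"
      using finite_tri by (auto intro!: sets.finite_UN)
    ultimately show ?thesis by simp
  qed
  then have "AE x in lborel. x \<notin> (\<Union>T\<in>\<T>. frontier T)"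
    using finite_tri by (intro AE_not_in null_setsI sets.finite_UN) auto
  then show ?thesis
  proof eventually_elim
    case (elim x)
    show ?case
    proof
      assume "x \<in> \<Omega>"
      then obtain T where "T \<in> \<T>" "x \<in> T" using Union_tri closure_subset by blast
      then show "\<exists>T\<in>\<T>. x \<in> interior T" using elim closure_subset[of T] by (auto simp: frontier_def)
    qed
  qed
qed

lemma S1_continuous: "v \<in> S1 \<T> \<Longrightarrow> continuous_on (closure \<Omega>) v"
  unfolding S1_def Union_tri by simp

lemma continuous_bounded:
  fixes v :: "'a \<Rightarrow> real"
  assumes "continuous_on (closure \<Omega>) v"
  obtains B where "B \<ge> 0" "\<And>x. x \<in> closure \<Omega> \<Longrightarrow> \<bar>v x\<bar> \<le> B"
proof -
  have "bounded (v ` closure \<Omega>)"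
    using compact_continuous_image[OF assms compact_closure_domain] compact_imp_bounded by blast
  then obtain B where "\<And>x. x \<in> closure \<Omega> \<Longrightarrow> norm (v x) \<le> B" unfolding bounded_iff by blast
  then show ?thesis using that[of "\<bar>B\<bar>"] by force
qed

lemma continuous_measurable:
  fixes v :: "'a \<Rightarrow> real"
  assumes "continuous_on (closure \<Omega>) v"
  shows "set_borel_measurable lborel \<Omega> v"
  unfolding set_borel_measurable_def
  using borel_measurable_continuous_on_indicator[of \<Omega> v] continuous_on_subset[OF assms closure_subset] open_domain
  by simp

lemma continuous_integrable:
  fixes v :: "'a \<Rightarrow> real"
  assumes "continuous_on (closure \<Omega>) v"
  shows "set_integrable lborel \<Omega> v"
proof -
  obtain B where "B \<ge> 0" and B: "\<And>x. x \<in> closure \<Omega> \<Longrightarrow> \<bar>v x\<bar> \<le> B" using continuous_bounded[OF assms] by blast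
  show ?thesis
    by (rule set_integrable_bounded[OF open_domain bounded_domain continuous_measurable[OF assms], of B])
      (use B closure_subset in auto)
qed

lemma S1_space_L2:
  assumes "v \<in> S1 \<T>"
  shows "v \<in> space_L2 lborel \<Omega>"
proof -
  obtain B where "B \<ge> 0" and B: "\<And>x. x \<in> closure \<Omega> \<Longrightarrow> \<bar>v x\<bar> \<le> B" using continuous_bounded[OF S1_continuous[OF assms]] by blast
  show ?thesis
    by (rule space_L2_bounded[OF open_domain bounded_domain continuous_measurable[OF S1_continuous[OF assms]], of B])
      (use B closure_subset in auto)
qed

lemma piecewise_grad_measurable: "piecewise_grad v \<in> borel_measurable borel"
  unfolding piecewise_grad_def by (intro borel_measurable_sum borel_measurable_scaleR) auto

lemma piecewise_grad_bounded: "norm (piecewise_grad v x) \<le> (\<Sum>T\<in>\<T>. norm (slope T v))"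
  unfolding piecewise_grad_def
  by (rule order_trans[OF norm_sum sum_mono]) (auto simp: indicator_def)

lemma piecewise_grad_space_L2: "piecewise_grad v \<in> space_L2 lborel \<Omega>"
proof (rule space_L2_bounded[OF open_domain bounded_domain])
  show "set_borel_measurable lborel \<Omega> (piecewise_grad v)"
    unfolding set_borel_measurable_def using piecewise_grad_measurable open_domain
    by (intro borel_measurable_scaleR) auto
qed (rule piecewise_grad_bounded)

text \<open>The closure of \<Omega> need not be convex, hence the condition on the segment. Its
  parametrization pulls the simplices back to finitely many closed sets covering [0, 1], and
  Lipschitz bounds on closed pieces glue on an interval.\<close>

lemma S1_lipschitz:
  assumes v: "v \<in> S1 \<T>" and seg: "closed_segment x y \<subseteq> closure \<Omega>"
  shows "\<bar>v x - v y\<bar> \<le> (\<Sum>T\<in>\<T>. norm (slope T v)) * norm (x - y)"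
proof -
  define M where "M = (\<Sum>T\<in>\<T>. norm (slope T v)) * norm (x - y)"
  define p where "p t = x + t *\<^sub>R (y - x)" for t
  have M0: "0 \<le> M" unfolding M_def by (intro mult_nonneg_nonneg sum_nonneg) auto
  have "M-lipschitz_on {0..1} (\<lambda>t. v (p t))"
  proof (rule lipschitz_on_closed_Union[where I = \<T> and U = "\<lambda>T. p -` T"])
    fix T assume T: "T \<in> \<T>"
    show "closed (p -` T)"
      using full[OF T] closed_simplex unfolding p_def
      by (intro continuous_closed_vimage) (auto intro!: continuous_intros)
    obtain b where b: "\<forall>x\<in>T. v x = slope T v \<bullet> x + b" using slope[OF v T] by auto
    show "M-lipschitz_on (p -` T) (\<lambda>t. v (p t))"
    proof (rule lipschitz_onI[OF _ M0])
      fix s t assume st: "s \<in> p -` T" "t \<in> p -` T"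
      have "v (p s) - v (p t) = (s - t) * (slope T v \<bullet> (y - x))"
        using b st by (simp add: p_def inner_add_right algebra_simps)
      then have "dist (v (p s)) (v (p t)) \<le> \<bar>s - t\<bar> * (norm (slope T v) * norm (y - x))"
        using Cauchy_Schwarz_ineq2[of "slope T v" "y - x"] by (simp add: dist_real_def abs_mult mult_left_mono)
      also have "norm (slope T v) * norm (y - x) \<le> M"
        unfolding M_def norm_minus_commute[of y x] using finite_tri T
        by (intro mult_right_mono member_le_sum) auto
      then have "\<bar>s - t\<bar> * (norm (slope T v) * norm (y - x)) \<le> \<bar>s - t\<bar> * M"
        by (rule mult_left_mono) simp
      finally show "dist (v (p s)) (v (p t)) \<le> M * dist s t"
        by (simp add: dist_real_def mult.commute)
    qed
  next
    have "p t \<in> \<Union>\<T>" if "t \<in> {0..1}" for t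
    proof -
      have "p t = (1 - t) *\<^sub>R x + t *\<^sub>R y" by (simp add: p_def algebra_simps)
      then have "p t \<in> closed_segment x y" using that by (auto simp: closed_segment_def)
      then show ?thesis using seg Union_tri by auto
    qed
    then show "{0..1} \<subseteq> (\<Union>T\<in>\<T>. p -` T)" by auto
  qed (use finite_tri M0 in auto)
  from lipschitz_onD[OF this, of 0 1] show ?thesis by (simp add: p_def dist_real_def M_def)
qed

end

section \<open>Weak differentiability of piecewise affine functions\<close>

context mesh
begin

text \<open>The extension \<open>F\<close> of \<open>v \<phi>\<close> by zero is Lipschitz; so its difference quotients, whose integrals
  vanish by translation invariance, converge boundedly to its directional derivative.\<close>

lemma integral_by_parts:
  assumes v: "v \<in> S1 \<T>" and \<phi>: "test_function \<Omega> \<phi> D" and e: "norm e = 1"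
  shows "(\<integral>x. indicator \<Omega> x * (\<phi> x * (piecewise_grad v x \<bullet> e) + v x * (D x \<bullet> e)) \<partial>lborel) = 0"
proof -
  obtain K B where K: "compact K" "K \<subseteq> \<Omega>" "\<And>x. x \<notin> K \<Longrightarrow> \<phi> x = 0" "\<And>x. x \<notin> K \<Longrightarrow> D x = 0"
    and B: "B \<ge> 0" "\<And>x. \<bar>\<phi> x\<bar> \<le> B" "\<And>x. norm (D x) \<le> B" "\<And>x y. \<bar>\<phi> x - \<phi> y\<bar> \<le> B * norm (x - y)"
    using test_function_bounds[OF \<phi>] by metis
  obtain Bv where Bv: "Bv \<ge> 0" "\<And>x. x \<in> closure \<Omega> \<Longrightarrow> \<bar>v x\<bar> \<le> Bv"
    using continuous_bounded[OF S1_continuous[OF v]] by blast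
  define M where "M = (\<Sum>T\<in>\<T>. norm (slope T v))"
  have M0: "0 \<le> M" unfolding M_def by (intro sum_nonneg) auto
  obtain \<delta> where \<delta>: "\<delta> > 0" "(\<Union>x\<in>K. ball x \<delta>) \<subseteq> \<Omega>"
    using compact_subset_open_imp_ball_epsilon_subset[OF K(1) open_domain K(2)] .
  obtain R where R: "\<And>x. x \<in> K \<Longrightarrow> norm x \<le> R"
    using compact_imp_bounded[OF K(1)] unfolding bounded_iff by auto
  define F where "F x = indicator \<Omega> x * (v x * \<phi> x)" for x
  define f where "f x = indicator \<Omega> x * (\<phi> x * (piecewise_grad v x \<bullet> e) + v x * (D x \<bullet> e))" for x
  \<comment> \<open>Step sizes below \<open>\<delta>\<close> keep every segment that starts or ends
    in \<open>K\<close> inside \<Omega>.\<close>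
  define h where "h n = \<delta> / (2 * (real n + 1))" for n :: nat
  define q where "q n x = (F (x + h n *\<^sub>R e) - F x) / h n" for n x
  define C where "C = Bv * B + M * B"
  have C0: "0 \<le> C" using Bv B M0 by (simp add: C_def)
  have h: "0 < h n" "h n < \<delta>" for n using \<delta>(1) by (auto simp: h_def field_simps add_pos_nonneg)
  have F0: "F x = 0" if "x \<notin> K" for x using K(3)[OF that] by (simp add: F_def)
  have cont: "continuous_on \<Omega> v" by (rule continuous_on_subset[OF S1_continuous[OF v] closure_subset])
  have c\<phi>: "continuous_on UNIV \<phi>" by (rule test_function_continuous[OF \<phi>])
  have Fm: "F \<in> borel_measurable borel"
  proof -
    have "(\<lambda>x. indicator \<Omega> x *\<^sub>R (v x * \<phi> x)) \<in> borel_measurable borel"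
      using open_domain by (intro borel_measurable_continuous_on_indicator continuous_intros cont continuous_on_subset[OF c\<phi>]) auto
    then show ?thesis unfolding F_def[abs_def] by simp
  qed
  have Fi: "integrable lborel F"
  proof (rule integrableI_bounded_set[of \<Omega>])
    show "AE x in lborel. x \<in> \<Omega> \<longrightarrow> norm (F x) \<le> Bv * B"
      using Bv B(1,2) closure_subset[of \<Omega>]
      by (intro AE_I2) (auto simp: F_def abs_mult intro!: mult_mono)
    show "emeasure lborel \<Omega> < \<infinity>" by (rule emeasure_bounded_finite[OF bounded_domain])
    show "AE x in lborel. x \<notin> \<Omega> \<longrightarrow> F x = 0" by (simp add: F_def)
  qed (use Fm open_domain in simp_all)
  \<comment> \<open>Only points within distance \<open>t\<close> of \<open>K\<close> contribute, and
    the ball contains all of them; so the difference quotients have an integrable majorant.\<close>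
  have lip: "\<bar>F (x + t *\<^sub>R e) - F x\<bar> \<le> C * t * indicator (cball 0 (R + \<delta>)) x" if t: "0 < t" "t < \<delta>" for x t
  proof (cases "x \<in> K \<or> x + t *\<^sub>R e \<in> K")
    case False
    then show ?thesis using F0 C0 t by simp
  next
    case True
    let ?y = "x + t *\<^sub>R e"
    have dist: "dist x ?y = t" using e t by (simp add: dist_norm)
    obtain k where k: "k \<in> K" "k = x \<or> k = ?y" using True by blast
    then have "x \<in> ball k \<delta>" "?y \<in> ball k \<delta>" using dist t \<delta>(1) by (auto simp: dist_commute)
    then have seg: "closed_segment x ?y \<subseteq> \<Omega>"
      using closed_segment_subset[OF _ _ convex_ball] \<delta>(2) k(1) by blast
    then have xy: "x \<in> \<Omega>" "?y \<in> \<Omega>" by auto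
    have "\<bar>v x - v ?y\<bar> \<le> M * norm (x - ?y)"
      unfolding M_def by (rule S1_lipschitz[OF v]) (use seg closure_subset in blast)
    then have lv: "\<bar>v ?y - v x\<bar> \<le> M * t" using e t by (simp add: abs_minus_commute)
    have l\<phi>: "\<bar>\<phi> ?y - \<phi> x\<bar> \<le> B * t" using B(4)[of ?y x] e t by simp
    have "F ?y - F x = v ?y * (\<phi> ?y - \<phi> x) + (v ?y - v x) * \<phi> x"
      using xy by (simp add: F_def algebra_simps)
    also have "\<bar>\<dots>\<bar> \<le> Bv * (B * t) + (M * t) * B"
    proof (rule order_trans[OF abs_triangle_ineq add_mono])
      show "\<bar>v ?y * (\<phi> ?y - \<phi> x)\<bar> \<le> Bv * (B * t)"
        unfolding abs_mult using Bv xy closure_subset l\<phi> by (intro mult_mono) auto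
      show "\<bar>(v ?y - v x) * \<phi> x\<bar> \<le> M * t * B"
        unfolding abs_mult using lv B(2)[of x] M0 t by (intro mult_mono) auto
    qed
    also have "\<dots> = C * t" by (simp add: C_def algebra_simps)
    finally have "\<bar>F ?y - F x\<bar> \<le> C * t" .
    moreover have "x \<in> cball 0 (R + \<delta>)"
    proof -
      have "norm x \<le> norm k + dist k x" using norm_triangle_ineq2[of x k] by (simp add: dist_norm norm_minus_commute)
      moreover have "dist k x \<le> t" using k(2) dist t by (auto simp: dist_commute)
      ultimately show ?thesis using R[OF k(1)] t by simp
    qed
    ultimately show ?thesis by simp
  qed
  have qi: "integrable lborel (q n)" "integral\<^sup>L lborel (q n) = 0" for n
    using integral_difference_zero[OF Fi, of "h n *\<^sub>R e"] Fi unfolding q_def[abs_def] by auto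
  have lim: "AE x in lborel. (\<lambda>n. q n x) \<longlonglongrightarrow> f x"
    using AE_interior
  proof eventually_elim
    case (elim x)
    \<comment> \<open>Off \<open>K\<close> the function vanishes locally; on \<open>K\<close> almost
      every point is interior to a simplex, where \<open>F\<close> is an affine function times
      \<open>\<phi>\<close>.\<close>
    have "((\<lambda>t. F (x + t *\<^sub>R e)) has_real_derivative f x) (at 0)"
    proof (cases "x \<in> K")
      case False
      have "open ((\<lambda>t. x + t *\<^sub>R e) -` (- K))"
        using K(1) by (intro open_vimage continuous_intros) (simp add: compact_imp_closed open_Compl)
      moreover have "f x = 0" using False K by (simp add: f_def)
      moreover have "((\<lambda>t. 0) has_real_derivative 0) (at 0)" by simp
      ultimately show ?thesis
        using has_field_derivative_transform_within_open[of "\<lambda>t. 0" 0 0 "(\<lambda>t. x + t *\<^sub>R e) -` (- K)" "\<lambda>t. F (x + t *\<^sub>R e)"]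
          False F0 by simp
    next
      case True
      then have x: "x \<in> \<Omega>" using K by auto
      then obtain T where T: "T \<in> \<T>" "x \<in> interior T" using elim by auto
      obtain b where b: "\<forall>x\<in>T. v x = slope T v \<bullet> x + b" using slope[OF v T(1)] by auto
      let ?p = "\<lambda>t. x + t *\<^sub>R e"
      have xT: "x \<in> T" using T interior_subset by blast
      have 1: "(\<phi> has_derivative (\<lambda>k. k \<bullet> D x)) (at (?p 0))"
        using \<phi> by (simp add: test_function_def gderiv_def)
      have 2: "(?p has_derivative (\<lambda>t. t *\<^sub>R e)) (at 0)" by (auto intro!: derivative_eq_intros)
      have "((\<lambda>t. \<phi> (?p t)) has_derivative (\<lambda>t. (t *\<^sub>R e) \<bullet> D x)) (at 0)"
        by (rule has_derivative_compose[OF 2 1])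
      moreover have "(\<lambda>t. (t *\<^sub>R e) \<bullet> D x) = (*) (D x \<bullet> e)"
        by (simp add: fun_eq_iff inner_commute)
      ultimately have d\<phi>: "((\<lambda>t. \<phi> (?p t)) has_real_derivative (D x \<bullet> e)) (at 0)"
        by (simp only: has_field_derivative_def)
      have "((\<lambda>t. slope T v \<bullet> ?p t + b) has_real_derivative (slope T v \<bullet> e)) (at 0)"
        unfolding inner_add_right inner_scaleR_right by (auto intro!: derivative_eq_intros)
      from DERIV_mult[OF this d\<phi>]
      have "((\<lambda>t. (slope T v \<bullet> ?p t + b) * \<phi> (?p t)) has_real_derivative
        (slope T v \<bullet> e) * \<phi> x + (D x \<bullet> e) * (slope T v \<bullet> x + b)) (at 0)" by simp
      moreover have "open (?p -` (interior T \<inter> \<Omega>))"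
        using open_domain by (intro open_vimage continuous_intros) auto
      moreover have "F (?p t) = (slope T v \<bullet> ?p t + b) * \<phi> (?p t)" if "?p t \<in> interior T \<inter> \<Omega>" for t
        using that b interior_subset[of T] by (auto simp: F_def)
      moreover have "(slope T v \<bullet> e) * \<phi> x + (D x \<bullet> e) * (slope T v \<bullet> x + b) = f x"
        using x b xT by (simp add: f_def piecewise_grad_interior[OF T])
      ultimately show ?thesis
        using has_field_derivative_transform_within_open[of "\<lambda>t. (slope T v \<bullet> ?p t + b) * \<phi> (?p t)" "f x" 0
            "?p -` (interior T \<inter> \<Omega>)" "\<lambda>t. F (?p t)"] x T(2) by simp
    qed
    then have "((\<lambda>t. (F (x + t *\<^sub>R e) - F x) / t) \<longlongrightarrow> f x) (at 0)"
      by (simp add: has_field_derivative_iff)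
    moreover have "filterlim h (at 0) sequentially"
    proof -
      have "(\<lambda>n. \<delta> / 2 * inverse (real (Suc n))) \<longlonglongrightarrow> \<delta> / 2 * 0"
        by (intro tendsto_intros LIMSEQ_inverse_real_of_nat)
      moreover have "h = (\<lambda>n. \<delta> / 2 * inverse (real (Suc n)))"
        by (simp add: h_def fun_eq_iff field_simps)
      ultimately have "h \<longlonglongrightarrow> 0" by simp
      then show ?thesis using h(1) by (intro filterlim_atI) (auto simp: less_imp_neq[symmetric])
    qed
    ultimately show ?case unfolding q_def by (rule filterlim_compose)
  qed
  have "(\<lambda>n. integral\<^sup>L lborel (q n)) \<longlonglongrightarrow> integral\<^sup>L lborel f"
  proof (rule integral_dominated_convergence[where w = "\<lambda>x. C * indicator (cball 0 (R + \<delta>)) x"])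
    have "D \<in> borel_measurable borel" "\<phi> \<in> borel_measurable borel"
      using \<phi> c\<phi> borel_measurable_continuous_onI unfolding test_function_def by blast+
    moreover have "(\<lambda>x. indicator \<Omega> x *\<^sub>R v x) \<in> borel_measurable borel"
      using open_domain by (intro borel_measurable_continuous_on_indicator cont) auto
    moreover have "f = (\<lambda>x. indicator \<Omega> x * (\<phi> x * (piecewise_grad v x \<bullet> e)) + (indicator \<Omega> x *\<^sub>R v x) * (D x \<bullet> e))"
      by (simp add: f_def fun_eq_iff algebra_simps)
    ultimately show "f \<in> borel_measurable lborel"
      using open_domain piecewise_grad_measurable[of v]
      by (auto intro!: borel_measurable_add borel_measurable_times borel_measurable_inner)
    show "integrable lborel (\<lambda>x. C * indicator (cball 0 (R + \<delta>)) x)"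
      using emeasure_bounded_finite[of "cball 0 (R + \<delta>)"]
      by (intro integrable_mult_right integrable_real_indicator) auto
    show "AE x in lborel. norm (q n x) \<le> C * indicator (cball 0 (R + \<delta>)) x" for n
    proof (rule AE_I2)
      fix x
      have "\<bar>q n x\<bar> * h n \<le> (C * indicator (cball 0 (R + \<delta>)) x) * h n"
        using lip[of "h n" x] h[of n] by (simp add: q_def mult.commute mult.left_commute)
      then show "norm (q n x) \<le> C * indicator (cball 0 (R + \<delta>)) x"
        using h(1)[of n] by (simp only: real_norm_def mult_le_cancel_right_pos)
    qed
  qed (use qi lim in auto)
  then show ?thesis unfolding qi f_def[abs_def] by (simp add: LIMSEQ_const_iff)
qed

lemma weak_gradient_piecewise_grad:
  assumes v: "v \<in> S1 \<T>"
  shows "weak_gradient \<Omega> v (piecewise_grad v)"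
  unfolding weak_gradient_iff
proof (intro conjI allI impI)
  fix \<phi> D assume \<phi>: "test_function \<Omega> \<phi> D"
  obtain K B where B: "\<And>x. \<bar>\<phi> x\<bar> \<le> B" "\<And>x. norm (D x) \<le> B" "B \<ge> 0"
    using test_function_bounds[OF \<phi>] by metis
  obtain Bv where Bv: "Bv \<ge> 0" "\<And>x. x \<in> closure \<Omega> \<Longrightarrow> \<bar>v x\<bar> \<le> Bv"
    using continuous_bounded[OF S1_continuous[OF v]] by blast
  have m: "D \<in> borel_measurable borel" "\<phi> \<in> borel_measurable borel"
    using \<phi> test_function_continuous[OF \<phi>] borel_measurable_continuous_onI unfolding test_function_def by blast+
  have mv: "(\<lambda>x. indicator \<Omega> x *\<^sub>R v x) \<in> borel_measurable lborel"
    using continuous_measurable[OF S1_continuous[OF v]] by (simp add: set_borel_measurable_def)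
  have i1: "set_integrable lborel \<Omega> (\<lambda>x. v x *\<^sub>R D x)"
  proof (rule set_integrable_bounded[OF open_domain bounded_domain, where B = "Bv * B"])
    have "(\<lambda>x. (indicator \<Omega> x *\<^sub>R v x) *\<^sub>R D x) \<in> borel_measurable lborel"
    proof (rule borel_measurable_scaleR[OF mv])
      show "D \<in> borel_measurable lborel" using m by simp
    qed
    then show "set_borel_measurable lborel \<Omega> (\<lambda>x. v x *\<^sub>R D x)" by (simp add: set_borel_measurable_def)
    show "norm (v x *\<^sub>R D x) \<le> Bv * B" if "x \<in> \<Omega>" for x
      using Bv B(2) that closure_subset by (auto intro!: mult_mono)
  qed
  have i2: "set_integrable lborel \<Omega> (\<lambda>x. \<phi> x *\<^sub>R piecewise_grad v x)"
  proof (rule set_integrable_bounded[OF open_domain bounded_domain, where B = "B * (\<Sum>T\<in>\<T>. norm (slope T v))"])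
    show "set_borel_measurable lborel \<Omega> (\<lambda>x. \<phi> x *\<^sub>R piecewise_grad v x)"
      unfolding set_borel_measurable_def using m piecewise_grad_measurable[of v] open_domain
      by (intro borel_measurable_scaleR) auto
    show "norm (\<phi> x *\<^sub>R piecewise_grad v x) \<le> B * (\<Sum>T\<in>\<T>. norm (slope T v))" if "x \<in> \<Omega>" for x
      using B piecewise_grad_bounded[of v x] by (auto intro!: mult_mono)
  qed
  show "(LINT x:\<Omega>|lborel. v x *\<^sub>R D x) = - (LINT x:\<Omega>|lborel. \<phi> x *\<^sub>R piecewise_grad v x)"
  proof (rule euclidean_eqI)
    fix e :: 'a assume "e \<in> Basis"
    then have e: "norm e = 1" by simp
    have "(LINT x:\<Omega>|lborel. v x *\<^sub>R D x) \<bullet> e + (LINT x:\<Omega>|lborel. \<phi> x *\<^sub>R piecewise_grad v x) \<bullet> e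
      = ((LINT x:\<Omega>|lborel. v x *\<^sub>R D x) + (LINT x:\<Omega>|lborel. \<phi> x *\<^sub>R piecewise_grad v x)) \<bullet> e"
      by (simp add: inner_add_left)
    also have "\<dots> = (\<integral>x. indicator \<Omega> x *\<^sub>R (v x *\<^sub>R D x) + indicator \<Omega> x *\<^sub>R (\<phi> x *\<^sub>R piecewise_grad v x) \<partial>lborel) \<bullet> e"
      unfolding set_lebesgue_integral_def
      by (subst Bochner_Integration.integral_add) (use i1 i2 in \<open>auto simp: set_integrable_def\<close>)
    also have "\<dots> = (\<integral>x. (indicator \<Omega> x *\<^sub>R (v x *\<^sub>R D x) + indicator \<Omega> x *\<^sub>R (\<phi> x *\<^sub>R piecewise_grad v x)) \<bullet> e \<partial>lborel)"
      by (rule integral_inner_left[symmetric]) (use i1 i2 in \<open>auto simp: set_integrable_def\<close>)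
    also have "\<dots> = (\<integral>x. indicator \<Omega> x * (\<phi> x * (piecewise_grad v x \<bullet> e) + v x * (D x \<bullet> e)) \<partial>lborel)"
      by (intro Bochner_Integration.integral_cong) (auto simp: inner_add_left algebra_simps)
    also have "\<dots> = 0" by (rule integral_by_parts[OF v \<phi> e])
    finally show "(LINT x:\<Omega>|lborel. v x *\<^sub>R D x) \<bullet> e = - (LINT x:\<Omega>|lborel. \<phi> x *\<^sub>R piecewise_grad v x) \<bullet> e"
      by simp
  qed
qed (use v S1_space_L2 piecewise_grad_space_L2 in auto)

text \<open>Existence makes the choice in \<open>grad\<close> a weak gradient, and uniqueness then
  identifies it with the elementwise one.\<close>

lemma grad_AE:
  assumes v: "v \<in> S1 \<T>"
  shows "weak_gradient \<Omega> v (grad \<Omega> v)" "AE x in lborel. x \<in> \<Omega> \<longrightarrow> grad \<Omega> v x = piecewise_grad v x"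
proof -
  show *: "weak_gradient \<Omega> v (grad \<Omega> v)"
    unfolding grad_def by (rule someI[of "weak_gradient \<Omega> v"]) (rule weak_gradient_piecewise_grad[OF v])
  show "AE x in lborel. x \<in> \<Omega> \<longrightarrow> grad \<Omega> v x = piecewise_grad v x"
    by (rule weak_gradient_unique[OF open_domain bounded_domain * weak_gradient_piecewise_grad[OF v]])
qed

lemma inner_grad:
  assumes v: "v \<in> S1 \<T>" and w: "w \<in> S1 \<T>"
  shows "inner_L2 lborel \<Omega> (grad \<Omega> v) (grad \<Omega> w) = (\<Sum>T\<in>\<T>. measure lborel (\<Omega> \<inter> interior T) * (slope T v \<bullet> slope T w))"
proof -
  have m: "(\<lambda>x. indicator \<Omega> x *\<^sub>R grad \<Omega> u x) \<in> borel_measurable lborel" if "u \<in> S1 \<T>" for u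
    using grad_AE(1)[OF that] by (simp add: weak_gradient_iff space_L2_def set_borel_measurable_def)
  have sq: "indicator \<Omega> x *\<^sub>R (a \<bullet> b) = (indicator \<Omega> x *\<^sub>R a) \<bullet> (indicator \<Omega> x *\<^sub>R b)" for x and a b :: 'a
    by (simp add: indicator_def)
  have "inner_L2 lborel \<Omega> (grad \<Omega> v) (grad \<Omega> w) = (\<integral>x. indicator \<Omega> x *\<^sub>R (grad \<Omega> v x \<bullet> grad \<Omega> w x) \<partial>lborel)"
    by (simp add: inner_L2_def set_lebesgue_integral_def)
  also have "\<dots> = (\<integral>x. (\<Sum>T\<in>\<T>. indicator (\<Omega> \<inter> interior T) x * (slope T v \<bullet> slope T w)) \<partial>lborel)"
  proof (rule integral_cong_AE)
    show "(\<lambda>x. indicator \<Omega> x *\<^sub>R (grad \<Omega> v x \<bullet> grad \<Omega> w x)) \<in> borel_measurable lborel"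
      unfolding sq by (intro borel_measurable_inner m v w)
    show "(\<lambda>x. \<Sum>T\<in>\<T>. indicator (\<Omega> \<inter> interior T) x * (slope T v \<bullet> slope T w)) \<in> borel_measurable lborel"
      using open_domain by (intro borel_measurable_sum borel_measurable_times borel_measurable_indicator) auto
    show "AE x in lborel. indicator \<Omega> x *\<^sub>R (grad \<Omega> v x \<bullet> grad \<Omega> w x) =
        (\<Sum>T\<in>\<T>. indicator (\<Omega> \<inter> interior T) x * (slope T v \<bullet> slope T w))"
      using AE_interior grad_AE(2)[OF v] grad_AE(2)[OF w]
    proof eventually_elim
      case (elim x)
      show ?case
      proof (cases "x \<in> \<Omega>")
        case True
        then obtain T where T: "T \<in> \<T>" "x \<in> interior T" using elim by auto
        have "(\<Sum>U\<in>\<T>. indicator (\<Omega> \<inter> interior U) x * (slope U v \<bullet> slope U w)) =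
          (\<Sum>U\<in>\<T>. if U = T then slope T v \<bullet> slope T w else 0)"
          by (rule sum.cong) (use interiors_disjoint T True in \<open>auto simp: indicator_def\<close>)
        then show ?thesis using True elim finite_tri T by (simp add: piecewise_grad_interior[OF T])
      qed simp
    qed
  qed
  also have "\<dots> = (\<Sum>T\<in>\<T>. (\<integral>x. indicator (\<Omega> \<inter> interior T) x * (slope T v \<bullet> slope T w) \<partial>lborel))"
  proof (rule Bochner_Integration.integral_sum)
    fix T assume "T \<in> \<T>"
    have "emeasure lborel (\<Omega> \<inter> interior T) < \<infinity>"
      using bounded_domain bounded_Int by (intro emeasure_bounded_finite) blast
    then show "integrable lborel (\<lambda>x. indicator (\<Omega> \<inter> interior T) x * (slope T v \<bullet> slope T w))"
      using open_domain by (intro integrable_mult_left integrable_real_indicator) auto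
  qed
  also have "\<dots> = (\<Sum>T\<in>\<T>. measure lborel (\<Omega> \<inter> interior T) * (slope T v \<bullet> slope T w))"
    by simp
  finally show ?thesis .
qed

end

section \<open>The lumped energy and block coordinate descent\<close>

text \<open>Only the values at the finitely many nodes \<open>N\<close>, of which those in \<open>Z\<close> lie on the insulated
  boundary part, matter; \<open>a\<close> is the Dirichlet form and \<open>l\<close> the load functional.\<close>

abbreviation comb :: "real \<Rightarrow> ('a \<Rightarrow> real) \<Rightarrow> ('a \<Rightarrow> real) \<Rightarrow> 'a \<Rightarrow> real" where
  "comb t v w \<equiv> (\<lambda>x. v x + t * w x)"

locale insulation_problem =
  fixes V :: "('a \<Rightarrow> real) set" and N Z :: "'a set" and \<omega> :: "'a \<Rightarrow> real"
    and a :: "('a \<Rightarrow> real) \<Rightarrow> ('a \<Rightarrow> real) \<Rightarrow> real" and l :: "('a \<Rightarrow> real) \<Rightarrow> real"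
    and \<kappa> \<beta> m :: real and uinf :: "'a \<Rightarrow> real"
  assumes a_form: "psd_form comb V a"
    and N: "finite N" "Z \<subseteq> N" "Z \<noteq> {}"
    and \<omega>: "\<And>z. z \<in> Z \<Longrightarrow> 0 < \<omega> z"
    and const_mem: "(\<lambda>x. c) \<in> V"
    and a_zero: "\<And>v. v \<in> V \<Longrightarrow> (\<And>z. z \<in> N \<Longrightarrow> v z = 0) \<Longrightarrow> a v v = 0"
    and a_const: "\<And>v. v \<in> V \<Longrightarrow> a v v = 0 \<Longrightarrow> \<exists>c. \<forall>z\<in>N. v z = c"
    and a_one: "a (\<lambda>x. 1) (\<lambda>x. 1) = 0"
    and l_linear: "\<And>t v w. v \<in> V \<Longrightarrow> w \<in> V \<Longrightarrow> l (comb t v w) = l v + t * l w"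
    and l_zero: "\<And>v. v \<in> V \<Longrightarrow> (\<And>z. z \<in> N \<Longrightarrow> v z = 0) \<Longrightarrow> l v = 0"
    and load: "l (\<lambda>x. 1) \<noteq> 0"
    and pos: "\<kappa> > 0" "\<beta> > 0" "m > 0"
begin

sublocale a: psd_form comb V a by (rule a_form)

lemma finite_Z: "finite Z"
  using N finite_subset by blast

text \<open>Membership in \<open>S1\<close> is left out, so that any function with suitable nodal
  values counts as a density; \<open>interp\<close> leads back to \<open>S1\<close>.\<close>

definition adm :: "('a \<Rightarrow> real) set" where
  "adm = {\<eta>. (\<forall>z\<in>Z. 0 \<le> \<eta> z) \<and> (\<Sum>z\<in>Z. \<omega> z * \<eta> z) = m}"

definition en :: "('a \<Rightarrow> real) \<Rightarrow> ('a \<Rightarrow> real) \<Rightarrow> real" where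
  "en v \<eta> = \<kappa> / 2 * a v v + \<beta> / 2 * (\<Sum>z\<in>Z. \<omega> z * ((v z - uinf z)\<^sup>2 / (1 + \<beta> * \<eta> z))) - l v"

definition robin :: "('a \<Rightarrow> real) \<Rightarrow> ('a \<Rightarrow> real) \<Rightarrow> ('a \<Rightarrow> real) \<Rightarrow> real" where
  "robin \<eta> v w = \<kappa> * a v w + \<beta> * (\<Sum>z\<in>Z. \<omega> z * (v z * w z / (1 + \<beta> * \<eta> z)))"

definition step1 :: "('a \<Rightarrow> real) \<Rightarrow> real \<Rightarrow> bool" where
  "step1 u c \<longleftrightarrow> c > 0 \<and> m * \<beta> * c = (\<Sum>z\<in>Z. \<omega> z * max (\<bar>u z - uinf z\<bar> - c) 0)"

definition step2 :: "('a \<Rightarrow> real) \<Rightarrow> real \<Rightarrow> ('a \<Rightarrow> real) \<Rightarrow> bool" where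
  "step2 u c d \<longleftrightarrow> (\<forall>z\<in>Z. d z = max (\<bar>u z - uinf z\<bar> - c) 0 / (c * \<beta>))"

definition step3 :: "('a \<Rightarrow> real) \<Rightarrow> ('a \<Rightarrow> real) \<Rightarrow> bool" where
  "step3 d u \<longleftrightarrow> u \<in> V \<and> (\<forall>v\<in>V. \<kappa> * a u v + \<beta> * (\<Sum>z\<in>Z. \<omega> z * ((u z - uinf z) * v z / (1 + \<beta> * d z))) = l v)"

section \<open>Solvability and uniqueness of the three steps\<close>

lemma adm_pos: "\<eta> \<in> adm \<Longrightarrow> z \<in> Z \<Longrightarrow> 1 \<le> 1 + \<beta> * \<eta> z"
  using pos by (simp add: adm_def)

lemma psd_form_add:
  fixes p q :: "('a \<Rightarrow> real) \<Rightarrow> ('a \<Rightarrow> real) \<Rightarrow> real"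
  assumes p: "psd_form comb V p" and q: "\<And>t v w x. q (comb t v w) x = q v x + t * q w x"
    "\<And>v w. q v w = q w v" "\<And>v. 0 \<le> q v v" and c: "c \<ge> 0"
  shows "psd_form comb V (\<lambda>v w. c * p v w + q v w)"
proof -
  interpret p: psd_form comb V p by fact
  show ?thesis
  proof
    show "c * p (comb t x y) z + q (comb t x y) z = c * p x z + q x z + t * (c * p y z + q y z)"
      if "x \<in> V" "y \<in> V" "z \<in> V" for t x y z
      using p.linear[OF that, of t] q(1)[of x t y z] by (simp add: algebra_simps)
    show "c * p x y + q x y = c * p y x + q y x" if "x \<in> V" "y \<in> V" for x y
      using p.sym[OF that] q(2)[of x y] by simp
    show "0 \<le> c * p x x + q x x" if "x \<in> V" for x
      using p.nonneg[OF that] q(3)[of x] c by simp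
  qed (use p.nonempty p.closed in auto)
qed

lemma lumped_term_nonneg: "\<eta> \<in> adm \<Longrightarrow> z \<in> Z \<Longrightarrow> 0 \<le> \<omega> z * (x * x / (1 + \<beta> * \<eta> z))"
  by (rule mult_nonneg_nonneg[OF less_imp_le[OF \<omega>]
        divide_nonneg_nonneg[OF zero_le_square order_trans[OF zero_le_one adm_pos]]])

lemma robin_form:
  assumes \<eta>: "\<eta> \<in> adm"
  shows "psd_form comb V (robin \<eta>)"
  unfolding robin_def[abs_def]
proof (rule psd_form_add[OF a_form])
  fix t v w x
  show "\<beta> * (\<Sum>z\<in>Z. \<omega> z * ((v z + t * w z) * x z / (1 + \<beta> * \<eta> z))) =
    \<beta> * (\<Sum>z\<in>Z. \<omega> z * (v z * x z / (1 + \<beta> * \<eta> z))) + t * (\<beta> * (\<Sum>z\<in>Z. \<omega> z * (w z * x z / (1 + \<beta> * \<eta> z))))"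
    by (simp add: sum_distrib_left sum.distrib[symmetric] algebra_simps add_divide_distrib)
next
  fix v
  show "0 \<le> \<beta> * (\<Sum>z\<in>Z. \<omega> z * (v z * v z / (1 + \<beta> * \<eta> z)))"
    using pos by (intro mult_nonneg_nonneg sum_nonneg lumped_term_nonneg[OF \<eta>]) auto
qed (use pos in \<open>auto simp: mult.commute\<close>)

text \<open>A function without Dirichlet energy has constant nodal values, and the lumped term
  forces the constant to be 0 at a node of \<open>Z\<close>.\<close>

lemma robin_definite:
  assumes \<eta>: "\<eta> \<in> adm" and v: "v \<in> V" and 0: "robin \<eta> v v = 0" and z: "z \<in> N"
  shows "v z = 0"
proof -
  define t where "t y = \<omega> y * (v y * v y / (1 + \<beta> * \<eta> y))" for y
  have t0: "0 \<le> t y" if "y \<in> Z" for y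
    unfolding t_def by (rule lumped_term_nonneg[OF \<eta> that])
  have "0 \<le> sum t Z" by (rule sum_nonneg) (rule t0)
  then have "0 \<le> \<kappa> * a v v" "0 \<le> \<beta> * sum t Z"
    using pos a.nonneg[OF v] by auto
  moreover have "\<kappa> * a v v + \<beta> * sum t Z = 0" using 0 by (simp add: robin_def t_def)
  ultimately have "\<kappa> * a v v = 0" "\<beta> * sum t Z = 0" by linarith+
  then have av: "a v v = 0" and st: "sum t Z = 0" using pos by auto
  obtain c where c: "\<forall>z\<in>N. v z = c" using a_const[OF v av] by auto
  obtain y where y: "y \<in> Z" using N by auto
  have "t y = 0" using st t0 y finite_Z by (simp add: sum_nonneg_eq_0_iff)
  then have "v y = 0" using \<omega>[OF y] adm_pos[OF \<eta> y] by (auto simp: t_def)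
  then show ?thesis using c y N(2) z by auto
qed

lemma step3_iff:
  assumes "d \<in> adm"
  shows "step3 d u \<longleftrightarrow> u \<in> V \<and> (\<forall>v\<in>V. robin d u v = l v + \<beta> * (\<Sum>z\<in>Z. \<omega> z * (uinf z * v z / (1 + \<beta> * d z))))"
proof -
  have "(\<Sum>z\<in>Z. \<omega> z * ((u z - uinf z) * v z / (1 + \<beta> * d z))) =
    (\<Sum>z\<in>Z. \<omega> z * (u z * v z / (1 + \<beta> * d z))) - (\<Sum>z\<in>Z. \<omega> z * (uinf z * v z / (1 + \<beta> * d z)))" for v
    by (simp add: sum_subtractf[symmetric] algebra_simps diff_divide_distrib)
  then show ?thesis
    unfolding step3_def robin_def by (simp add: right_diff_distrib add_diff_eq diff_eq_eq)
qed

text \<open>Null vectors of the Robin form have zero nodal values, so the right-hand side vanishes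
  on them, as the representation theorem requires.\<close>

lemma step3_exists:
  assumes d: "d \<in> adm"
  obtains u where "step3 d u"
proof -
  let ?l = "\<lambda>v. l v + \<beta> * (\<Sum>z\<in>Z. \<omega> z * (uinf z * v z / (1 + \<beta> * d z)))"
  obtain u where "u \<in> V" "\<And>v. v \<in> V \<Longrightarrow> robin d u v = ?l v"
  proof (rule psd_form_riesz[OF N(1) robin_form[OF d], of "\<lambda>z v. v z" ?l])
    show "robin d v v = 0" if "v \<in> V" "\<And>z. z \<in> N \<Longrightarrow> v z = 0" for v
      using a_zero[OF that] that(2) N(2) by (auto simp: robin_def intro!: sum.neutral)
    show "?l (comb t v w) = ?l v + t * ?l w" if "v \<in> V" "w \<in> V" for t v w
      by (simp add: l_linear[OF that] sum_distrib_left sum.distrib[symmetric] algebra_simps add_divide_distrib)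
    show "?l v = 0" if v: "v \<in> V" and 0: "robin d v v = 0" for v
      using l_zero[OF v] robin_definite[OF d v 0] N(2) by (auto simp: subset_iff intro!: sum.neutral)
  qed auto
  then show ?thesis using that step3_iff[OF d] by blast
qed

lemma step3_unique:
  assumes d: "d \<in> adm" and u: "step3 d u" and u': "step3 d u'" and z: "z \<in> N"
  shows "u z = u' z"
proof -
  interpret r: psd_form comb V "robin d" by (rule robin_form[OF d])
  have V: "u \<in> V" "u' \<in> V" using u u' by (auto simp: step3_def)
  have "robin d u v = robin d u' v" if "v \<in> V" for v
    using u u' that unfolding step3_iff[OF d] by simp
  then have "robin d (comb (- 1) u u') v = 0" if "v \<in> V" for v
    using r.linear[OF V that, of "- 1"] that by simp
  then have "robin d (comb (- 1) u u') (comb (- 1) u u') = 0" using r.closed[OF V] by blast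
  from robin_definite[OF d r.closed[OF V] this z] show ?thesis by simp
qed

lemma step3_cong:
  assumes d: "\<And>z. z \<in> Z \<Longrightarrow> d z = d' z" and u: "step3 d u"
  shows "step3 d' u"
proof -
  have "(\<Sum>z\<in>Z. \<omega> z * ((u z - uinf z) * v z / (1 + \<beta> * d z))) =
    (\<Sum>z\<in>Z. \<omega> z * ((u z - uinf z) * v z / (1 + \<beta> * d' z)))" for v
    by (rule sum.cong) (simp_all add: d)
  with u show ?thesis by (simp add: step3_def)
qed

text \<open>Otherwise the constant test function would give \<open>l 1 = 0\<close>.\<close>

lemma step3_nontrivial:
  assumes "step3 d u"
  shows "\<exists>z\<in>Z. u z \<noteq> uinf z"
proof (rule ccontr)
  assume "\<not> ?thesis"
  then have "(\<Sum>z\<in>Z. \<omega> z * ((u z - uinf z) * 1 / (1 + \<beta> * d z))) = 0" by (auto intro: sum.neutral)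
  moreover have "u \<in> V" using assms by (simp add: step3_def)
  moreover have "a u (\<lambda>x. 1) = 0" by (rule a.null_orthogonal[OF \<open>u \<in> V\<close> const_mem a_one])
  moreover have "\<kappa> * a u (\<lambda>x. 1) + \<beta> * (\<Sum>z\<in>Z. \<omega> z * ((u z - uinf z) * 1 / (1 + \<beta> * d z))) = l (\<lambda>x. 1)"
    using assms const_mem[of 1] unfolding step3_def by blast
  ultimately show False using load by simp
qed

text \<open>Intermediate values: at 0 the defect \<open>h\<close> is negative because some node has
  \<open>u z \<noteq> uinf z\<close>, and at \<open>M\<close>, an upper bound of all
  \<open>\<bar>u z - uinf z\<bar>\<close>, every positive part vanishes. The zero found is positive
  since \<open>h 0 < 0\<close>.\<close>

lemma step1_exists:
  assumes "\<exists>z\<in>Z. u z \<noteq> uinf z"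
  obtains c where "step1 u c"
proof -
  define h where "h c = m * \<beta> * c - (\<Sum>z\<in>Z. \<omega> z * max (\<bar>u z - uinf z\<bar> - c) 0)" for c
  define M where "M = (\<Sum>z\<in>Z. \<bar>u z - uinf z\<bar>)"
  have le: "\<bar>u z - uinf z\<bar> \<le> M" if "z \<in> Z" for z
    unfolding M_def using finite_Z that by (intro member_le_sum) auto
  have M0: "0 \<le> M" unfolding M_def by (intro sum_nonneg) auto
  obtain y where y: "y \<in> Z" "u y \<noteq> uinf y" using assms by auto
  have "0 < (\<Sum>z\<in>Z. \<omega> z * \<bar>u z - uinf z\<bar>)"
    using finite_Z y \<omega> by (intro sum_pos2[of _ y]) (auto simp: less_imp_le)
  then have h0: "h 0 < 0" by (simp add: h_def)
  have "0 \<le> h M"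
  proof -
    have "(\<Sum>z\<in>Z. \<omega> z * max (\<bar>u z - uinf z\<bar> - M) 0) = 0"
      using le by (intro sum.neutral) (auto simp: max_def)
    then show ?thesis using M0 pos by (simp add: h_def)
  qed
  moreover have "continuous_on {0..M} h"
    unfolding h_def by (intro continuous_intros)
  ultimately obtain c where c: "0 \<le> c" "h c = 0"
    using IVT'[of h 0 0 M] h0 M0 by auto
  then have "c \<noteq> 0" using h0 by auto
  then have "step1 u c" using c by (simp add: step1_def h_def)
  then show ?thesis by (rule that)
qed

text \<open>In the equation of Step 1 the left-hand side increases strictly with \<open>c\<close>,
  while the right-hand side does not increase.\<close>

lemma step1_unique:
  assumes "step1 u c" "step1 u' c'" "\<And>z. z \<in> Z \<Longrightarrow> u z = u' z"
  shows "c = c'"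
proof -
  have no: "\<not> b < b'" if "step1 u b" "step1 u b'" for b b'
  proof
    assume b: "b < b'"
    have "(\<Sum>z\<in>Z. \<omega> z * max (\<bar>u z - uinf z\<bar> - b') 0) \<le> (\<Sum>z\<in>Z. \<omega> z * max (\<bar>u z - uinf z\<bar> - b) 0)"
      using b by (intro sum_mono mult_left_mono less_imp_le[OF \<omega>]) auto
    then have "m * \<beta> * b' \<le> m * \<beta> * b" using that by (simp add: step1_def)
    then show False using b pos by simp
  qed
  have "(\<Sum>z\<in>Z. \<omega> z * max (\<bar>u z - uinf z\<bar> - c') 0) = (\<Sum>z\<in>Z. \<omega> z * max (\<bar>u' z - uinf z\<bar> - c') 0)"
    by (rule sum.cong) (use assms(3) in auto)
  then have "step1 u c'" using assms(2) by (simp add: step1_def)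
  then show ?thesis using no[OF assms(1)] no[of c' c] assms(1) by force
qed

lemma step2_adm:
  assumes "step1 u c" "step2 u c d"
  shows "d \<in> adm"
proof -
  have c: "c > 0" "m * \<beta> * c = (\<Sum>z\<in>Z. \<omega> z * max (\<bar>u z - uinf z\<bar> - c) 0)"
    using assms(1) by (auto simp: step1_def)
  have "(\<Sum>z\<in>Z. \<omega> z * d z) = (\<Sum>z\<in>Z. \<omega> z * max (\<bar>u z - uinf z\<bar> - c) 0) / (c * \<beta>)"
    unfolding sum_divide_distrib by (rule sum.cong) (use assms(2) in \<open>auto simp: step2_def\<close>)
  also have "\<dots> = m" using c pos by (simp add: c(2)[symmetric])
  finally show ?thesis using assms(2) c pos by (auto simp: adm_def step2_def)
qed

section \<open>Taylor expansion and first-order optimality\<close>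

definition deriv_v :: "('a \<Rightarrow> real) \<Rightarrow> ('a \<Rightarrow> real) \<Rightarrow> ('a \<Rightarrow> real) \<Rightarrow> real" where
  "deriv_v v \<eta> \<phi> = \<kappa> * a v \<phi> + \<beta> * (\<Sum>z\<in>Z. \<omega> z * ((v z - uinf z) * \<phi> z / (1 + \<beta> * \<eta> z))) - l \<phi>"

definition deriv_\<eta> :: "('a \<Rightarrow> real) \<Rightarrow> ('a \<Rightarrow> real) \<Rightarrow> ('a \<Rightarrow> real) \<Rightarrow> real" where
  "deriv_\<eta> v \<eta> \<xi> = - (\<beta>\<^sup>2 / 2 * (\<Sum>z\<in>Z. \<omega> z * (((v z - uinf z) / (1 + \<beta> * \<eta> z))\<^sup>2 * \<xi> z)))"

text \<open>The density \<open>\<eta>'\<close> of the denominators is a separate argument: the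
  numerators are quadratic in the increments, while the denominators only need bounds.\<close>

definition remainder :: "('a \<Rightarrow> real) \<Rightarrow> ('a \<Rightarrow> real) \<Rightarrow> ('a \<Rightarrow> real) \<Rightarrow> ('a \<Rightarrow> real) \<Rightarrow> ('a \<Rightarrow> real) \<Rightarrow> real" where
  "remainder v \<eta> \<phi> \<xi> \<eta>' = \<kappa> / 2 * a \<phi> \<phi> +
    \<beta> / 2 * (\<Sum>z\<in>Z. \<omega> z * ((\<phi> z - \<beta> * (v z - uinf z) / (1 + \<beta> * \<eta> z) * \<xi> z)\<^sup>2 / (1 + \<beta> * \<eta>' z)))"

text \<open>The Taylor remainder of the jointly convex function \<open>w\<^sup>2 / s\<close> is an exact square:
  \<open>w'\<^sup>2 / s' = w\<^sup>2 / s + 2 (w / s) (w' - w) - (w / s)\<^sup>2 (s' - s) + (w' - (w / s) s')\<^sup>2 / s'\<close>.\<close>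

lemma expansion:
  assumes v: "v \<in> V" and \<phi>: "\<phi> \<in> V" and \<eta>: "\<eta> \<in> adm" and \<eta>': "(\<lambda>z. \<eta> z + \<xi> z) \<in> adm"
  shows "en (\<lambda>x. v x + \<phi> x) (\<lambda>x. \<eta> x + \<xi> x) =
    en v \<eta> + deriv_v v \<eta> \<phi> + deriv_\<eta> v \<eta> \<xi> + remainder v \<eta> \<phi> \<xi> (\<lambda>x. \<eta> x + \<xi> x)"
proof -
  have pt: "(v z + \<phi> z - uinf z)\<^sup>2 / (1 + \<beta> * (\<eta> z + \<xi> z)) = (v z - uinf z)\<^sup>2 / (1 + \<beta> * \<eta> z)
      + 2 * ((v z - uinf z) * \<phi> z / (1 + \<beta> * \<eta> z)) - \<beta> * (((v z - uinf z) / (1 + \<beta> * \<eta> z))\<^sup>2 * \<xi> z)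
      + (\<phi> z - \<beta> * (v z - uinf z) / (1 + \<beta> * \<eta> z) * \<xi> z)\<^sup>2 / (1 + \<beta> * (\<eta> z + \<xi> z))" if z: "z \<in> Z" for z
  proof -
    define w s s' where "w = v z - uinf z" and "s = 1 + \<beta> * \<eta> z" and "s' = 1 + \<beta> * (\<eta> z + \<xi> z)"
    have s: "s > 0" "s' > 0" using adm_pos[OF \<eta> z] adm_pos[OF \<eta>' z] by (auto simp: s_def s'_def)
    have \<xi>: "\<beta> * \<xi> z = s' - s" by (simp add: s_def s'_def algebra_simps)
    \<comment> \<open>In terms of the quotient \<open>k\<close>, only the division by
      \<open>s'\<close> remains.\<close>
    define k where "k = w / s"
    have w: "w = k * s" using s by (simp add: k_def)
    have "(w + \<phi> z)\<^sup>2 / s' = k\<^sup>2 * s + 2 * (k * \<phi> z) - k\<^sup>2 * (s' - s) + (\<phi> z - k * (s' - s))\<^sup>2 / s'"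
      unfolding w using s by (simp add: field_simps power2_eq_square)
    moreover have "w\<^sup>2 / s = k\<^sup>2 * s" "w * \<phi> z / s = k * \<phi> z" unfolding w using s by (auto simp: power2_eq_square)
    moreover have "\<beta> * ((w / s)\<^sup>2 * \<xi> z) = k\<^sup>2 * (s' - s)" by (simp add: k_def[symmetric] \<xi>[symmetric])
    moreover have "\<beta> * w / s * \<xi> z = k * (s' - s)" by (simp add: k_def \<xi>[symmetric])
    ultimately have "(w + \<phi> z)\<^sup>2 / s' = w\<^sup>2 / s + 2 * (w * \<phi> z / s) - \<beta> * ((w / s)\<^sup>2 * \<xi> z) + (\<phi> z - \<beta> * w / s * \<xi> z)\<^sup>2 / s'"
      by simp
    then show ?thesis unfolding w_def s_def s'_def by (simp add: algebra_simps)
  qed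
  have "(\<Sum>z\<in>Z. \<omega> z * ((v z + \<phi> z - uinf z)\<^sup>2 / (1 + \<beta> * (\<eta> z + \<xi> z)))) =
    (\<Sum>z\<in>Z. \<omega> z * ((v z - uinf z)\<^sup>2 / (1 + \<beta> * \<eta> z)))
      + 2 * (\<Sum>z\<in>Z. \<omega> z * ((v z - uinf z) * \<phi> z / (1 + \<beta> * \<eta> z)))
      - \<beta> * (\<Sum>z\<in>Z. \<omega> z * (((v z - uinf z) / (1 + \<beta> * \<eta> z))\<^sup>2 * \<xi> z))
      + (\<Sum>z\<in>Z. \<omega> z * ((\<phi> z - \<beta> * (v z - uinf z) / (1 + \<beta> * \<eta> z) * \<xi> z)\<^sup>2 / (1 + \<beta> * (\<eta> z + \<xi> z))))"
    unfolding sum_distrib_left sum.distrib[symmetric] sum_subtractf[symmetric]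
    by (rule sum.cong[OF refl]) (simp only: pt, simp add: algebra_simps)
  note sums = this
  have aa: "a (\<lambda>x. v x + \<phi> x) (\<lambda>x. v x + \<phi> x) = a v v + 2 * a v \<phi> + a \<phi> \<phi>"
    using a.comb_square[OF v \<phi>, of 1] by simp
  have ll: "l (\<lambda>x. v x + \<phi> x) = l v + l \<phi>" using l_linear[OF v \<phi>, of 1] by simp
  have regroup: "\<kappa> / 2 * (x + 2 * y + w) + \<beta> / 2 * (A + 2 * B - \<beta> * C + D) - (p + q) =
      (\<kappa> / 2 * x + \<beta> / 2 * A - p) + (\<kappa> * y + \<beta> * B - q) + - (\<beta>\<^sup>2 / 2 * C) + (\<kappa> / 2 * w + \<beta> / 2 * D)"
    for x y w A B C D p q :: real
    by (simp add: algebra_simps power2_eq_square add_divide_distrib diff_divide_distrib)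
  show ?thesis
    unfolding en_def deriv_v_def deriv_\<eta>_def remainder_def sums aa ll by (rule regroup)
qed

lemma remainder_nonneg:
  assumes "\<phi> \<in> V" "\<eta>' \<in> adm"
  shows "0 \<le> remainder v \<eta> \<phi> \<xi> \<eta>'"
proof -
  have "0 \<le> \<omega> z * ((\<phi> z - \<beta> * (v z - uinf z) / (1 + \<beta> * \<eta> z) * \<xi> z)\<^sup>2 / (1 + \<beta> * \<eta>' z))" if "z \<in> Z" for z
    unfolding power2_eq_square by (rule lumped_term_nonneg[OF assms(2) that])
  from sum_nonneg[OF this] show ?thesis
    unfolding remainder_def using pos a.nonneg[OF assms(1)]
    by (intro add_nonneg_nonneg mult_nonneg_nonneg) auto
qed

lemma diff_mem: "v \<in> V \<Longrightarrow> w \<in> V \<Longrightarrow> (\<lambda>x. v x - w x) \<in> V"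
  using a.closed[of v w "- 1"] by simp

lemma expansion':
  assumes "v \<in> V" "v' \<in> V" "\<eta> \<in> adm" "\<eta>' \<in> adm"
  shows "en v' \<eta>' = en v \<eta> + deriv_v v \<eta> (\<lambda>x. v' x - v x) + deriv_\<eta> v \<eta> (\<lambda>x. \<eta>' x - \<eta> x)
    + remainder v \<eta> (\<lambda>x. v' x - v x) (\<lambda>x. \<eta>' x - \<eta> x) \<eta>'"
  using expansion[OF assms(1) diff_mem[OF assms(2,1)] assms(3), of "\<lambda>x. \<eta>' x - \<eta> x"] assms(4) by simp

lemma deriv_v_scale: "v \<in> V \<Longrightarrow> \<phi> \<in> V \<Longrightarrow> deriv_v v \<eta> (\<lambda>x. t * \<phi> x) = t * deriv_v v \<eta> \<phi>"
proof -
  assume v: "v \<in> V" and \<phi>: "\<phi> \<in> V"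
  have 0: "(\<lambda>x. 0) \<in> V" by (rule const_mem)
  have "a v (\<lambda>x. 0) = 0" using a.null_orthogonal[OF v 0] a_zero[OF 0] by simp
  then have "a v (\<lambda>x. t * \<phi> x) = t * a v \<phi>" using a.linear_right[OF 0 \<phi> v, of t] by simp
  moreover have "l (\<lambda>x. t * \<phi> x) = t * l \<phi>" using l_linear[OF 0 \<phi>, of t] l_zero[OF 0] by simp
  ultimately show ?thesis
    by (simp add: deriv_v_def sum_distrib_left algebra_simps)
qed

lemma deriv_\<eta>_scale: "deriv_\<eta> v \<eta> (\<lambda>x. t * \<xi> x) = t * deriv_\<eta> v \<eta> \<xi>"
  by (simp add: deriv_\<eta>_def sum_distrib_left algebra_simps)

lemma scale_mem: "\<phi> \<in> V \<Longrightarrow> (\<lambda>x. t * \<phi> x) \<in> V"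
  using a.closed[OF const_mem[of 0], of \<phi> t] by simp

lemma a_scale: "\<phi> \<in> V \<Longrightarrow> a (\<lambda>x. t * \<phi> x) (\<lambda>x. t * \<phi> x) = t\<^sup>2 * a \<phi> \<phi>"
  using a.comb_square[OF const_mem[of 0], of \<phi> t] a.null_orthogonal[of \<phi> "\<lambda>x. 0"] a_zero[OF const_mem[of 0]]
    a.sym[OF const_mem[of 0], of \<phi>] const_mem[of 0] by simp

lemma adm_segment:
  assumes "\<eta> \<in> adm" "\<eta>' \<in> adm" "0 \<le> t" "t \<le> 1"
  shows "(\<lambda>x. \<eta> x + t * (\<eta>' x - \<eta> x)) \<in> adm"
proof -
  have "0 \<le> \<eta> z + t * (\<eta>' z - \<eta> z)" if "z \<in> Z" for z
  proof -
    have "0 \<le> (1 - t) * \<eta> z + t * \<eta>' z"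
      using assms that by (intro add_nonneg_nonneg mult_nonneg_nonneg) (auto simp: adm_def)
    then show ?thesis by (simp add: algebra_simps)
  qed
  moreover have "(\<Sum>z\<in>Z. \<omega> z * (\<eta> z + t * (\<eta>' z - \<eta> z))) = (\<Sum>z\<in>Z. \<omega> z * \<eta> z) + t * ((\<Sum>z\<in>Z. \<omega> z * \<eta>' z) - (\<Sum>z\<in>Z. \<omega> z * \<eta> z))"
    by (simp add: sum_distrib_left sum.distrib[symmetric] sum_subtractf[symmetric] algebra_simps)
  ultimately show ?thesis using assms by (simp add: adm_def)
qed

text \<open>Admissible densities form a convex set only, so variations are one-sided and a
  variational inequality results. Along the segment the energy is \<open>en u d + t * D\<close> plus
  a remainder of order \<open>t\<^sup>2\<close>, since the denominators are at least 1.\<close>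

lemma first_order_optimality:
  assumes u: "u \<in> V" and d: "d \<in> adm" and min: "\<And>v \<eta>. v \<in> V \<Longrightarrow> \<eta> \<in> adm \<Longrightarrow> en u d \<le> en v \<eta>"
    and v: "v \<in> V" and \<eta>: "\<eta> \<in> adm"
  shows "0 \<le> deriv_v u d (\<lambda>x. v x - u x) + deriv_\<eta> u d (\<lambda>x. \<eta> x - d x)"
proof -
  define \<phi> \<xi> where "\<phi> = (\<lambda>x. v x - u x)" and "\<xi> = (\<lambda>x. \<eta> x - d x)"
  define D where "D = deriv_v u d \<phi> + deriv_\<eta> u d \<xi>"
  define q where "q z = (\<phi> z - \<beta> * (u z - uinf z) / (1 + \<beta> * d z) * \<xi> z)\<^sup>2" for z
  define M where "M = \<kappa> / 2 * a \<phi> \<phi> + \<beta> / 2 * (\<Sum>z\<in>Z. \<omega> z * q z)"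
  have \<phi>: "\<phi> \<in> V" unfolding \<phi>_def by (rule diff_mem[OF v u])
  have M0: "0 \<le> M" unfolding M_def
    using pos a.nonneg[OF \<phi>] less_imp_le[OF \<omega>] by (intro add_nonneg_nonneg mult_nonneg_nonneg sum_nonneg) (auto simp: q_def)
  have step: "0 \<le> D + t * M" if t: "0 < t" "t \<le> 1" for t
  proof -
    let ?d = "\<lambda>x. d x + t * \<xi> x"
    have dt: "?d \<in> adm" unfolding \<xi>_def using adm_segment[OF d \<eta>] t by simp
    have ut: "(\<lambda>x. u x + t * \<phi> x) \<in> V" by (rule a.closed[OF u \<phi>])
    have "en u d \<le> en (\<lambda>x. u x + t * \<phi> x) ?d" by (rule min[OF ut dt])
    also have "\<dots> = en u d + t * D + remainder u d (\<lambda>x. t * \<phi> x) (\<lambda>x. t * \<xi> x) ?d"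
      unfolding expansion[OF u scale_mem[OF \<phi>] d dt]
      by (simp add: deriv_v_scale[OF u \<phi>] deriv_\<eta>_scale D_def algebra_simps)
    also have "remainder u d (\<lambda>x. t * \<phi> x) (\<lambda>x. t * \<xi> x) ?d \<le> t\<^sup>2 * M"
    proof -
      have "(\<Sum>z\<in>Z. \<omega> z * ((t * \<phi> z - \<beta> * (u z - uinf z) / (1 + \<beta> * d z) * (t * \<xi> z))\<^sup>2 / (1 + \<beta> * ?d z)))
        \<le> (\<Sum>z\<in>Z. \<omega> z * (t\<^sup>2 * q z))"
      proof (intro sum_mono mult_left_mono less_imp_le[OF \<omega>])
        fix z assume z: "z \<in> Z"
        have "(t * \<phi> z - \<beta> * (u z - uinf z) / (1 + \<beta> * d z) * (t * \<xi> z))\<^sup>2 = t\<^sup>2 * q z"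
          unfolding q_def power_mult_distrib[symmetric] by (simp add: algebra_simps)
        moreover have "0 \<le> t\<^sup>2 * q z" by (simp add: q_def)
        ultimately show "(t * \<phi> z - \<beta> * (u z - uinf z) / (1 + \<beta> * d z) * (t * \<xi> z))\<^sup>2 / (1 + \<beta> * ?d z) \<le> t\<^sup>2 * q z"
          using adm_pos[OF dt z] divide_left_mono[of 1 "1 + \<beta> * ?d z" "t\<^sup>2 * q z"] by simp
      qed
      also have "\<dots> = t\<^sup>2 * (\<Sum>z\<in>Z. \<omega> z * q z)" by (simp add: sum_distrib_left algebra_simps)
      finally have "\<beta> / 2 * (\<Sum>z\<in>Z. \<omega> z * ((t * \<phi> z - \<beta> * (u z - uinf z) / (1 + \<beta> * d z) * (t * \<xi> z))\<^sup>2 / (1 + \<beta> * ?d z)))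
        \<le> \<beta> / 2 * (t\<^sup>2 * (\<Sum>z\<in>Z. \<omega> z * q z))" using pos by (intro mult_left_mono) auto
      then show ?thesis
        by (simp add: remainder_def M_def a_scale[OF \<phi>] algebra_simps)
    qed
    finally have "0 \<le> t * (D + t * M)" by (simp add: algebra_simps power2_eq_square)
    then show ?thesis using t by (simp add: zero_le_mult_iff)
  qed
  have "0 \<le> D"
  proof (rule ccontr)
    assume "\<not> 0 \<le> D"
    \<comment> \<open>With this \<open>t\<close> a negative \<open>D\<close> outweighs
      \<open>t * M\<close>; \<open>M + 1\<close> keeps the denominator positive when
      \<open>M = 0\<close>.\<close>
    define t where "t = min 1 (- D / (2 * (M + 1)))"
    have t: "0 < t" "t \<le> 1" using \<open>\<not> 0 \<le> D\<close> M0 by (auto simp: t_def intro!: divide_neg_pos)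
    have "0 < 2 * (M + 1)" "t \<le> - D / (2 * (M + 1))" using M0 by (auto simp: t_def)
    then have "t * (2 * (M + 1)) \<le> - D" by (simp only: pos_le_divide_eq)
    then have "t * M + t * M + 2 * t \<le> - D" by (simp add: algebra_simps)
    then show False using step[OF t] t mult_nonneg_nonneg[of t M] M0 by linarith
  qed
  then show ?thesis by (simp add: D_def \<phi>_def \<xi>_def)
qed

lemma quadratic_growth:
  assumes u: "u \<in> V" and d: "d \<in> adm" and min: "\<And>v \<eta>. v \<in> V \<Longrightarrow> \<eta> \<in> adm \<Longrightarrow> en u d \<le> en v \<eta>"
    and v: "v \<in> V" and \<eta>: "\<eta> \<in> adm"
  shows "remainder u d (\<lambda>x. v x - u x) (\<lambda>x. \<eta> x - d x) \<eta> \<le> en v \<eta> - en u d"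
  using first_order_optimality[OF assms] expansion'[OF u v d \<eta>] by linarith

text \<open>Positive weights and nonnegative values turn the mass constraint into the nodal bound
  \<open>m / \<omega> z\<close>. It is uniform over all densities but depends on the mesh through
  the weights.\<close>

lemma adm_bounded:
  obtains S where "S > 0" "\<And>\<eta> z. \<eta> \<in> adm \<Longrightarrow> z \<in> Z \<Longrightarrow> 1 + \<beta> * \<eta> z \<le> S"
proof
  let ?S = "1 + \<beta> * (\<Sum>z\<in>Z. m / \<omega> z)"
  have nn: "0 \<le> m / \<omega> z" if "z \<in> Z" for z using \<omega>[OF that] pos by simp
  have "0 \<le> (\<Sum>z\<in>Z. m / \<omega> z)" by (rule sum_nonneg) (rule nn)
  then show "?S > 0" using pos by (simp add: add_pos_nonneg)
  fix \<eta> z assume \<eta>: "\<eta> \<in> adm" and z: "z \<in> Z"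
  have "\<omega> z * \<eta> z \<le> (\<Sum>y\<in>Z. \<omega> y * \<eta> y)"
    using \<eta> z finite_Z less_imp_le[OF \<omega>] by (intro member_le_sum) (auto simp: adm_def)
  then have "\<eta> z \<le> m / \<omega> z" using \<eta> \<omega>[OF z] by (simp add: adm_def field_simps)
  also have "\<dots> \<le> (\<Sum>z\<in>Z. m / \<omega> z)" using z finite_Z nn by (intro member_le_sum) auto
  finally show "1 + \<beta> * \<eta> z \<le> ?S" using pos by simp
qed

end

section \<open>Coercivity, descent and linear convergence\<close>

context insulation_problem
begin

text \<open>The gap lies above the form \<open>Q\<close> in both increments, and \<open>Q\<close>
  dominates \<open>p\<close> once its null vectors have first components with zero nodal values. For
  a null vector the first component is a constant \<open>c\<close>, equal to \<open>k z\<close>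
  times the mean-zero second component on \<open>Z\<close>; if \<open>c \<noteq> 0\<close>, dividing
  by \<open>c\<close> contradicts non-degeneracy.\<close>

lemma coercive:
  assumes u: "u \<in> V" and d: "d \<in> adm" and min: "\<And>v \<eta>. v \<in> V \<Longrightarrow> \<eta> \<in> adm \<Longrightarrow> en u d \<le> en v \<eta>"
    and nondeg: "\<And>\<xi>. (\<Sum>z\<in>Z. \<omega> z * \<xi> z) = 0 \<Longrightarrow> \<exists>z\<in>Z. \<beta> * (u z - uinf z) / (1 + \<beta> * d z) * \<xi> z \<noteq> 1"
    and p: "psd_form comb V p" and p0: "\<And>v. v \<in> V \<Longrightarrow> (\<And>z. z \<in> N \<Longrightarrow> v z = 0) \<Longrightarrow> p v v = 0"
  obtains c where "c > 0"
    "\<And>v \<eta>. v \<in> V \<Longrightarrow> \<eta> \<in> adm \<Longrightarrow> p (\<lambda>x. v x - u x) (\<lambda>x. v x - u x) \<le> c * (en v \<eta> - en u d)"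
proof -
  interpret p: psd_form comb V p by fact
  obtain S where S: "S > 0" "\<And>\<eta> z. \<eta> \<in> adm \<Longrightarrow> z \<in> Z \<Longrightarrow> 1 + \<beta> * \<eta> z \<le> S" using adm_bounded by blast
  define k where "k z = \<beta> * (u z - uinf z) / (1 + \<beta> * d z)" for z
  \<comment> \<open>Admissible densities have equal mass, so their differences are mean-zero, as the
    non-degeneracy condition demands.\<close>
  define W where "W = V \<times> {\<xi>. (\<Sum>z\<in>Z. \<omega> z * \<xi> z) = 0}"
  define comb2 where "comb2 t x y = (comb t (fst x) (fst y), comb t (snd x) (snd y))" for t and x y :: "('a \<Rightarrow> real) \<times> ('a \<Rightarrow> real)"
  define r where "r x z = fst x z - k z * snd x z" for x :: "('a \<Rightarrow> real) \<times> ('a \<Rightarrow> real)" and z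
  \<comment> \<open>The remainder, polarized, with the denominators replaced by their common upper
    bound \<open>S\<close>.\<close>
  define Q where "Q x y = \<kappa> / 2 * a (fst x) (fst y) + \<beta> / (2 * S) * (\<Sum>z\<in>Z. \<omega> z * (r x z * r y z))" for x y
  define P where "P x y = p (fst x) (fst y)" for x y :: "('a \<Rightarrow> real) \<times> ('a \<Rightarrow> real)"
  have r_comb: "r (comb2 t x y) z = r x z + t * r y z" for t x y z
    by (simp add: r_def comb2_def algebra_simps)
  have W: "fst x \<in> V" if "x \<in> W" for x using that by (auto simp: W_def)
  have W_closed: "comb2 t x y \<in> W" if "x \<in> W" "y \<in> W" for t x y
  proof -
    have "(\<Sum>z\<in>Z. \<omega> z * (snd x z + t * snd y z)) = (\<Sum>z\<in>Z. \<omega> z * snd x z) + t * (\<Sum>z\<in>Z. \<omega> z * snd y z)"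
      by (simp add: sum_distrib_left sum.distrib[symmetric] algebra_simps)
    then show ?thesis using that a.closed[of "fst x" "fst y" t] by (auto simp: W_def comb2_def)
  qed
  have W_ne: "W \<noteq> {}"
  proof -
    have "(\<lambda>x. 0, \<lambda>x. 0) \<in> W" using const_mem[of 0] by (simp add: W_def)
    then show ?thesis by blast
  qed
  have sq_nonneg: "0 \<le> (\<Sum>z\<in>Z. \<omega> z * (r x z * r x z))" for x
    by (rule sum_nonneg) (rule mult_nonneg_nonneg[OF less_imp_le[OF \<omega>] zero_le_square])
  have Q_form: "psd_form comb2 W Q"
  proof
    show "Q (comb2 t x y) z = Q x z + t * Q y z" if "x \<in> W" "y \<in> W" "z \<in> W" for t x y z
    proof -
      have "(\<Sum>i\<in>Z. \<omega> i * (r (comb2 t x y) i * r z i)) =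
        (\<Sum>i\<in>Z. \<omega> i * (r x i * r z i) + t * (\<omega> i * (r y i * r z i)))"
        by (rule sum.cong) (simp_all add: r_comb algebra_simps)
      also have "\<dots> = (\<Sum>i\<in>Z. \<omega> i * (r x i * r z i)) + t * (\<Sum>i\<in>Z. \<omega> i * (r y i * r z i))"
        by (simp add: sum.distrib sum_distrib_left)
      finally have "(\<Sum>i\<in>Z. \<omega> i * (r (comb2 t x y) i * r z i)) =
        (\<Sum>i\<in>Z. \<omega> i * (r x i * r z i)) + t * (\<Sum>i\<in>Z. \<omega> i * (r y i * r z i))" .
      moreover have "a (fst (comb2 t x y)) (fst z) = a (fst x) (fst z) + t * a (fst y) (fst z)"
        using a.linear[OF W[OF that(1)] W[OF that(2)] W[OF that(3)], of t] by (simp add: comb2_def)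
      ultimately show ?thesis unfolding Q_def by (simp add: algebra_simps)
    qed
    show "Q x y = Q y x" if "x \<in> W" "y \<in> W" for x y
      using a.sym[OF W[OF that(1)] W[OF that(2)]] by (simp add: Q_def mult.commute)
    show "0 \<le> Q x x" if "x \<in> W" for x
      unfolding Q_def using pos S(1) a.nonneg[OF W[OF that]] sq_nonneg[of x]
      by (intro add_nonneg_nonneg mult_nonneg_nonneg) auto
  qed (use W_ne W_closed in auto)
  have P_form: "psd_form comb2 W P"
  proof
    show "P (comb2 t x y) z = P x z + t * P y z" if "x \<in> W" "y \<in> W" "z \<in> W" for t x y z
      using p.linear[OF W[OF that(1)] W[OF that(2)] W[OF that(3)], of t] by (simp add: P_def comb2_def)
  qed (use W_ne W_closed W p.sym p.nonneg in \<open>auto simp: P_def\<close>)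
  have Q0: "P x x = 0" if x: "x \<in> W" and 0: "Q x x = 0" for x
  proof -
    have "0 \<le> \<kappa> / 2 * a (fst x) (fst x)" "0 \<le> \<beta> / (2 * S) * (\<Sum>z\<in>Z. \<omega> z * (r x z * r x z))"
      using pos S(1) a.nonneg[OF W[OF x]] sq_nonneg[of x] by (auto intro!: mult_nonneg_nonneg)
    then have "\<kappa> / 2 * a (fst x) (fst x) = 0" "\<beta> / (2 * S) * (\<Sum>z\<in>Z. \<omega> z * (r x z * r x z)) = 0"
      using 0 unfolding Q_def by linarith+
    then have ax: "a (fst x) (fst x) = 0" and sx: "(\<Sum>z\<in>Z. \<omega> z * (r x z * r x z)) = 0"
      using pos S(1) by auto
    obtain c where c: "\<forall>z\<in>N. fst x z = c" using a_const[OF W[OF x] ax] by auto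
    have rz: "r x z = 0" if z: "z \<in> Z" for z
    proof -
      have "\<omega> z * (r x z * r x z) = 0"
        using sx z finite_Z less_imp_le[OF \<omega>] by (subst (asm) sum_nonneg_eq_0_iff) auto
      then show ?thesis using \<omega>[OF z] by auto
    qed
    have "c = 0"
    proof (rule ccontr)
      assume "c \<noteq> 0"
      have "(\<Sum>z\<in>Z. \<omega> z * (snd x z / c)) = (\<Sum>z\<in>Z. \<omega> z * snd x z) / c"
        by (simp add: sum_divide_distrib)
      also have "\<dots> = 0" using x by (auto simp: W_def)
      finally obtain z where z: "z \<in> Z" "k z * (snd x z / c) \<noteq> 1"
        using nondeg[of "\<lambda>z. snd x z / c"] unfolding k_def by blast
      have "fst x z = c" using c z(1) N(2) by blast
      then have "k z * snd x z = c" using rz[OF z(1)] by (simp add: r_def)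
      then show False using z(2) \<open>c \<noteq> 0\<close> by simp
    qed
    then show ?thesis using p0[OF W[OF x]] c by (simp add: P_def)
  qed
  \<comment> \<open>The sum type indexes the separating functionals: nodal values of the first
    component on \<open>N\<close> and of the second on \<open>Z\<close>.\<close>
  define \<phi> where "\<phi> i x = (case i of Inl z \<Rightarrow> fst x z | Inr z \<Rightarrow> snd x z)"
    for i :: "'a + 'a" and x :: "('a \<Rightarrow> real) \<times> ('a \<Rightarrow> real)"
  obtain c where c: "c > 0" "\<And>x. x \<in> W \<Longrightarrow> P x x \<le> c * Q x x"
  proof (rule psd_form_dominated[OF _ Q_form P_form, of "Inl ` N \<union> Inr ` Z" \<phi>])
    show "finite (Inl ` N \<union> Inr ` Z)" using N(1) finite_Z by simp
    show "\<phi> i (comb2 t x y) = \<phi> i x + t * \<phi> i y" for i t x y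
      by (cases i) (auto simp: \<phi>_def comb2_def)
    show "Q x x = 0" if x: "x \<in> W" and 0: "\<And>i. i \<in> Inl ` N \<union> Inr ` Z \<Longrightarrow> \<phi> i x = 0" for x
    proof -
      have N0: "fst x z = 0" if "z \<in> N" for z using 0[of "Inl z"] that by (simp add: \<phi>_def)
      have Z0: "snd x z = 0" if "z \<in> Z" for z using 0[of "Inr z"] that by (simp add: \<phi>_def)
      have "r x z = 0" if "z \<in> Z" for z using N0[of z] Z0[OF that] N(2) that by (auto simp: r_def)
      then show ?thesis using a_zero[OF W[OF x] N0] by (simp add: Q_def)
    qed
  qed (use Q0 that in auto)
  have "p (\<lambda>x. v x - u x) (\<lambda>x. v x - u x) \<le> c * (en v \<eta> - en u d)" if v: "v \<in> V" and \<eta>: "\<eta> \<in> adm" for v \<eta>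
  proof -
    define x where "x = ((\<lambda>x. v x - u x), (\<lambda>x. \<eta> x - d x))"
    have "(\<Sum>z\<in>Z. \<omega> z * (\<eta> z - d z)) = 0"
      using \<eta> d by (simp add: adm_def right_diff_distrib sum_subtractf)
    then have x: "x \<in> W" using diff_mem[OF v u] by (simp add: x_def W_def)
    have "Q x x \<le> remainder u d (\<lambda>x. v x - u x) (\<lambda>x. \<eta> x - d x) \<eta>"
    proof -
      have "(\<Sum>z\<in>Z. \<omega> z * (r x z * r x z)) / S = (\<Sum>z\<in>Z. \<omega> z * ((r x z)\<^sup>2 / S))"
        by (simp add: sum_divide_distrib power2_eq_square)
      also have "\<dots> \<le> (\<Sum>z\<in>Z. \<omega> z * ((r x z)\<^sup>2 / (1 + \<beta> * \<eta> z)))"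
      proof (intro sum_mono mult_left_mono less_imp_le[OF \<omega>])
        fix z assume z: "z \<in> Z"
        show "(r x z)\<^sup>2 / S \<le> (r x z)\<^sup>2 / (1 + \<beta> * \<eta> z)"
          using adm_pos[OF \<eta> z] S(2)[OF \<eta> z] by (intro divide_left_mono) auto
      qed
      finally have "\<beta> / 2 * ((\<Sum>z\<in>Z. \<omega> z * (r x z * r x z)) / S) \<le> \<beta> / 2 * (\<Sum>z\<in>Z. \<omega> z * ((r x z)\<^sup>2 / (1 + \<beta> * \<eta> z)))"
        using pos by (intro mult_left_mono) auto
      then show ?thesis by (simp add: Q_def remainder_def x_def r_def k_def)
    qed
    also have "\<dots> \<le> en v \<eta> - en u d" by (rule quadratic_growth[OF u d min v \<eta>])
    finally have "c * Q x x \<le> c * (en v \<eta> - en u d)" using c(1) by simp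
    moreover have "p (\<lambda>x. v x - u x) (\<lambda>x. v x - u x) \<le> c * Q x x" using c(2)[OF x] by (simp add: P_def x_def)
    ultimately show ?thesis by linarith
  qed
  then show ?thesis using that c(1) by blast
qed

text \<open>Up to a constant factor, the derivative of the energy with respect to \<open>\<eta>\<close> is
  \<open>- (min \<bar>u - uinf\<bar> c)\<^sup>2\<close>.  It is minimal where \<open>d > 0\<close>, so moving mass elsewhere cannot
  decrease the energy.\<close>

lemma step2_optimal:
  assumes s1: "step1 u c" and s2: "step2 u c d" and \<eta>: "\<eta> \<in> adm"
  shows "0 \<le> deriv_\<eta> u d (\<lambda>x. \<eta> x - d x)"
proof -
  have c: "c > 0" using s1 by (simp add: step1_def)
  have d: "d \<in> adm" by (rule step2_adm[OF s1 s2])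
  have "((u z - uinf z) / (1 + \<beta> * d z))\<^sup>2 * (\<eta> z - d z) \<le> c\<^sup>2 * (\<eta> z - d z)" if z: "z \<in> Z" for z
  proof -
    define w where "w = u z - uinf z"
    have dz: "d z = max (\<bar>w\<bar> - c) 0 / (c * \<beta>)" using s2 z by (simp add: step2_def w_def)
    \<comment> \<open>So \<open>w / (1 + \<beta> * d z)\<close> is \<open>w\<close> truncated to
      absolute value at most \<open>c\<close>.\<close>
    have sz: "1 + \<beta> * d z = max \<bar>w\<bar> c / c" using c pos by (simp add: dz max_def field_simps)
    show ?thesis
    proof (cases "c \<le> \<bar>w\<bar>")
      case True
      then have "1 + \<beta> * d z = \<bar>w\<bar> / c" "w \<noteq> 0" using sz c by auto
      then have "(w / (1 + \<beta> * d z))\<^sup>2 = c\<^sup>2" using c by (simp add: power_divide power_mult_distrib)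
      then show ?thesis by (simp add: w_def)
    next
      case False
      then have "1 + \<beta> * d z = 1" "d z = 0" using sz dz c by auto
      moreover have "w\<^sup>2 \<le> c\<^sup>2" using False c by (simp add: abs_le_square_iff[symmetric])
      moreover have "0 \<le> \<eta> z" using \<eta> z by (simp add: adm_def)
      ultimately show ?thesis by (simp add: w_def mult_right_mono)
    qed
  qed
  then have "(\<Sum>z\<in>Z. \<omega> z * (((u z - uinf z) / (1 + \<beta> * d z))\<^sup>2 * (\<eta> z - d z))) \<le> (\<Sum>z\<in>Z. \<omega> z * (c\<^sup>2 * (\<eta> z - d z)))"
    by (intro sum_mono mult_left_mono less_imp_le[OF \<omega>])
  also have "\<dots> = c\<^sup>2 * ((\<Sum>z\<in>Z. \<omega> z * \<eta> z) - (\<Sum>z\<in>Z. \<omega> z * d z))"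
    by (simp add: sum_distrib_left sum_subtractf[symmetric] algebra_simps)
  also have "\<dots> = 0" using \<eta> d by (simp add: adm_def)
  finally show ?thesis unfolding deriv_\<eta>_def
    by (simp add: mult_nonneg_nonpos)
qed

lemma en_mono_step2:
  assumes "u \<in> V" "step1 u c" "step2 u c d" "\<eta> \<in> adm"
  shows "en u d \<le> en u \<eta>"
proof -
  have d: "d \<in> adm" by (rule step2_adm[OF assms(2,3)])
  have 0: "(\<lambda>x. 0) \<in> V" by (rule const_mem)
  have "deriv_v u d (\<lambda>x. 0) = 0" using deriv_v_scale[OF assms(1) 0, of d 0] by simp
  then show ?thesis
    using expansion'[OF assms(1,1) d assms(4)] step2_optimal[OF assms(2-4)] remainder_nonneg[OF 0 assms(4)] by simp
qed

lemma en_mono_step3: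
  assumes "step3 d u" "d \<in> adm" "v \<in> V"
  shows "en u d \<le> en v d"
proof -
  have u: "u \<in> V" using assms(1) by (simp add: step3_def)
  have "deriv_v u d (\<lambda>x. v x - u x) = 0"
    using assms(1) diff_mem[OF assms(3) u] unfolding step3_def deriv_v_def by simp
  moreover have "deriv_\<eta> u d (\<lambda>x. 0) = 0" by (simp add: deriv_\<eta>_def)
  ultimately show ?thesis
    using expansion'[OF u assms(3,2,2)] remainder_nonneg[OF diff_mem[OF assms(3) u] assms(2)] by simp
qed

text \<open>Step 3 is compared with the step \<open>t\<close> towards the minimizer.  By joint convexity and the
  optimality of \<open>d\<close> the linear term is at most \<open>-t\<close> times the energy gap.\<close>

lemma descent:
  assumes s1: "step1 v c" and s2: "step2 v c d" and v: "v \<in> V" and s3: "step3 d v'"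
    and s1': "step1 v' c'" and s2': "step2 v' c' d'"
    and u: "u \<in> V" and e: "e \<in> adm" and t: "0 \<le> t" "t \<le> 1"
  shows "en v' d' - en u e \<le> (1 - t) * (en v d - en u e) +
    t\<^sup>2 / 2 * (\<kappa> * a (\<lambda>x. v x - u x) (\<lambda>x. v x - u x) + \<beta> * (\<Sum>z\<in>Z. \<omega> z * ((v z - u z) * (v z - u z))))"
proof -
  define \<phi> where "\<phi> = (\<lambda>x. u x - v x)"
  have \<phi>: "\<phi> \<in> V" unfolding \<phi>_def by (rule diff_mem[OF u v])
  have d: "d \<in> adm" and d': "d' \<in> adm" using step2_adm s1 s2 s1' s2' by blast+
  have v': "v' \<in> V" using s3 by (simp add: step3_def)
  have "en v' d' \<le> en v' d" by (rule en_mono_step2[OF v' s1' s2' d])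
  also have "\<dots> \<le> en (\<lambda>x. v x + t * \<phi> x) d" by (rule en_mono_step3[OF s3 d a.closed[OF v \<phi>]])
  also have "\<dots> = en v d + t * deriv_v v d \<phi> + remainder v d (\<lambda>x. t * \<phi> x) (\<lambda>x. 0) d"
  proof -
    have "deriv_\<eta> v d (\<lambda>x. 0) = 0" by (simp add: deriv_\<eta>_def)
    then show ?thesis
      using expansion[OF v scale_mem[OF \<phi>, of t] d, of "\<lambda>x. 0"] d by (simp add: deriv_v_scale[OF v \<phi>])
  qed
  also have "t * deriv_v v d \<phi> \<le> t * (en u e - en v d)"
    using expansion'[OF v u d e] step2_optimal[OF s1 s2 e] remainder_nonneg[OF \<phi> e] t(1)
    by (intro mult_left_mono) (auto simp: \<phi>_def)
  also have "remainder v d (\<lambda>x. t * \<phi> x) (\<lambda>x. 0) d \<le> t\<^sup>2 / 2 * (\<kappa> * a \<phi> \<phi> + \<beta> * (\<Sum>z\<in>Z. \<omega> z * (\<phi> z * \<phi> z)))"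
  proof -
    have "(\<Sum>z\<in>Z. \<omega> z * ((t * \<phi> z)\<^sup>2 / (1 + \<beta> * d z))) \<le> (\<Sum>z\<in>Z. \<omega> z * (t\<^sup>2 * (\<phi> z * \<phi> z)))"
    proof (intro sum_mono mult_left_mono less_imp_le[OF \<omega>])
      fix z assume z: "z \<in> Z"
      show "(t * \<phi> z)\<^sup>2 / (1 + \<beta> * d z) \<le> t\<^sup>2 * (\<phi> z * \<phi> z)"
      proof -
        have "(t * \<phi> z)\<^sup>2 / (1 + \<beta> * d z) \<le> (t * \<phi> z)\<^sup>2 / 1"
          using adm_pos[OF d z] by (intro divide_left_mono) auto
        then show ?thesis by (simp add: power2_eq_square mult_ac)
      qed
    qed
    also have "\<dots> = t\<^sup>2 * (\<Sum>z\<in>Z. \<omega> z * (\<phi> z * \<phi> z))"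
      by (simp add: sum_distrib_left mult.left_commute)
    finally have "\<beta> / 2 * (\<Sum>z\<in>Z. \<omega> z * ((t * \<phi> z)\<^sup>2 / (1 + \<beta> * d z))) \<le> \<beta> / 2 * (t\<^sup>2 * (\<Sum>z\<in>Z. \<omega> z * (\<phi> z * \<phi> z)))"
      using pos by (intro mult_left_mono) auto
    then show ?thesis by (simp add: remainder_def a_scale[OF \<phi>] algebra_simps)
  qed
  finally have le: "en v' d' \<le> en v d + t * (en u e - en v d) + t\<^sup>2 / 2 * (\<kappa> * a \<phi> \<phi> + \<beta> * (\<Sum>z\<in>Z. \<omega> z * (\<phi> z * \<phi> z)))"
    by simp
  have "a (\<lambda>x. v x - u x) (\<lambda>x. v x - u x) = a \<phi> \<phi>"
    using a_scale[OF \<phi>, of "- 1"] by (simp add: \<phi>_def)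
  moreover have "(v z - u z) * (v z - u z) = \<phi> z * \<phi> z" for z by (simp add: \<phi>_def algebra_simps)
  ultimately show ?thesis using le by (simp add: algebra_simps)
qed

theorem linear_convergence:
  assumes u: "u \<in> V" and d: "d \<in> adm" and min: "\<And>v \<eta>. v \<in> V \<Longrightarrow> \<eta> \<in> adm \<Longrightarrow> en u d \<le> en v \<eta>"
    and nondeg: "\<And>\<xi>. (\<Sum>z\<in>Z. \<omega> z * \<xi> z) = 0 \<Longrightarrow> \<exists>z\<in>Z. \<beta> * (u z - uinf z) / (1 + \<beta> * d z) * \<xi> z \<noteq> 1"
    and p: "psd_form comb V p" and p0: "\<And>v. v \<in> V \<Longrightarrow> (\<And>z. z \<in> N \<Longrightarrow> v z = 0) \<Longrightarrow> p v v = 0"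
    and L: "L > 0"
  obtains \<sigma> where "\<sigma> > 0"
    "\<And>w C e i. (\<And>i. w i \<in> V \<and> step1 (w i) (C i) \<and> step2 (w i) (C i) (e i) \<and> step3 (e i) (w (Suc i))) \<Longrightarrow>
      \<sigma> * p (\<lambda>x. w i x - u x) (\<lambda>x. w i x - u x) \<le> en (w i) (e i) - en u d \<and>
      en (w i) (e i) - en u d \<le> (1 - \<sigma> / (8 * L)) ^ i * (en (w 0) (e 0) - en u d)"
proof -
  obtain cp where cp: "cp > 0" "\<And>v \<eta>. v \<in> V \<Longrightarrow> \<eta> \<in> adm \<Longrightarrow> p (\<lambda>x. v x - u x) (\<lambda>x. v x - u x) \<le> cp * (en v \<eta> - en u d)"
    using coercive[OF u d min nondeg p p0] by blast
  \<comment> \<open>The quadratic term of \<open>descent\<close> as a form; a second use of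
    \<open>coercive\<close> bounds it by the gap with a constant independent of the iterate.\<close>
  define A where "A v w = \<kappa> * a v w + \<beta> * (\<Sum>z\<in>Z. \<omega> z * (v z * w z))" for v w
  have A: "psd_form comb V A"
    unfolding A_def[abs_def]
  proof (rule psd_form_add[OF a_form])
    show "\<beta> * (\<Sum>z\<in>Z. \<omega> z * ((v z + t * w z) * x z)) =
      \<beta> * (\<Sum>z\<in>Z. \<omega> z * (v z * x z)) + t * (\<beta> * (\<Sum>z\<in>Z. \<omega> z * (w z * x z)))" for t and v w x :: "'a \<Rightarrow> real"
      by (simp add: sum_distrib_left sum.distrib[symmetric] algebra_simps)
    show "0 \<le> \<beta> * (\<Sum>z\<in>Z. \<omega> z * (v z * v z))" for v :: "'a \<Rightarrow> real"
    proof -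
      have "0 \<le> (\<Sum>z\<in>Z. \<omega> z * (v z * v z))"
        by (rule sum_nonneg) (rule mult_nonneg_nonneg[OF less_imp_le[OF \<omega>] zero_le_square])
      then show ?thesis using pos by simp
    qed
  qed (use pos in \<open>auto simp: mult.commute\<close>)
  have A0: "A v v = 0" if "v \<in> V" "\<And>z. z \<in> N \<Longrightarrow> v z = 0" for v
    using a_zero[OF that] that(2) N(2) by (auto simp: A_def intro!: sum.neutral)
  obtain cA where cA: "cA > 0" "\<And>v \<eta>. v \<in> V \<Longrightarrow> \<eta> \<in> adm \<Longrightarrow> A (\<lambda>x. v x - u x) (\<lambda>x. v x - u x) \<le> cA * (en v \<eta> - en u d)"
    using coercive[OF u d min nondeg A A0] by blast
  \<comment> \<open>Since \<open>t * cA \<le> 1\<close>, the quadratic term costs at most half of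
    the linear gain \<open>t\<close>, which leaves the factor \<open>1 - t / 2\<close>.\<close>
  define t where "t = 1 / max 1 cA"
  have t: "0 < t" "t \<le> 1" "t * cA \<le> 1" using cA(1) by (auto simp: t_def max_def field_simps)
  \<comment> \<open>The first entry gives the lower estimate for \<open>p\<close>; the second gives
    \<open>\<sigma> / (8 * L) \<le> t / 2\<close>, so the required factor is at least
    \<open>1 - t / 2\<close>.\<close>
  define \<sigma> where "\<sigma> = min (1 / cp) (4 * L * t)"
  have \<sigma>: "0 < \<sigma>" "\<sigma> \<le> 1 / cp" "\<sigma> / (8 * L) \<le> t / 2"
    using cp(1) L t by (auto simp: \<sigma>_def min_def field_simps)
  show ?thesis
  proof (rule that[OF \<sigma>(1)])
    fix w C e i
    assume run: "\<And>i. w i \<in> V \<and> step1 (w i) (C i) \<and> step2 (w i) (C i) (e i) \<and> step3 (e i) (w (Suc i))"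
    have wV: "w i \<in> V" and ei: "e i \<in> adm" for i using run step2_adm by blast+
    have gap: "0 \<le> en (w i) (e i) - en u d" for i using min[OF wV ei] by simp
    have lower: "\<sigma> * p (\<lambda>x. w i x - u x) (\<lambda>x. w i x - u x) \<le> en (w i) (e i) - en u d" for i
    proof -
      interpret p: psd_form comb V p by fact
      have "\<sigma> * p (\<lambda>x. w i x - u x) (\<lambda>x. w i x - u x) \<le> 1 / cp * (cp * (en (w i) (e i) - en u d))"
        using \<sigma> cp wV ei p.nonneg[OF diff_mem[OF wV u]] by (intro mult_mono) auto
      then show ?thesis using cp(1) by simp
    qed
    have contract: "en (w (Suc i)) (e (Suc i)) - en u d \<le> (1 - \<sigma> / (8 * L)) * (en (w i) (e i) - en u d)" for i
    proof -
      let ?g = "en (w i) (e i) - en u d"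
      have "en (w (Suc i)) (e (Suc i)) - en u d \<le> (1 - t) * ?g + t\<^sup>2 / 2 * A (\<lambda>x. w i x - u x) (\<lambda>x. w i x - u x)"
        unfolding A_def using run[of i] run[of "Suc i"] t u d by (intro descent) auto
      also have "t\<^sup>2 / 2 * A (\<lambda>x. w i x - u x) (\<lambda>x. w i x - u x) \<le> t\<^sup>2 / 2 * (cA * ?g)"
        using cA(2)[OF wV ei] by (intro mult_left_mono) auto
      also have "t\<^sup>2 / 2 * (cA * ?g) = (t * cA) * (t / 2 * ?g)" by (simp add: power2_eq_square)
      also have "\<dots> \<le> 1 * (t / 2 * ?g)" using t gap by (intro mult_right_mono mult_nonneg_nonneg) auto
      also have "(1 - t) * ?g + 1 * (t / 2 * ?g) = (1 - t / 2) * ?g" by (simp add: algebra_simps)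
      also have "\<dots> \<le> (1 - \<sigma> / (8 * L)) * ?g" using \<sigma>(3) gap by (intro mult_right_mono) auto
      finally show ?thesis by simp
    qed
    have q0: "0 \<le> 1 - \<sigma> / (8 * L)" using \<sigma>(3) t by simp
    have "en (w i) (e i) - en u d \<le> (1 - \<sigma> / (8 * L)) ^ i * (en (w 0) (e 0) - en u d)" for i
    proof (induction i)
      case (Suc i)
      show ?case using order_trans[OF contract[of i] mult_left_mono[OF Suc q0]] by simp
    qed simp
    with lower show "\<sigma> * p (\<lambda>x. w i x - u x) (\<lambda>x. w i x - u x) \<le> en (w i) (e i) - en u d \<and>
      en (w i) (e i) - en u d \<le> (1 - \<sigma> / (8 * L)) ^ i * (en (w 0) (e 0) - en u d)" by blast
  qed
qed

end

section \<open>The finite element problem as an instance\<close>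

lemma inner_L2_nonneg: "0 \<le> inner_L2 M S v v"
  unfolding inner_L2_def set_lebesgue_integral_def
  by (rule integral_nonneg_AE) (simp add: indicator_def)

lemma norm_L2_square: "(norm_L2 M S v)\<^sup>2 = inner_L2 M S v v"
  by (simp add: norm_L2_def inner_L2_nonneg)

lemma inner_L2_commute: "inner_L2 M S v w = inner_L2 M S w v"
  by (simp add: inner_L2_def inner_commute)

context mesh
begin

definition dirichlet :: "('a \<Rightarrow> real) \<Rightarrow> ('a \<Rightarrow> real) \<Rightarrow> real" where
  "dirichlet v w = inner_L2 lborel \<Omega> (grad \<Omega> v) (grad \<Omega> w)"

lemma nodes_subset: "nodes \<T> \<subseteq> closure \<Omega>"
  unfolding nodes_def Union_tri[symmetric] by (auto simp: extreme_point_of_def)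

lemma S1_nodes_eq: "v \<in> S1 \<T> \<Longrightarrow> w \<in> S1 \<T> \<Longrightarrow> (\<And>z. z \<in> nodes \<T> \<Longrightarrow> v z = w z) \<Longrightarrow> x \<in> closure \<Omega> \<Longrightarrow> v x = w x"
  using S1_eq[OF tri, of v w x] Union_tri by simp

lemma dirichlet_form: "psd_form comb (S1 \<T>) dirichlet"
proof
  show "S1 \<T> \<noteq> {}" using S1_const by blast
  show "comb t v w \<in> S1 \<T>" if "v \<in> S1 \<T>" "w \<in> S1 \<T>" for t v w
    by (rule S1_comb[OF that])
  show "dirichlet (comb t v w) y = dirichlet v y + t * dirichlet w y"
    if "v \<in> S1 \<T>" "w \<in> S1 \<T>" "y \<in> S1 \<T>" for t v w y
    using that S1_comb[OF that(1,2), of t]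
    by (simp add: dirichlet_def inner_grad slope_comb inner_add_left sum_distrib_left sum.distrib[symmetric] algebra_simps)
qed (simp_all add: dirichlet_def inner_L2_commute inner_L2_nonneg)

lemma dirichlet_locally_constant:
  assumes "v \<in> S1 \<T>" "\<And>T. T \<in> \<T> \<Longrightarrow> slope T v = 0"
  shows "dirichlet v v = 0"
  using assms by (simp add: dirichlet_def inner_grad)

lemma dirichlet_zero:
  assumes v: "v \<in> S1 \<T>" and 0: "\<And>z. z \<in> nodes \<T> \<Longrightarrow> v z = 0"
  shows "dirichlet v v = 0"
proof (rule dirichlet_locally_constant[OF v])
  fix T assume T: "T \<in> \<T>"
  have "v x = 0" if "x \<in> T" for x
    using S1_nodes_eq[OF v S1_const[of 0], of x] 0 T that Union_tri by auto
  then show "slope T v = 0" by (intro slope_eqI[OF v T, of _ 0]) simp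
qed

lemma dirichlet_one: "dirichlet (\<lambda>x. 1) (\<lambda>x. 1) = 0"
  by (rule dirichlet_locally_constant[OF S1_const]) (rule slope_eqI[OF S1_const, where a = 0 and b = 1], auto)

text \<open>Every simplex meets \<Omega> in positive volume, so all slopes vanish and
  \<open>v\<close> takes finitely many values; a continuous function with finite range on a
  connected set is constant.\<close>

lemma dirichlet_const:
  assumes v: "v \<in> S1 \<T>" and 0: "dirichlet v v = 0"
  obtains c where "\<And>x. x \<in> closure \<Omega> \<Longrightarrow> v x = c"
proof -
  have pos: "0 < measure lborel (\<Omega> \<inter> interior T)" if T: "T \<in> \<T>" for T
  proof -
    have "interior T \<subseteq> closure \<Omega>" using Union_tri T interior_subset by blast
    then have "\<Omega> \<inter> interior T \<noteq> {}"
      using tri_interior[OF tri full T] open_Int_closure_eq_empty[of "interior T" \<Omega>] by auto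
    then have "0 < emeasure lborel (\<Omega> \<inter> interior T)"
      using open_domain by (intro emeasure_lborel_open_pos) auto
    moreover have "emeasure lborel (\<Omega> \<inter> interior T) < \<infinity>"
      using bounded_domain bounded_Int by (intro emeasure_bounded_finite) blast
    ultimately show ?thesis by (simp add: measure_def enn2real_positive_iff)
  qed
  have "(\<Sum>T\<in>\<T>. measure lborel (\<Omega> \<inter> interior T) * (slope T v \<bullet> slope T v)) = 0"
    using 0 v by (simp add: dirichlet_def inner_grad)
  then have "\<forall>T\<in>\<T>. measure lborel (\<Omega> \<inter> interior T) * (slope T v \<bullet> slope T v) = 0"
    using finite_tri by (subst (asm) sum_nonneg_eq_0_iff) auto
  then have "slope T v = 0" if "T \<in> \<T>" for T using pos[OF that] that by auto
  then have "\<exists>b. \<forall>x\<in>T. v x = b" if "T \<in> \<T>" for T using slope[OF v that] that by auto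
  then obtain b where b: "\<And>T x. T \<in> \<T> \<Longrightarrow> x \<in> T \<Longrightarrow> v x = b T" by metis
  have "v ` closure \<Omega> \<subseteq> b ` \<T>" using b Union_tri by blast
  then have "finite (v ` closure \<Omega>)" using finite_tri finite_surj by blast
  then have "v constant_on closure \<Omega>"
    using connected_domain connected_imp_connected_closure S1_continuous[OF v] continuous_finite_range_constant by blast
  then show ?thesis using that by (auto simp: constant_on_def)
qed

lemma inner_L2_comb:
  fixes u v w :: "'a \<Rightarrow> real"
  assumes "set_integrable M S (\<lambda>x. u x * v x)" "set_integrable M S (\<lambda>x. u x * w x)"
  shows "inner_L2 M S u (comb t v w) = inner_L2 M S u v + t * inner_L2 M S u w"
proof -
  have "inner_L2 M S u (comb t v w) = (LINT x:S|M. u x * v x + t * (u x * w x))"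
    by (simp add: inner_L2_def algebra_simps)
  also have "\<dots> = (LINT x:S|M. u x * v x) + (LINT x:S|M. t * (u x * w x))"
    using assms by (intro set_integral_add) auto
  finally show ?thesis by (simp add: inner_L2_def)
qed

lemma S1_mult_integrable: "v \<in> S1 \<T> \<Longrightarrow> w \<in> S1 \<T> \<Longrightarrow> set_integrable lborel \<Omega> (\<lambda>x. v x * w x)"
  by (intro continuous_integrable continuous_on_mult S1_continuous)

definition H1_form :: "('a \<Rightarrow> real) \<Rightarrow> ('a \<Rightarrow> real) \<Rightarrow> real" where
  "H1_form v w = inner_L2 lborel \<Omega> v w + dirichlet v w"

lemma norm_H1_square: "(norm_H1 \<Omega> v)\<^sup>2 = H1_form v v"
  using inner_L2_nonneg[of lborel \<Omega> v] inner_L2_nonneg[of lborel \<Omega> "grad \<Omega> v"]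
  by (simp add: norm_H1_def H1_form_def dirichlet_def norm_L2_square)

lemma H1_form: "psd_form comb (S1 \<T>) H1_form"
proof -
  interpret d: psd_form comb "S1 \<T>" dirichlet by (rule dirichlet_form)
  show ?thesis
  proof
    show "H1_form (comb t v w) y = H1_form v y + t * H1_form w y"
      if "v \<in> S1 \<T>" "w \<in> S1 \<T>" "y \<in> S1 \<T>" for t v w y
      using d.linear[OF that, of t] inner_L2_comb[OF S1_mult_integrable[OF that(3,1)] S1_mult_integrable[OF that(3,2)], of t]
      by (simp add: H1_form_def inner_L2_commute[of _ _ _ y] algebra_simps)
    show "H1_form v w = H1_form w v" if "v \<in> S1 \<T>" "w \<in> S1 \<T>" for v w
      using d.sym[OF that] by (simp add: H1_form_def inner_L2_commute)
    show "0 \<le> H1_form v v" if "v \<in> S1 \<T>" for v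
      using d.nonneg[OF that] inner_L2_nonneg[of lborel \<Omega> v] by (simp add: H1_form_def)
  qed (use d.nonempty d.closed in auto)
qed

lemma H1_form_zero:
  assumes v: "v \<in> S1 \<T>" and 0: "\<And>z. z \<in> nodes \<T> \<Longrightarrow> v z = 0"
  shows "H1_form v v = 0"
proof -
  have "v x = 0" if "x \<in> \<Omega>" for x
    using S1_nodes_eq[OF v S1_const[of 0], of x] 0 that closure_subset by auto
  then have "(\<lambda>x. indicator \<Omega> x *\<^sub>R (v x \<bullet> v x)) = (\<lambda>x. 0)" by (auto simp: indicator_def)
  then have "inner_L2 lborel \<Omega> v v = 0" by (simp only: inner_L2_def set_lebesgue_integral_def integral_zero)
  then show ?thesis using dirichlet_zero[OF assms] by (simp add: H1_form_def)
qed

end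

section \<open>Boundary data and the nodal form of the algorithm\<close>

locale insulated_domain = mesh \<Omega> \<T> for \<Omega> :: "'a::euclidean_space set" and \<T> +
  fixes \<Gamma>I \<Gamma>N :: "'a set" and \<kappa> \<beta> m :: real and f g uinf :: "'a \<Rightarrow> real"
  assumes relopen: "openin (top_of_set (frontier \<Omega>)) \<Gamma>I" "openin (top_of_set (frontier \<Omega>)) \<Gamma>N"
    and disjoint: "\<Gamma>I \<inter> \<Gamma>N = {}" and nonempty: "\<Gamma>I \<noteq> {}"
    and pos: "\<kappa> > 0" "\<beta> > 0" "m > 0"
    and facets_split: "boundary_facets \<Omega> \<T> = facets_in \<Omega> \<T> \<Gamma>I \<union> facets_in \<Omega> \<T> \<Gamma>N"
    and data: "f \<in> S1 \<T>" "g \<in> S1 (facets_in \<Omega> \<T> \<Gamma>N)" "uinf \<in> S1 (facets_in \<Omega> \<T> \<Gamma>I)"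
    and load: "inner_L2 lborel \<Omega> f (\<lambda>x. 1) + inner_L2 (boundary_measure \<Omega>) \<Gamma>N g (\<lambda>x. 1) \<noteq> 0"
begin

sublocale I: boundary_part \<Omega> \<T> \<Gamma>I
proof
  show "closure \<Gamma>I = \<Union>(facets_in \<Omega> \<T> \<Gamma>I)"
    by (rule closure_boundary_part[OF relopen(1) _ disjoint facets_split]) (use openin_imp_subset[OF relopen(2)] in simp)
qed (rule relopen)

sublocale N: boundary_part \<Omega> \<T> \<Gamma>N
proof
  show "closure \<Gamma>N = \<Union>(facets_in \<Omega> \<T> \<Gamma>N)"
  proof (rule closure_boundary_part[OF relopen(2)])
    show "\<Gamma>I \<subseteq> frontier \<Omega>" using openin_imp_subset[OF relopen(1)] by simp
    show "\<Gamma>N \<inter> \<Gamma>I = {}" using disjoint by blast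
    show "boundary_facets \<Omega> \<T> = facets_in \<Omega> \<T> \<Gamma>N \<union> facets_in \<Omega> \<T> \<Gamma>I"
      unfolding facets_split by (rule Un_commute)
  qed
qed (rule relopen)

definition load_functional :: "('a \<Rightarrow> real) \<Rightarrow> real" where
  "load_functional v = inner_L2 lborel \<Omega> f v + inner_L2 (boundary_measure \<Omega>) \<Gamma>N g v"

lemma part_subset: "\<Gamma>N \<subseteq> closure \<Omega>"
  using openin_imp_subset[OF relopen(2)] by (auto simp: frontier_def)

lemma load_functional_zero:
  assumes v: "v \<in> S1 \<T>" and 0: "\<And>z. z \<in> nodes \<T> \<Longrightarrow> v z = 0"
  shows "load_functional v = 0"
proof -
  have v0: "v x = 0" if "x \<in> closure \<Omega>" for x
    using S1_nodes_eq[OF v S1_const[of 0], of x] 0 that by auto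
  have "(\<lambda>x. indicator \<Omega> x *\<^sub>R (f x \<bullet> v x)) = (\<lambda>x. 0)" "(\<lambda>x. indicator \<Gamma>N x *\<^sub>R (g x \<bullet> v x)) = (\<lambda>x. 0)"
    using v0 closure_subset[of \<Omega>] part_subset by (auto simp: indicator_def fun_eq_iff)
  then have "inner_L2 lborel \<Omega> f v = 0" "inner_L2 (boundary_measure \<Omega>) \<Gamma>N g v = 0"
    by (simp_all only: inner_L2_def set_lebesgue_integral_def integral_zero)
  then show ?thesis by (simp add: load_functional_def)
qed

lemma load_functional_linear:
  assumes v: "v \<in> S1 \<T>" and w: "w \<in> S1 \<T>"
  shows "load_functional (comb t v w) = load_functional v + t * load_functional w"
proof -
  have gint: "set_integrable (boundary_measure \<Omega>) \<Gamma>N (\<lambda>x. g x * y x)" if "y \<in> S1 \<T>" for y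
    by (intro N.integrable_part continuous_on_mult N.S1_part_continuous data S1_facets_in that)
  show ?thesis
    unfolding load_functional_def
    using inner_L2_comb[OF S1_mult_integrable[OF data(1) v] S1_mult_integrable[OF data(1) w], of t]
      inner_L2_comb[OF gint[OF v] gint[OF w], of t] by (simp add: algebra_simps)
qed

text \<open>Without nodes the constants 0 and 1 would agree on the closure of the nonempty part,
  since nodal values determine functions of \<open>S1\<close>.\<close>

lemma Z_nonempty: "I.Z \<noteq> {}"
proof
  assume Z: "I.Z = {}"
  obtain x where "x \<in> \<Gamma>I" using nonempty by auto
  then have "x \<in> closure \<Gamma>I" using closure_subset by blast
  then have "(0::real) = 1"
    using I.S1_part_eq[OF S1_const[of 0] S1_const[of 1], of x] Z by auto
  then show False by simp
qed

sublocale P: insulation_problem "S1 \<T>" "nodes \<T>" I.Z I.weight dirichlet load_functional \<kappa> \<beta> m uinf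
proof (rule insulation_problem.intro)
  show "psd_form comb (S1 \<T>) dirichlet" by (rule dirichlet_form)
  show "finite (nodes \<T>)" by (rule finite_nodes[OF tri])
  show "I.Z \<noteq> {}" by (rule Z_nonempty)
  show "\<exists>c. \<forall>z\<in>nodes \<T>. v z = c" if v: "v \<in> S1 \<T>" "dirichlet v v = 0" for v
  proof -
    obtain c where "\<And>x. x \<in> closure \<Omega> \<Longrightarrow> v x = c" using dirichlet_const[OF v] by blast
    then show ?thesis using nodes_subset by blast
  qed
  show "load_functional (\<lambda>x. 1) \<noteq> 0" using load by (simp add: load_functional_def)
  show "0 < I.weight z" if "z \<in> I.Z" for z by (rule I.weight_pos[OF that])
  show "dirichlet v v = 0" if "v \<in> S1 \<T>" "\<And>z. z \<in> nodes \<T> \<Longrightarrow> v z = 0" for v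
    by (rule dirichlet_zero[OF that])
  show "load_functional v = 0" if "v \<in> S1 \<T>" "\<And>z. z \<in> nodes \<T> \<Longrightarrow> v z = 0" for v
    by (rule load_functional_zero[OF that])
  show "load_functional (comb t v w) = load_functional v + t * load_functional w"
    if "v \<in> S1 \<T>" "w \<in> S1 \<T>" for t v w by (rule load_functional_linear[OF that])
  show "(\<lambda>x. c) \<in> S1 \<T>" for c by (rule S1_const)
  show "dirichlet (\<lambda>x. 1) (\<lambda>x. 1) = 0" by (rule dirichlet_one)
qed (rule pos Int_lower1)+

text \<open>Step 2 prescribes the density on \<open>\<Gamma>I\<close>, while nodes may lie anywhere
  in its closure; continuity bridges the difference.\<close>

lemma part_closure_eq:
  assumes "continuous_on (closure \<Gamma>I) v" "continuous_on (closure \<Gamma>I) w"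
    and "\<And>x. x \<in> \<Gamma>I \<Longrightarrow> v x = (w x :: real)" and "x \<in> closure \<Gamma>I"
  shows "v x = w x"
proof -
  have "v x - w x = 0"
    by (rule continuous_constant_on_closure[of \<Gamma>I "\<lambda>x. v x - w x"])
      (use assms in \<open>auto intro!: continuous_intros\<close>)
  then show ?thesis by simp
qed

lemma admissible_iff: "\<eta> \<in> admissible \<Omega> \<T> \<Gamma>I m \<longleftrightarrow> \<eta> \<in> S1 (facets_in \<Omega> \<T> \<Gamma>I) \<and> \<eta> \<in> P.adm"
proof -
  have "(\<forall>x\<in>\<Gamma>I. 0 \<le> \<eta> x) \<longleftrightarrow> (\<forall>z\<in>I.Z. 0 \<le> \<eta> z)" if \<eta>: "\<eta> \<in> S1 (facets_in \<Omega> \<T> \<Gamma>I)"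
  proof
    assume nn: "\<forall>x\<in>\<Gamma>I. 0 \<le> \<eta> x"
    show "\<forall>z\<in>I.Z. 0 \<le> \<eta> z"
      using continuous_ge_on_closure[OF I.S1_part_continuous[OF \<eta>], of _ 0] nn by blast
  next
    assume "\<forall>z\<in>I.Z. 0 \<le> \<eta> z"
    then show "\<forall>x\<in>\<Gamma>I. 0 \<le> \<eta> x" using I.S1_part_nonneg[OF \<eta>] closure_subset by blast
  qed
  then show ?thesis by (auto simp: admissible_def P.adm_def I.inner_h_eq)
qed

lemma energy_eq:
  assumes "\<eta> \<in> admissible \<Omega> \<T> \<Gamma>I m"
  shows "energy \<Omega> \<Gamma>I \<Gamma>N \<T> \<kappa> \<beta> m f g uinf v \<eta> = ereal (P.en v \<eta>)"
proof -
  have \<eta>: "\<eta> \<in> P.adm" using assms by (simp add: admissible_iff)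
  have "((1 + \<beta> * \<eta> z) powr (- 1 / 2) * (v z - uinf z))\<^sup>2 = (v z - uinf z)\<^sup>2 / (1 + \<beta> * \<eta> z)" if z: "z \<in> I.Z" for z
  proof -
    have s: "0 < 1 + \<beta> * \<eta> z" using P.adm_pos[OF \<eta> z] by simp
    have "((1 + \<beta> * \<eta> z) powr (- 1 / 2))\<^sup>2 = (1 + \<beta> * \<eta> z) powr (- 1)"
      using s by (simp only: power2_eq_square powr_add[symmetric]) simp
    also have "\<dots> = 1 / (1 + \<beta> * \<eta> z)" using s by (simp add: powr_minus_divide)
    finally show ?thesis by (simp only: power_mult_distrib times_divide_eq_left mult_1_left)
  qed
  then have "(norm_h \<Omega> \<T> \<Gamma>I (\<lambda>x. (1 + \<beta> * \<eta> x) powr (- 1 / 2) * (v x - uinf x)))\<^sup>2 =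
      (\<Sum>z\<in>I.Z. I.weight z * ((v z - uinf z)\<^sup>2 / (1 + \<beta> * \<eta> z)))"
    unfolding I.norm_h_square by (intro sum.cong) auto
  then show ?thesis
    using assms by (simp add: energy_def P.en_def norm_L2_square dirichlet_def load_functional_def)
qed

lemma bcd_step1_iff: "bcd_step1 \<Omega> \<Gamma>I \<T> \<beta> m uinf u c \<longleftrightarrow> P.step1 u c"
proof -
  have "norm_L1 (boundary_measure \<Omega>) \<Gamma>I (interp \<Omega> \<T> \<Gamma>I (\<lambda>x. max (\<bar>u x - uinf x\<bar> - c) 0)) =
      (\<Sum>z\<in>I.Z. I.weight z * max (\<bar>u z - uinf z\<bar> - c) 0)"
    by (rule I.norm_L1_interp) simp
  then show ?thesis using pos by (auto simp: bcd_step1_def P.step1_def field_simps)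
qed

lemma bcd_step2D:
  assumes "bcd_step2 \<Omega> \<Gamma>I \<T> \<beta> m uinf u c d"
  shows "d \<in> S1 (facets_in \<Omega> \<T> \<Gamma>I)" "P.step2 u c d"
proof -
  show d: "d \<in> S1 (facets_in \<Omega> \<T> \<Gamma>I)" using assms by (simp add: bcd_step2_def admissible_def)
  let ?w = "interp \<Omega> \<T> \<Gamma>I (\<lambda>y. max (\<bar>u y - uinf y\<bar> - c) 0)"
  have "d x = 1 / (c * \<beta>) * ?w x" if "x \<in> closure \<Gamma>I" for x
    by (rule part_closure_eq[OF I.S1_part_continuous[OF d] _ _ that])
      (use assms in \<open>auto simp: bcd_step2_def simp del: times_divide_eq_left
        intro!: I.S1_part_continuous S1_cmult I.interp\<close>)
  then show "P.step2 u c d" using I.interp(2) by (simp add: P.step2_def)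
qed

lemma bcd_step2_exists:
  assumes "P.step1 u c"
  obtains d where "bcd_step2 \<Omega> \<Gamma>I \<T> \<beta> m uinf u c d"
proof -
  define d where "d x = 1 / (c * \<beta>) * interp \<Omega> \<T> \<Gamma>I (\<lambda>y. max (\<bar>u y - uinf y\<bar> - c) 0) x" for x
  have S1: "d \<in> S1 (facets_in \<Omega> \<T> \<Gamma>I)" unfolding d_def by (rule S1_cmult[OF I.interp(1)])
  have "P.step2 u c d" using I.interp(2) by (simp add: P.step2_def d_def)
  then have "d \<in> admissible \<Omega> \<T> \<Gamma>I m" using P.step2_adm[OF assms] S1 by (simp add: admissible_iff)
  then show ?thesis using that[of d] by (simp add: bcd_step2_def d_def)
qed

lemma bcd_step3_iff: "bcd_step3 \<Omega> \<Gamma>I \<Gamma>N \<T> \<kappa> \<beta> f g uinf d u \<longleftrightarrow> P.step3 d u"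
proof -
  have "inner_h \<Omega> \<T> \<Gamma>I (\<lambda>x. inverse (1 + \<beta> * d x) * (u x - uinf x)) v =
      (\<Sum>z\<in>I.Z. I.weight z * ((u z - uinf z) * v z / (1 + \<beta> * d z)))" for v
    unfolding I.inner_h_eq by (intro sum.cong) (auto simp: divide_inverse)
  then show ?thesis by (simp add: bcd_step3_def P.step3_def dirichlet_def load_functional_def)
qed

end

context insulation_problem
begin

lemma adm_cong: "(\<And>z. z \<in> Z \<Longrightarrow> \<eta> z = \<eta>' z) \<Longrightarrow> \<eta> \<in> adm \<Longrightarrow> \<eta>' \<in> adm"
  unfolding adm_def by (simp cong: sum.cong)

lemma en_cong: "(\<And>z. z \<in> Z \<Longrightarrow> \<eta> z = \<eta>' z) \<Longrightarrow> en v \<eta> = en v \<eta>'"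
  unfolding en_def by (simp cong: sum.cong)

end

section \<open>Runs of the algorithm\<close>

context insulated_domain
begin

abbreviation run where "run \<equiv> bcd_run \<Omega> \<Gamma>I \<Gamma>N \<T> \<kappa> \<beta> m f g uinf"

abbreviation E where "E \<equiv> energy \<Omega> \<Gamma>I \<Gamma>N \<T> \<kappa> \<beta> m f g uinf"

lemma run_iff: "run n u C d \<longleftrightarrow> u 0 \<in> S1 \<T> \<and> (\<forall>i<n. P.step1 (u i) (C i) \<and>
    bcd_step2 \<Omega> \<Gamma>I \<T> \<beta> m uinf (u i) (C i) (d i) \<and> P.step3 (d i) (u (Suc i)))"
  by (simp add: bcd_run_def bcd_step1_iff bcd_step3_iff)

text \<open>Dependent choice needs an invariant that keeps Step 1 solvable: the iterate differs from
  \<open>uinf\<close> at some boundary node. For \<open>u0\<close> a difference on the closure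
  passes to a node, since both functions are piecewise affine there; for later iterates it follows
  from the load condition.\<close>

lemma run_exists:
  assumes u0: "u0 \<in> S1 \<T>" and ne: "\<exists>x\<in>closure \<Gamma>I. u0 x \<noteq> uinf x"
  shows "\<exists>u C d. u 0 = u0 \<and> (\<forall>n. run n u C d)"
proof -
  \<comment> \<open>The clause for \<open>n = 0\<close> builds the prescribed start into the
    predicate used for dependent choice.\<close>
  define good where "good n u \<longleftrightarrow> u \<in> S1 \<T> \<and> (\<exists>z\<in>I.Z. u z \<noteq> uinf z) \<and> (n = (0::nat) \<longrightarrow> u = u0)" for n u
  define step where "step u u' \<longleftrightarrow>
    (\<exists>c d. P.step1 u c \<and> bcd_step2 \<Omega> \<Gamma>I \<T> \<beta> m uinf u c d \<and> P.step3 d u')" for u u'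
  have "\<exists>z\<in>I.Z. u0 z \<noteq> uinf z"
    using I.S1_part_eq[OF S1_facets_in[OF u0] data(3)] ne by blast
  then have "\<exists>u. good 0 u" using u0 by (auto simp: good_def)
  moreover have "\<exists>u'. good (Suc n) u' \<and> step u u'" if u: "good n u" for n u
  proof -
    obtain c where c: "P.step1 u c" using P.step1_exists u unfolding good_def by blast
    obtain d where d: "bcd_step2 \<Omega> \<Gamma>I \<T> \<beta> m uinf u c d" using bcd_step2_exists[OF c] by blast
    obtain u' where u': "P.step3 d u'"
      using P.step3_exists[OF P.step2_adm[OF c bcd_step2D(2)[OF d]]] by blast
    have "good (Suc n) u'"
      using P.step3_nontrivial[OF u'] u' by (simp add: good_def P.step3_def)
    then show ?thesis using c d u' unfolding step_def by blast
  qed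
  ultimately obtain u where u: "\<And>n. good n (u n) \<and> step (u n) (u (Suc n))"
    using dependent_nat_choice[of good "\<lambda>_. step"] by blast
  then have "\<forall>n. \<exists>c d. P.step1 (u n) c \<and> bcd_step2 \<Omega> \<Gamma>I \<T> \<beta> m uinf (u n) c d \<and> P.step3 d (u (Suc n))"
    unfolding step_def by blast
  then obtain C d where "\<forall>n. P.step1 (u n) (C n) \<and> bcd_step2 \<Omega> \<Gamma>I \<T> \<beta> m uinf (u n) (C n) (d n) \<and> P.step3 (d n) (u (Suc n))"
    by metis
  moreover have "u 0 = u0" using u[of 0] by (simp add: good_def)
  ultimately have "u 0 = u0 \<and> (\<forall>n. run n u C d)" using u0 by (simp add: run_iff)
  then show ?thesis by blast
qed

text \<open>Iterates are compared on the closures, as their values elsewhere are arbitrary.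
  Agreement of \<open>u i\<close> on the closure of \<Omega> determines a whole pass, so it
  propagates by induction.\<close>

lemma run_unique:
  assumes run: "run n u C d" "run n u' C' d'" and init: "u 0 = u' 0" and i: "i < n"
  shows "C i = C' i" "x \<in> closure \<Gamma>I \<Longrightarrow> d i x = d' i x" "x \<in> closure \<Omega> \<Longrightarrow> u (Suc i) x = u' (Suc i) x"
proof -
  have Zc: "I.Z \<subseteq> closure \<Omega>" using nodes_subset by blast
  have one: "C i = C' i \<and> (\<forall>x\<in>closure \<Gamma>I. d i x = d' i x) \<and> (\<forall>x\<in>closure \<Omega>. u (Suc i) x = u' (Suc i) x)"
    if i: "i < n" and eq: "\<forall>x\<in>closure \<Omega>. u i x = u' i x" for i
  proof -
    have s: "P.step1 (u i) (C i)" "bcd_step2 \<Omega> \<Gamma>I \<T> \<beta> m uinf (u i) (C i) (d i)" "P.step3 (d i) (u (Suc i))"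
      and s': "P.step1 (u' i) (C' i)" "bcd_step2 \<Omega> \<Gamma>I \<T> \<beta> m uinf (u' i) (C' i) (d' i)" "P.step3 (d' i) (u' (Suc i))"
      using run i by (auto simp: run_iff)
    have eqZ: "u i z = u' i z" if "z \<in> I.Z" for z using eq Zc that by blast
    have C: "C i = C' i" by (rule P.step1_unique[OF s(1) s'(1) eqZ])
    have dZ: "d i z = d' i z" if "z \<in> I.Z" for z
      using bcd_step2D(2)[OF s(2)] bcd_step2D(2)[OF s'(2)] eqZ[OF that] C that by (simp add: P.step2_def)
    have d: "d i x = d' i x" if "x \<in> closure \<Gamma>I" for x
      by (rule I.S1_part_eq[OF bcd_step2D(1)[OF s(2)] bcd_step2D(1)[OF s'(2)] dZ that])
    have adm: "d' i \<in> P.adm" by (rule P.step2_adm[OF s'(1) bcd_step2D(2)[OF s'(2)]])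
    have "u (Suc i) z = u' (Suc i) z" if "z \<in> nodes \<T>" for z
      by (rule P.step3_unique[OF adm P.step3_cong[OF dZ s(3)] s'(3) that])
    then have "u (Suc i) x = u' (Suc i) x" if "x \<in> closure \<Omega>" for x
      using S1_nodes_eq[of "u (Suc i)" "u' (Suc i)" x] s(3) s'(3) that by (simp add: P.step3_def)
    then show ?thesis using C d by blast
  qed
  have "\<forall>x\<in>closure \<Omega>. u i x = u' i x" if "i < n" for i
    using that
  proof (induction i)
    case (Suc i)
    then show ?case using one[of i] by simp
  qed (use init in simp)
  with one[OF i] i show "C i = C' i" "x \<in> closure \<Gamma>I \<Longrightarrow> d i x = d' i x"
    "x \<in> closure \<Omega> \<Longrightarrow> u (Suc i) x = u' (Suc i) x" by blast+
qed

text \<open>A nodal competitor need not lie in \<open>S1\<close>; interpolation replaces it without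
  changing mass or energy.\<close>

lemma minimizer_nodal:
  assumes "is_minimizer \<Omega> \<Gamma>I \<Gamma>N \<T> \<kappa> \<beta> m f g uinf u d"
  shows "u \<in> S1 \<T>" "d \<in> admissible \<Omega> \<T> \<Gamma>I m" "v \<in> S1 \<T> \<Longrightarrow> \<eta> \<in> P.adm \<Longrightarrow> P.en u d \<le> P.en v \<eta>"
proof -
  show u: "u \<in> S1 \<T>" and d: "d \<in> admissible \<Omega> \<T> \<Gamma>I m" using assms by (auto simp: is_minimizer_def)
  assume v: "v \<in> S1 \<T>" and \<eta>: "\<eta> \<in> P.adm"
  let ?\<eta> = "interp \<Omega> \<T> \<Gamma>I \<eta>"
  have S: "?\<eta> \<in> S1 (facets_in \<Omega> \<T> \<Gamma>I)" by (rule I.interp)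
  have "?\<eta> \<in> P.adm" by (rule P.adm_cong[OF _ \<eta>]) (simp add: I.interp(2))
  then have "?\<eta> \<in> admissible \<Omega> \<T> \<Gamma>I m" using S by (simp add: admissible_iff)
  moreover have "E u d \<le> E v ?\<eta>" using assms v S by (simp add: is_minimizer_def)
  ultimately have "P.en u d \<le> P.en v ?\<eta>" using d by (simp add: energy_eq)
  also have "\<dots> = P.en v \<eta>" by (rule P.en_cong) (simp add: I.interp(2))
  finally show "P.en u d \<le> P.en v \<eta>" .
qed

text \<open>If the nodal equation held at every node, the interpolant of \<open>\<xi>\<close> would
  be a competitor at distance 0 in the infimum.\<close>

lemma nondegeneracy_nodal:
  assumes pos: "nondegeneracy_dist \<Omega> \<Gamma>I \<T> \<beta> uinf u d > 0"
    and \<xi>: "(\<Sum>z\<in>I.Z. I.weight z * \<xi> z) = 0"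
  shows "\<exists>z\<in>I.Z. \<beta> * (u z - uinf z) / (1 + \<beta> * d z) * \<xi> z \<noteq> 1"
proof (rule ccontr)
  assume 1: "\<not> ?thesis"
  let ?\<xi> = "interp \<Omega> \<T> \<Gamma>I \<xi>"
  let ?X = "{\<xi> \<in> S1 (facets_in \<Omega> \<T> \<Gamma>I). inner_h \<Omega> \<T> \<Gamma>I \<xi> (\<lambda>x. 1) = 0}"
  let ?r = "\<lambda>\<xi> x. 1 - \<beta> * (u x - uinf x) / (1 + \<beta> * d x) * \<xi> x"
  have "inner_h \<Omega> \<T> \<Gamma>I ?\<xi> (\<lambda>x. 1) = 0"
    using \<xi> by (simp add: I.inner_h_eq I.interp(2))
  then have mem: "?\<xi> \<in> ?X" using I.interp(1) by simp
  have "0 \<le> norm_h \<Omega> \<T> \<Gamma>I v" for v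
  proof -
    have "0 \<le> inner_h \<Omega> \<T> \<Gamma>I v v"
      unfolding I.inner_h_eq by (rule sum_nonneg) (rule mult_nonneg_nonneg[OF less_imp_le[OF I.weight_pos] zero_le_square])
    then show ?thesis by (simp add: norm_h_def)
  qed
  then have "bdd_below ((\<lambda>\<xi>. norm_h \<Omega> \<T> \<Gamma>I (?r \<xi>)) ` ?X)" by (intro bdd_belowI[of _ 0]) blast
  then have "nondegeneracy_dist \<Omega> \<Gamma>I \<T> \<beta> uinf u d \<le> norm_h \<Omega> \<T> \<Gamma>I (?r ?\<xi>)"
    unfolding nondegeneracy_dist_def by (rule cINF_lower[OF _ mem])
  moreover have "(norm_h \<Omega> \<T> \<Gamma>I (?r ?\<xi>))\<^sup>2 = 0"
    unfolding I.norm_h_square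
  proof (rule sum.neutral, rule ballI)
    fix z assume z: "z \<in> I.Z"
    then have eq: "\<beta> * (u z - uinf z) / (1 + \<beta> * d z) * \<xi> z = 1" using 1 by blast
    show "I.weight z * (?r ?\<xi> z)\<^sup>2 = 0" unfolding I.interp(2)[OF z] eq by simp
  qed
  ultimately show False using pos by simp
qed

lemma run_linear_convergence:
  assumes min: "is_minimizer \<Omega> \<Gamma>I \<Gamma>N \<T> \<kappa> \<beta> m f g uinf u\<^sub>h d\<^sub>h"
    and nondeg: "nondegeneracy_dist \<Omega> \<Gamma>I \<T> \<beta> uinf u\<^sub>h d\<^sub>h > 0" and L: "L > 0"
  shows "\<exists>\<sigma>>0. \<forall>u C d. (\<forall>n. run n u C d) \<longrightarrow>
    (\<forall>i. ereal (\<sigma> * (norm_H1 \<Omega> (\<lambda>x. u i x - u\<^sub>h x))\<^sup>2) \<le> E (u i) (d i) - E u\<^sub>h d\<^sub>h \<and>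
         E (u i) (d i) - E u\<^sub>h d\<^sub>h \<le> ereal ((1 - \<sigma> / (8 * L)) ^ i) * (E (u 0) (d 0) - E u\<^sub>h d\<^sub>h))"
proof -
  note m = minimizer_nodal[OF min]
  have d\<^sub>h: "d\<^sub>h \<in> P.adm" using m(2) by (simp add: admissible_iff)
  obtain \<sigma> where \<sigma>: "\<sigma> > 0" "\<And>w C e i. (\<And>i. w i \<in> S1 \<T> \<and> P.step1 (w i) (C i) \<and> P.step2 (w i) (C i) (e i) \<and> P.step3 (e i) (w (Suc i))) \<Longrightarrow>
      \<sigma> * H1_form (\<lambda>x. w i x - u\<^sub>h x) (\<lambda>x. w i x - u\<^sub>h x) \<le> P.en (w i) (e i) - P.en u\<^sub>h d\<^sub>h \<and>
      P.en (w i) (e i) - P.en u\<^sub>h d\<^sub>h \<le> (1 - \<sigma> / (8 * L)) ^ i * (P.en (w 0) (e 0) - P.en u\<^sub>h d\<^sub>h)"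
    using P.linear_convergence[OF m(1) d\<^sub>h m(3) nondegeneracy_nodal[OF nondeg] H1_form H1_form_zero L] by blast
  show ?thesis
  proof (intro exI[of _ \<sigma>] conjI[OF \<sigma>(1)] allI impI)
    fix u C d i assume run: "\<forall>n. run n u C d"
    \<comment> \<open>A run of length \<open>n\<close> records the passes below \<open>n\<close>, so
      pass \<open>i\<close> is read off the run of length \<open>Suc i\<close>.\<close>
    have s: "P.step1 (u i) (C i)" "bcd_step2 \<Omega> \<Gamma>I \<T> \<beta> m uinf (u i) (C i) (d i)" "P.step3 (d i) (u (Suc i))" for i
      using run[rule_format, of "Suc i"] by (auto simp: run_iff)
    have uV: "u i \<in> S1 \<T>" for i
      using run s(3)[of "i - 1"] by (cases i) (auto simp: run_iff P.step3_def)
    have "E (u i) (d i) = ereal (P.en (u i) (d i))" for i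
      using s(2)[of i] by (intro energy_eq) (simp add: bcd_step2_def)
    moreover have "E u\<^sub>h d\<^sub>h = ereal (P.en u\<^sub>h d\<^sub>h)" by (rule energy_eq[OF m(2)])
    moreover have "u i \<in> S1 \<T> \<and> P.step1 (u i) (C i) \<and> P.step2 (u i) (C i) (d i) \<and> P.step3 (d i) (u (Suc i))" for i
      using uV s bcd_step2D(2) by blast
    note \<sigma>(2)[of u C d i, OF this]
    ultimately show "ereal (\<sigma> * (norm_H1 \<Omega> (\<lambda>x. u i x - u\<^sub>h x))\<^sup>2) \<le> E (u i) (d i) - E u\<^sub>h d\<^sub>h \<and>
        E (u i) (d i) - E u\<^sub>h d\<^sub>h \<le> ereal ((1 - \<sigma> / (8 * L)) ^ i) * (E (u 0) (d 0) - E u\<^sub>h d\<^sub>h)"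
      by (simp add: norm_H1_square)
  qed
qed

end

text \<open>If \<open>u0\<close> equals \<open>uinf\<close> on the closure of
  \<open>\<Gamma>I\<close>, the right-hand side of Step 1 vanishes for every positive constant and
  no such constant solves it; hence the premise on \<open>u0\<close>. Quantifying \<sigma> before
  the runs makes it independent of the initial iterate as well as of \<open>i\<close>.\<close>

theorem theoremC2:
  fixes \<Omega> \<Gamma>I \<Gamma>N :: "(real ^ 'n) set"
    and \<F> :: "(real ^ 'n) set set set" and \<T> :: "(real ^ 'n) set set"
    and \<kappa> \<beta> m cTr :: real
    and f g uinf u\<^sub>h d\<^sub>h :: "real ^ 'n \<Rightarrow> real"
  assumes dim: "CARD('n) = 2 \<or> CARD('n) = 3"
    and domain: "bounded_polyhedral_lipschitz_domain \<Omega>"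
    and relopen: "openin (top_of_set (frontier \<Omega>)) \<Gamma>I" "openin (top_of_set (frontier \<Omega>)) \<Gamma>N"
    and disjoint: "\<Gamma>I \<inter> \<Gamma>N = {}" and nonempty: "\<Gamma>I \<noteq> {}"
    and cover: "frontier \<Omega> = closure \<Gamma>I \<union> closure \<Gamma>N"
    and pos: "\<kappa> > 0" "\<beta> > 0" "m > 0"
    and trace: "trace_constant \<Omega> cTr"
    and mesh: "shape_regular_family \<F> \<Omega>" "\<T> \<in> \<F>"
    and facets_split: "boundary_facets \<Omega> \<T> = facets_in \<Omega> \<T> \<Gamma>I \<union> facets_in \<Omega> \<T> \<Gamma>N"
    and facets_disjoint: "facets_in \<Omega> \<T> \<Gamma>I \<inter> facets_in \<Omega> \<T> \<Gamma>N = {}"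
    and data: "f \<in> S1 \<T>" "g \<in> S1 (facets_in \<Omega> \<T> \<Gamma>N)" "uinf \<in> S1 (facets_in \<Omega> \<T> \<Gamma>I)"
    and load: "inner_L2 lborel \<Omega> f (\<lambda>x. 1) + inner_L2 (boundary_measure \<Omega>) \<Gamma>N g (\<lambda>x. 1) \<noteq> 0"
    and minimizer: "is_minimizer \<Omega> \<Gamma>I \<Gamma>N \<T> \<kappa> \<beta> m f g uinf u\<^sub>h d\<^sub>h"
  shows
    "(\<forall>u0 \<in> S1 \<T>. (\<exists>x \<in> closure \<Gamma>I. u0 x \<noteq> uinf x) \<longrightarrow>
        (\<exists>u C d. u 0 = u0 \<and> (\<forall>n. bcd_run \<Omega> \<Gamma>I \<Gamma>N \<T> \<kappa> \<beta> m f g uinf n u C d)) \<and>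
        (\<forall>n u C d u' C' d'.
           u 0 = u0 \<and> bcd_run \<Omega> \<Gamma>I \<Gamma>N \<T> \<kappa> \<beta> m f g uinf n u C d \<and>
           u' 0 = u0 \<and> bcd_run \<Omega> \<Gamma>I \<Gamma>N \<T> \<kappa> \<beta> m f g uinf n u' C' d' \<longrightarrow>
           (\<forall>i<n. C i = C' i \<and> (\<forall>x \<in> closure \<Gamma>I. d i x = d' i x) \<and>
                  (\<forall>x \<in> closure \<Omega>. u (Suc i) x = u' (Suc i) x))))
     \<and>
     (nondegeneracy_dist \<Omega> \<Gamma>I \<T> \<beta> uinf u\<^sub>h d\<^sub>h > 0 \<longrightarrow>
       (let L = \<kappa> + cTr\<^sup>2 * \<beta> * (real CARD('n) + 1);
            E = energy \<Omega> \<Gamma>I \<Gamma>N \<T> \<kappa> \<beta> m f g uinf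
        in L > 0 \<and>
           (\<exists>\<sigma>>0. \<forall>u C d. (\<forall>n. bcd_run \<Omega> \<Gamma>I \<Gamma>N \<T> \<kappa> \<beta> m f g uinf n u C d) \<longrightarrow>
              (\<forall>i. ereal (\<sigma> * (norm_H1 \<Omega> (\<lambda>x. u i x - u\<^sub>h x))\<^sup>2) \<le> E (u i) (d i) - E u\<^sub>h d\<^sub>h \<and>
                   E (u i) (d i) - E u\<^sub>h d\<^sub>h
                     \<le> ereal ((1 - \<sigma> / (8 * L)) ^ i) * (E (u 0) (d 0) - E u\<^sub>h d\<^sub>h)))))"
proof -
  have triangulates: "triangulates \<T> \<Omega>" using mesh by (auto simp: shape_regular_family_def)
  interpret insulated_domain \<Omega> \<T> \<Gamma>I \<Gamma>N \<kappa> \<beta> m f g uinf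
    by unfold_locales (fact domain triangulates relopen disjoint nonempty pos facets_split data load)+
  let ?L = "\<kappa> + cTr\<^sup>2 * \<beta> * (real CARD('n) + 1)"
  have L: "?L > 0" using pos by (simp add: add_pos_nonneg)
  show ?thesis
    unfolding Let_def
  proof (intro conjI ballI impI)
    fix u0 assume u0: "u0 \<in> S1 \<T>" "\<exists>x\<in>closure \<Gamma>I. u0 x \<noteq> uinf x"
    show "\<exists>u C d. u 0 = u0 \<and> (\<forall>n. run n u C d)" by (rule run_exists[OF u0])
    show "\<forall>n u C d u' C' d'. u 0 = u0 \<and> run n u C d \<and> u' 0 = u0 \<and> run n u' C' d' \<longrightarrow>
      (\<forall>i<n. C i = C' i \<and> (\<forall>x\<in>closure \<Gamma>I. d i x = d' i x) \<and> (\<forall>x\<in>closure \<Omega>. u (Suc i) x = u' (Suc i) x))"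
    proof (intro allI impI conjI ballI; elim conjE)
      fix n i and u C d u' C' d'
      assume r: "u 0 = u0" "run n u C d" "u' 0 = u0" "run n u' C' d'" and i: "i < n"
      have init: "u 0 = u' 0" using r by simp
      show "C i = C' i" by (rule run_unique(1)[OF r(2,4) init i])
      show "d i x = d' i x" if "x \<in> closure \<Gamma>I" for x by (rule run_unique(2)[OF r(2,4) init i that])
      show "u (Suc i) x = u' (Suc i) x" if "x \<in> closure \<Omega>" for x by (rule run_unique(3)[OF r(2,4) init i that])
    qed
  next
    show "?L > 0" by (rule L)
  next
    assume "nondegeneracy_dist \<Omega> \<Gamma>I \<T> \<beta> uinf u\<^sub>h d\<^sub>h > 0"
    from run_linear_convergence[OF minimizer this L] show "\<exists>\<sigma>>0. \<forall>u C d. (\<forall>n. run n u C d) \<longrightarrow>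
      (\<forall>i. ereal (\<sigma> * (norm_H1 \<Omega> (\<lambda>x. u i x - u\<^sub>h x))\<^sup>2) \<le> E (u i) (d i) - E u\<^sub>h d\<^sub>h \<and>
        E (u i) (d i) - E u\<^sub>h d\<^sub>h \<le> ereal ((1 - \<sigma> / (8 * ?L)) ^ i) * (E (u 0) (d 0) - E u\<^sub>h d\<^sub>h))" .
  qed
qed

end
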